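(* Assume that there exists an accessible point $x^{\ast}\in M$ at which the weak Hörmander condition is satisfied, and let $Q\in\mathcal{Q}$. Then the stationary density $\pi^Q$ of $PDMP(Q)$ (with respect to Lebesgue measure on $M\times E$) is a $[0,\infty]$-valued lower semi-continuous function; that is, $\pi^Q$ has a version that is a lower semi-continuous function $M\times E\to[0,\infty]$.
   Context: Setting. Let $E=\{1,\ldots,n\}$ and let $v^1,\ldots,v^n$ be bounded $C^\infty$ vector fields on $\mathbb{R}^d$. For $i\in E$ let $\varphi^i_t$ ($t\in\mathbb{R}$) be the flow of $v^i$: $\varphi^i_t(x)=x_t$ where $x_0=x$, $\dot x_t=v^i(x_t)$. Let $M\subset\mathbb{R}^d$ be a compact set which is forward invariant under all the flows: $\varphi^i_t(x)\in M$ for all $i\in E$, $x\in M$, $t\ge 0$. Process. A rate matrix $Q$ on $E$ is an $n\times n$ matrix with $Q_{ij}\ge 0$ for $i\ne j$ and $Q_{ii}=-\sum_{j\neq i}Q_{ij}$. $\mathcal{Q}$ is the set of rate matrices on $E$ all of whose off-diagonal entries are strictly positive. For $Q\in\mathcal{Q}$, $(I_t)_{t\ge0}$ is the continuous-time Markov chain on $E$ jumping from $i$ to $j$ at rate $Q_{ij}$, and $X_t$ solves $\dot X_t=v^{I_t}(X_t)$, $X_0\in M$. The Markov process $(X_t,I_t)_{t\ge 0}$ on $M\times E$ is denoted $PDMP(Q)$. Accessibility. For $\underline{i}=(i_1,\ldots,i_\ell)\in E^\ell$ and $\underline{t}=(t_1,\ldots,t_\ell)\in\mathbb{R}_{\ge0}^\ell$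 let $\Phi^{\underline{i}}(x,\underline{t})=\varphi^{i_\ell}_{t_\ell}\circ\cdots\circ\varphi^{i_1}_{t_1}(x)$. A point $x^\ast$ is accessible if for every open neighbourhood $U\ni x^\ast$ and every $x\in M$ there exist $1\le\ell<\infty$, $\underline{i}\in E^\ell$, $\underline{t}\in\mathbb{R}_{\ge0}^\ell$ with $\Phi^{\underline{i}}(x,\underline{t})\in U$. Bracket condition. Let $[V,W]$ be the Lie bracket of vector fields, $\mathcal{V}_0=\{v^i:i\in E\}$, $\mathcal{V}_{k+1}=\{[v,w]:v\in\mathcal{V}_0,\ w\in\mathcal{V}_k\}\cup\mathcal{V}_k$, $\mathcal{V}_\infty=\bigcup_k\mathcal{V}_k$, $\mathcal{V}_k(x)=\{V(x):V\in\mathcal{V}_k\}$ for $0\le k\le\infty$. The weak Hörmander condition holds at $x$ if $\mathrm{span}(\mathcal{V}_\infty(x))=\mathbb{R}^d$. Stationary density. Under the hypothesis of the theorem it is known that for every $Q\in\mathcal{Q}$, $PDMP(Q)$ has a unique stationary distribution, and it is absolutely continuous with respect to Lebesgue measure on $M\times E$ (Lebesgue measure on each copy $M\times\{i\}$); both the distribution and its density are denoted $\pi^Q$. Convention: saying that an $L^1$ density belongs to a class of functions means that some version of it (equal to it Lebesgue-a.e.) belongs to that class. *)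

theory Defs
  imports "HOL-Probability.Probability"
begin

section \<open>Smooth vector fields, flows and Lie brackets\<close>

text \<open>In finite dimension, \<open>C\<^sup>k\<^sup>+\<^sup>1\<close> means differentiable with every directional derivative of class \<open>C\<^sup>k\<close>.\<close>

primrec Ck :: "nat \<Rightarrow> ('a::euclidean_space \<Rightarrow> 'b::real_normed_vector) \<Rightarrow> bool" where
  "Ck 0 f \<longleftrightarrow> continuous_on UNIV f"
| "Ck (Suc k) f \<longleftrightarrow>
     (\<forall>x. f differentiable (at x)) \<and> (\<forall>h. Ck k (\<lambda>x. frechet_derivative f (at x) h))"

definition smooth :: "('a::euclidean_space \<Rightarrow> 'b::real_normed_vector) \<Rightarrow> bool" where
  "smooth f \<longleftrightarrow> (\<forall>k. Ck k f)"

text \<open>For a bounded smooth vector field there is exactly one such \<open>\<phi>\<close>.\<close>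

definition is_flow :: "('a::euclidean_space \<Rightarrow> 'a) \<Rightarrow> (real \<Rightarrow> 'a \<Rightarrow> 'a) \<Rightarrow> bool" where
  "is_flow v \<phi> \<longleftrightarrow>
     (\<forall>x. \<phi> 0 x = x \<and>
          (\<forall>t. ((\<lambda>s. \<phi> s x) has_vector_derivative v (\<phi> t x)) (at t)))"

definition forward_invariant :: "('n \<Rightarrow> real \<Rightarrow> 'a \<Rightarrow> 'a) \<Rightarrow> 'a set \<Rightarrow> bool" where
  "forward_invariant \<phi> M \<longleftrightarrow> (\<forall>i. \<forall>x\<in>M. \<forall>t\<ge>0. \<phi> i t x \<in> M)"

definition lie_bracket :: "('a::euclidean_space \<Rightarrow> 'a) \<Rightarrow> ('a \<Rightarrow> 'a) \<Rightarrow> 'a \<Rightarrow> 'a" where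
  "lie_bracket V W x =
     frechet_derivative W (at x) (V x) - frechet_derivative V (at x) (W x)"

primrec bracket_fields ::
    "('n \<Rightarrow> 'a::euclidean_space \<Rightarrow> 'a) \<Rightarrow> nat \<Rightarrow> ('a \<Rightarrow> 'a) set" where
  "bracket_fields v 0 = range v"
| "bracket_fields v (Suc k) =
     {lie_bracket V W | V W. V \<in> range v \<and> W \<in> bracket_fields v k} \<union> bracket_fields v k"

definition weak_Hormander :: "('n \<Rightarrow> 'a::euclidean_space \<Rightarrow> 'a) \<Rightarrow> 'a \<Rightarrow> bool" where
  "weak_Hormander v x \<longleftrightarrow> span {V x | V. V \<in> (\<Union>k. bracket_fields v k)} = UNIV"

text \<open>The head of the list is the pair \<open>(i\<^sub>1, t\<^sub>1)\<close>, whose flow is applied first.\<close>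

definition composite_flow :: "('n \<Rightarrow> real \<Rightarrow> 'a \<Rightarrow> 'a) \<Rightarrow> 'a \<Rightarrow> ('n \<times> real) list \<Rightarrow> 'a" where
  "composite_flow \<phi> x its = fold (\<lambda>(i, t) y. \<phi> i t y) its x"

definition accessible ::
    "('n \<Rightarrow> real \<Rightarrow> 'a::euclidean_space \<Rightarrow> 'a) \<Rightarrow> 'a set \<Rightarrow> 'a \<Rightarrow> bool" where
  "accessible \<phi> M z \<longleftrightarrow>
     (\<forall>U. open U \<and> z \<in> U \<longrightarrow>
        (\<forall>x\<in>M. \<exists>its. its \<noteq> [] \<and> (\<forall>(i, t) \<in> set its. 0 \<le> t) \<and> composite_flow \<phi> x its \<in> U))"


section \<open>Markov chains with a given rate matrix\<close>

definition rate_matrix :: "real^'n^'n \<Rightarrow> bool" where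
  "rate_matrix Q \<longleftrightarrow>
     (\<forall>i j. i \<noteq> j \<longrightarrow> 0 \<le> Q $ i $ j) \<and> (\<forall>i. Q $ i $ i = - (\<Sum>j\<in>UNIV - {i}. Q $ i $ j))"

definition positive_rate_matrices :: "(real^'n^'n) set" where
  "positive_rate_matrices = {Q. rate_matrix Q \<and> (\<forall>i j. i \<noteq> j \<longrightarrow> 0 < Q $ i $ j)}"

text \<open>
  The joint law of the successive states \<open>Y\<^sub>0, Y\<^sub>1, \<dots>\<close> and holding times \<open>S\<^sub>0, S\<^sub>1, \<dots>\<close> of the chain:
  a state \<open>i\<close> is left after an exponential time of parameter \<open>- Q\<^sub>i\<^sub>i\<close>, and independently of that time
  the next state is \<open>j \<noteq> i\<close> with probability \<open>Q\<^sub>i\<^sub>j / (- Q\<^sub>i\<^sub>i)\<close>.  Given \<open>Y\<^sub>0\<close>, all this is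
  independent of the random variable \<open>Z\<close> (below: the initial position).
  Holding times take values in \<open>[0,\<infinity>]\<close> because of the chain with a single state:
  there \<open>Q = 0\<close>, only \<open>k = 0\<close> is possible, and the formula says that \<open>S\<^sub>0 = \<infinity>\<close> almost surely.
\<close>

definition jump_hold_law ::
    "'w measure \<Rightarrow> real^'n^'n \<Rightarrow> ('w \<Rightarrow> 'a::topological_space) \<Rightarrow>
     (nat \<Rightarrow> 'w \<Rightarrow> 'n) \<Rightarrow> (nat \<Rightarrow> 'w \<Rightarrow> ennreal) \<Rightarrow> bool" where
  "jump_hold_law \<Omega> Q Z Y S \<longleftrightarrow>
     (\<forall>k. Y k \<in> measurable \<Omega> (count_space UNIV)) \<and>
     (\<forall>k. S k \<in> borel_measurable \<Omega>) \<and>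
     (\<forall>A k i s. A \<in> sets borel \<and> (\<forall>m<k. i m \<noteq> i (Suc m)) \<and> (\<forall>m\<le>k. 0 \<le> s m) \<longrightarrow>
        measure \<Omega> {\<omega> \<in> space \<Omega>. Z \<omega> \<in> A \<and> (\<forall>m\<le>k. Y m \<omega> = i m \<and> ennreal (s m) < S m \<omega>)} =
        measure \<Omega> {\<omega> \<in> space \<Omega>. Z \<omega> \<in> A \<and> Y 0 \<omega> = i 0}
        * (\<Prod>m\<le>k. exp (Q $ i m $ i m * s m))
        * (\<Prod>m<k. Q $ i m $ i (Suc m) / (- Q $ i m $ i m)))"

text \<open>\<open>I\<close> is a continuous-time Markov chain, from its random initial state \<open>I\<^sub>0\<close>, jumping from
  \<open>i\<close> to \<open>j\<close> at rate \<open>Q\<^sub>i\<^sub>j\<close>, and independent of \<open>Z\<close> given \<open>I\<^sub>0\<close>.  Almost surely the intervals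
  between successive jump times cover the whole half-line.\<close>

definition markov_chain_rates ::
    "'w measure \<Rightarrow> real^'n^'n \<Rightarrow> ('w \<Rightarrow> 'a::topological_space) \<Rightarrow> (real \<Rightarrow> 'w \<Rightarrow> 'n) \<Rightarrow> bool" where
  "markov_chain_rates \<Omega> Q Z I \<longleftrightarrow>
     (\<forall>t\<ge>0. I t \<in> measurable \<Omega> (count_space UNIV)) \<and>
     (\<exists>Y S. jump_hold_law \<Omega> Q Z Y S \<and>
        (AE \<omega> in \<Omega>. \<forall>k. \<forall>t\<ge>0.
           (\<Sum>m<k. S m \<omega>) \<le> ennreal t \<and> ennreal t < (\<Sum>m<Suc k. S m \<omega>) \<longrightarrow> I t \<omega> = Y k \<omega>))"


section \<open>The piecewise deterministic Markov process\<close>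

text \<open>The equation \<open>X' = v\<^sup>I(X)\<close> is understood in integrated form, since \<open>X\<close> need not be
  differentiable at the jump times of \<open>I\<close>.\<close>

definition PDMP ::
    "('n \<Rightarrow> 'a::euclidean_space \<Rightarrow> 'a) \<Rightarrow> 'a set \<Rightarrow> real^'n^'n \<Rightarrow>
     'w measure \<Rightarrow> (real \<Rightarrow> 'w \<Rightarrow> 'a) \<Rightarrow> (real \<Rightarrow> 'w \<Rightarrow> 'n) \<Rightarrow> bool" where
  "PDMP v M Q \<Omega> X I \<longleftrightarrow>
     prob_space \<Omega> \<and>
     (\<forall>t\<ge>0. X t \<in> measurable \<Omega> (restrict_space borel M)) \<and>
     markov_chain_rates \<Omega> Q (X 0) I \<and>
     (AE \<omega> in \<Omega>. \<forall>t\<ge>0. ((\<lambda>s. v (I s \<omega>) (X s \<omega>)) has_integral (X t \<omega> - X 0 \<omega>)) {0..t})"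

definition PDMP_law ::
    "'a::euclidean_space set \<Rightarrow> 'w measure \<Rightarrow> (real \<Rightarrow> 'w \<Rightarrow> 'a) \<Rightarrow> (real \<Rightarrow> 'w \<Rightarrow> 'n) \<Rightarrow>
     real \<Rightarrow> ('a \<times> 'n) measure" where
  "PDMP_law M \<Omega> X I t =
     distr \<Omega> (restrict_space borel M \<Otimes>\<^sub>M count_space UNIV) (\<lambda>\<omega>. (X t \<omega>, I t \<omega>))"

text \<open>\<open>\<pi>\<close> is a stationary distribution of \<open>PDMP(Q)\<close>, witnessed by the process \<open>(X, I)\<close>: started
  from \<open>\<pi>\<close>, the process has law \<open>\<pi>\<close> at all times.  As the law of the process is
  determined by its initial law, the choice of \<open>\<Omega>\<close>, \<open>X\<close> and \<open>I\<close> is immaterial.\<close>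

definition stationary_distribution_via ::
    "('n \<Rightarrow> 'a::euclidean_space \<Rightarrow> 'a) \<Rightarrow> 'a set \<Rightarrow> real^'n^'n \<Rightarrow>
     'w measure \<Rightarrow> (real \<Rightarrow> 'w \<Rightarrow> 'a) \<Rightarrow> (real \<Rightarrow> 'w \<Rightarrow> 'n) \<Rightarrow> ('a \<times> 'n) measure \<Rightarrow> bool" where
  "stationary_distribution_via v M Q \<Omega> X I \<pi> \<longleftrightarrow>
     PDMP v M Q \<Omega> X I \<and> (\<forall>t\<ge>0. PDMP_law M \<Omega> X I t = \<pi>)"

definition lebesgue_on_copies :: "'a::euclidean_space set \<Rightarrow> ('a \<times> 'n) measure" where
  "lebesgue_on_copies M = restrict_space lborel M \<Otimes>\<^sub>M count_space UNIV"

definition lower_semicontinuous_map :: "'a topology \<Rightarrow> ('a \<Rightarrow> ennreal) \<Rightarrow> bool" where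
  "lower_semicontinuous_map T f \<longleftrightarrow> (\<forall>a. openin T {z \<in> topspace T. a < f z})"

end

theory Submission
  imports Defs
begin

text \<open>
  With \<open>\<Lambda>\<close> larger than all exit rates, uniformization turns stationarity of the process into
  invariance of \<open>\<pi>\<close> under the discrete kernel \<open>K\<close>: from a state \<open>i\<close> move to \<open>j\<close> with probability
  \<open>P i j > 0\<close>, then follow the flow of \<open>v j\<close> for an exponential time of rate \<open>\<Lambda>\<close>.  This identity
  comes from expanding the law of the process at time \<open>t\<close> to first order as \<open>t \<rightarrow> 0\<close>.

  The bracket condition gives a finite composition of flows, started at \<open>xstar\<close>, whose endpoint is a submersion
  in the durations.  Hence some power of \<open>K\<close> dominates a multiple of Lebesgue measure on a fixed open
  set \<open>V\<close>, uniformly in the starting points near \<open>xstar\<close>.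

  Since flows are diffeomorphisms, \<open>K\<close> maps lower semicontinuous densities on the whole space to such
  densities.  Let \<open>G\<close> be a lower semicontinuous density of maximal mass below \<open>\<pi>\<close>.  If \<open>\<pi>\<close> exceeded
  \<open>G\<close>, then by accessibility the excess would charge, after some steps of \<open>K\<close>, a neighbourhood of
  \<open>xstar\<close>, and so would contribute a multiple of the lower semicontinuous density \<open>indicator V\<close>;
  adding it to the image of \<open>G\<close> contradicts maximality.
\<close>

section \<open>Flows of smooth vector fields\<close>

text \<open>The obstacle to the first-order expansion is that a test function on copy j must be
  differentiable along the flow of \<open>v j\<close>. Resolvents f of Lipschitz functions h have
  this property: the derivative is \<Lambda> * (f - h), and the expansion of the law tested on f in
  copy j alone becomes, after division by \<Lambda>, exactly invariance under \<open>K\<close>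
  tested on h. All entries of \<open>P\<close> are positive, the diagonal included, so a finite word
  of flows has a weight bounded below whatever the initial index is; rank and accessibility
  arguments can therefore ignore the indices. In general there are more durations than dimensions.
  The excess is handled by averaging over a parameter \<sigma> of the right dimension which shifts
  the durations linearly. Densities live on the whole space because backward flows may leave
  \<open>M\<close>. The contradiction with maximality is a count of mass: \<open>K\<close> fixes the
  constant 1, so the transposed kernel preserves the mass of \<open>G\<close>, and any positive
  multiple of \<open>indicator V\<close> is a strict gain.\<close>

lemma gronwall_forward:
  fixes u :: "real \<Rightarrow> 'a::real_inner"
  assumes d: "\<And>s. 0 \<le> s \<Longrightarrow> s \<le> t \<Longrightarrow> (u has_vector_derivative u' s) (at s)"
    and b: "\<And>s. 0 \<le> s \<Longrightarrow> s \<le> t \<Longrightarrow> norm (u' s) \<le> L * norm (u s) + e"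
    and "0 \<le> L" "0 \<le> e" "0 \<le> t"
  shows "norm (u t) \<le> exp ((L + 1) * t) * (norm (u 0) + e)"
proof -
  \<comment> \<open>The squared norm is used because the norm is not differentiable where
    \<open>u\<close> vanishes. The rate 2 * L + 1 pays for twice the inner product of
    \<open>u' s\<close> and \<open>u s\<close>: 2 * L for the Lipschitz part, and 1 for splitting
    the cross term 2 * e * norm (u s) into the two squares.\<close>
  define g where "g s = exp (- (2 * L + 1) * s) * (u s \<bullet> u s + e\<^sup>2)" for s
  have "g t \<le> g 0"
  proof (rule DERIV_nonpos_imp_nonincreasing[OF \<open>0 \<le> t\<close>])
    fix s assume s: "0 \<le> s" "s \<le> t"
    let ?g' = "exp (- (2 * L + 1) * s) * (2 * (u' s \<bullet> u s) - (2 * L + 1) * (u s \<bullet> u s + e\<^sup>2))"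
    have du: "(u has_derivative (\<lambda>h. h *\<^sub>R u' s)) (at s)"
      using d[OF s] by (simp add: has_vector_derivative_def)
    have "((\<lambda>s. u s \<bullet> u s) has_derivative (\<lambda>h. u s \<bullet> (h *\<^sub>R u' s) + (h *\<^sub>R u' s) \<bullet> u s)) (at s)"
      by (rule has_derivative_inner[OF du du])
    then have duu: "((\<lambda>s. u s \<bullet> u s) has_real_derivative 2 * (u' s \<bullet> u s)) (at s)"
      unfolding has_field_derivative_def
      by (rule has_derivative_eq_rhs) (simp add: fun_eq_iff inner_commute)
    have "(g has_real_derivative ?g') (at s)"
      unfolding g_def by (auto intro!: derivative_eq_intros duu simp: algebra_simps)
    moreover have "?g' \<le> 0"
    proof -
      have "u' s \<bullet> u s \<le> norm (u' s) * norm (u s)" by (rule norm_cauchy_schwarz)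
      also have "\<dots> \<le> (L * norm (u s) + e) * norm (u s)"
        using b[OF s] by (simp add: mult_right_mono)
      finally have 1: "u' s \<bullet> u s \<le> L * (norm (u s))\<^sup>2 + e * norm (u s)"
        by (simp add: algebra_simps power2_eq_square)
      have 2: "2 * (e * norm (u s)) \<le> (norm (u s))\<^sup>2 + e\<^sup>2"
        using sum_squares_bound[of e "norm (u s)"] by (simp add: mult.assoc)
      have 3: "0 \<le> L * e\<^sup>2" using \<open>0 \<le> L\<close> by simp
      have "2 * (u' s \<bullet> u s) - (2 * L + 1) * (u s \<bullet> u s + e\<^sup>2) \<le> 0"
        using 1 2 3 by (simp add: dot_square_norm algebra_simps)
      then show ?thesis by (intro mult_nonneg_nonpos) auto
    qed
    ultimately show "\<exists>y. (g has_real_derivative y) (at s) \<and> y \<le> 0" by blast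
  qed
  then have "exp (- ((2 * L + 1) * t)) * ((norm (u t))\<^sup>2 + e\<^sup>2) \<le> (norm (u 0))\<^sup>2 + e\<^sup>2"
    unfolding g_def by (simp only: dot_square_norm mult_minus_left mult_zero_right exp_zero mult_1_left minus_zero)
  then have "exp ((2 * L + 1) * t) * (exp (- ((2 * L + 1) * t)) * ((norm (u t))\<^sup>2 + e\<^sup>2))
      \<le> exp ((2 * L + 1) * t) * ((norm (u 0))\<^sup>2 + e\<^sup>2)"
    by (intro mult_left_mono) auto
  then have "(norm (u t))\<^sup>2 + e\<^sup>2 \<le> exp ((2 * L + 1) * t) * ((norm (u 0))\<^sup>2 + e\<^sup>2)"
    by (simp add: mult.assoc[symmetric] exp_add[symmetric])
  then have "(norm (u t))\<^sup>2 \<le> exp ((2 * L + 1) * t) * ((norm (u 0))\<^sup>2 + e\<^sup>2)"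
    by (smt (verit) zero_le_power2)
  also have "\<dots> \<le> exp (2 * ((L + 1) * t)) * (norm (u 0) + e)\<^sup>2"
    using \<open>0 \<le> t\<close> \<open>0 \<le> e\<close>
    by (intro mult_mono) (auto simp: algebra_simps power2_eq_square)
  also have "\<dots> = (exp ((L + 1) * t) * (norm (u 0) + e))\<^sup>2"
    by (simp only: exp_double power_mult_distrib)
  finally show ?thesis
    by (rule power2_le_imp_le) (use \<open>0 \<le> e\<close> in auto)
qed

lemma gronwall:
  fixes u :: "real \<Rightarrow> 'a::real_inner"
  assumes d: "\<And>s. \<bar>s\<bar> \<le> T \<Longrightarrow> (u has_vector_derivative u' s) (at s)"
    and b: "\<And>s. \<bar>s\<bar> \<le> T \<Longrightarrow> norm (u' s) \<le> L * norm (u s) + e"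
    and "0 \<le> L" "0 \<le> e" "\<bar>t\<bar> \<le> T"
  shows "norm (u t) \<le> exp ((L + 1) * T) * (norm (u 0) + e)"
proof -
  have "norm (u t) \<le> exp ((L + 1) * \<bar>t\<bar>) * (norm (u 0) + e)"
  proof (cases "0 \<le> t")
    case True
    then show ?thesis
      using gronwall_forward[of t u u' L e] assms by auto
  next
    case False
    have "((\<lambda>s. u (- s)) has_vector_derivative - u' (- s)) (at s)" if "0 \<le> s" "s \<le> - t" for s
    proof -
      have "((u \<circ> uminus) has_vector_derivative (- 1) *\<^sub>R u' (- s)) (at s)"
        using that assms(5) False
        by (intro vector_diff_chain_at) (auto intro!: derivative_eq_intros d)
      then show ?thesis by (simp add: o_def)
    qed
    then show ?thesis
      using gronwall_forward[of "- t" "\<lambda>s. u (- s)" "\<lambda>s. - u' (- s)" L e] b assms(3,4,5) False by auto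
  qed
  also have "\<dots> \<le> exp ((L + 1) * T) * (norm (u 0) + e)"
    using assms by (intro mult_right_mono) (auto intro!: mult_left_mono)
  finally show ?thesis .
qed

section \<open>Flows of bounded fields: uniqueness, group law, continuity\<close>

locale C1_flow =
  fixes v :: "'a::euclidean_space \<Rightarrow> 'a" and v' :: "'a \<Rightarrow> 'a \<Rightarrow>\<^sub>L 'a"
    and \<phi> :: "real \<Rightarrow> 'a \<Rightarrow> 'a" and B :: real
  assumes has_derivative_v: "(v has_derivative v' x) (at x)"
    and continuous_v': "continuous_on UNIV v'"
    and norm_v_le: "norm (v x) \<le> B"
    and flow: "is_flow v \<phi>"
begin

lemma phi_0 [simp]: "\<phi> 0 x = x"
  using flow by (simp add: is_flow_def)

lemma phi_deriv: "((\<lambda>s. \<phi> s x) has_vector_derivative v (\<phi> t x)) (at t)"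
  using flow by (simp add: is_flow_def)

lemma B_nonneg: "0 \<le> B"
  by (rule order_trans[OF norm_ge_zero norm_v_le])

lemma continuous_v: "continuous_on UNIV v"
  by (intro continuous_at_imp_continuous_on ballI has_derivative_continuous[OF has_derivative_v])

lemma norm_phi_diff_le: "norm (\<phi> t x - \<phi> s x) \<le> B * \<bar>t - s\<bar>"
proof -
  have "norm (\<phi> t x - \<phi> s x) \<le> B * norm (t - s)"
  proof (rule differentiable_bound[of UNIV "\<lambda>t. \<phi> t x" "\<lambda>t h. h *\<^sub>R v (\<phi> t x)"])
    show "((\<lambda>t. \<phi> t x) has_derivative (\<lambda>h. h *\<^sub>R v (\<phi> t x))) (at t within UNIV)" for t
      using phi_deriv by (simp add: has_vector_derivative_def)
    show "onorm (\<lambda>h. h *\<^sub>R v (\<phi> t x)) \<le> B" for t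
      using norm_v_le[of "\<phi> t x"] by (intro onorm_bound B_nonneg) (auto simp: mult.commute[of B] intro!: mult_left_mono)
  qed auto
  then show ?thesis by simp
qed

lemma norm_phi_le: "\<bar>t\<bar> \<le> T \<Longrightarrow> norm x \<le> R \<Longrightarrow> norm (\<phi> t x) \<le> R + B * T"
  using norm_phi_diff_le[of t x 0] B_nonneg norm_triangle_sub[of "\<phi> t x" x]
    mult_left_mono[of "\<bar>t\<bar>" T B] by auto

lemma norm_v'_bounded_on_cball: "\<exists>L\<ge>0. \<forall>x. norm x \<le> R \<longrightarrow> norm (v' x) \<le> L"
proof -
  have "compact (v' ` cball 0 R)"
    by (intro compact_continuous_image continuous_on_subset[OF continuous_v']) auto
  then obtain L where "\<forall>x\<in>cball 0 R. norm (v' x) \<le> L"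
    by (meson compact_imp_bounded bounded_iff image_eqI)
  then have "\<forall>x. norm x \<le> R \<longrightarrow> norm (v' x) \<le> max L 0" by (auto simp: le_max_iff_disj)
  then show ?thesis by (meson max.cobounded2)
qed

text \<open>Uniform continuity of \<open>v'\<close> on the compact ball makes the first-order error
  uniform in the base point \<open>a\<close>. The mean value argument runs on the convex set of
  points that lie in the ball and close to \<open>a\<close>.\<close>

lemma v_linearization:
  assumes "0 < e"
  shows "\<exists>\<delta>>0. \<forall>a b. norm a \<le> R \<longrightarrow> norm b \<le> R \<longrightarrow> norm (b - a) < \<delta> \<longrightarrow>
           norm (v b - v a - v' a (b - a)) \<le> e * norm (b - a)"
proof -
  have "uniformly_continuous_on (cball 0 R) v'"
    by (intro compact_uniformly_continuous continuous_on_subset[OF continuous_v']) auto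
  then obtain \<delta> where \<delta>: "\<delta> > 0"
    "\<And>x y. x \<in> cball 0 R \<Longrightarrow> y \<in> cball 0 R \<Longrightarrow> dist x y < \<delta> \<Longrightarrow> dist (v' x) (v' y) < e"
    unfolding uniformly_continuous_on_def using assms by metis
  have "norm (v b - v a - v' a (b - a)) \<le> e * norm (b - a)"
    if "norm a \<le> R" "norm b \<le> R" "norm (b - a) < \<delta>" for a b
  proof -
    let ?S = "cball 0 R \<inter> ball a \<delta>"
    have cv: "convex ?S" by (intro convex_Int) auto
    have ab: "a \<in> ?S" "b \<in> ?S" using that \<delta> by (auto simp: dist_norm norm_minus_commute)
    have "norm (v b - v a - v' a (b - a)) \<le> norm (b - a) * e"
    proof (rule differentiable_bound_linearization[where S = ?S and f' = "\<lambda>x. blinfun_apply (v' x)"])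
      show "a + t *\<^sub>R (b - a) \<in> ?S" if "t \<in> {0..1}" for t
        using convexD_alt[OF cv ab, of t] that by (simp add: algebra_simps del: Int_iff)
      show "(v has_derivative blinfun_apply (v' x)) (at x within ?S)" for x
        using has_derivative_v has_derivative_at_withinI by blast
      show "onorm (blinfun_apply (v' x) - blinfun_apply (v' a)) \<le> e" if "x \<in> ?S" for x
      proof -
        have "norm (v' x - v' a) < e"
          using \<delta>(2)[of x a] that ab by (auto simp: dist_norm dist_commute norm_minus_commute)
        moreover have "blinfun_apply (v' x) - blinfun_apply (v' a) = blinfun_apply (v' x - v' a)"
          by (simp add: fun_eq_iff blinfun.diff_left)
        ultimately show ?thesis by (simp add: norm_blinfun.rep_eq)
      qed
    qed (use ab in auto)
    then show ?thesis by (simp add: mult.commute)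
  qed
  then show ?thesis using \<delta>(1) by blast
qed

lemma v_lipschitz_on_cball:
  assumes L: "\<And>x. norm x \<le> R \<Longrightarrow> norm (v' x) \<le> L" and "norm a \<le> R" "norm b \<le> R"
  shows "norm (v a - v b) \<le> L * norm (a - b)"
proof (rule differentiable_bound[of "cball 0 R" v "\<lambda>x. v' x"])
  show "(v has_derivative v' x) (at x within cball 0 R)" for x
    using has_derivative_v has_derivative_at_withinI by blast
  show "onorm (v' x) \<le> L" if "x \<in> cball 0 R" for x
    using L[of x] that by (simp add: norm_blinfun.rep_eq)
qed (use assms in auto)

lemma phi_unique:
  assumes u: "\<And>t. (u has_vector_derivative v (u t)) (at t)"
  shows "u t = \<phi> t (u 0)"
proof -
  have "continuous_on {-\<bar>t\<bar>..\<bar>t\<bar>} u"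
    using u by (meson continuous_at_imp_continuous_on has_vector_derivative_continuous)
  then have "bounded (u ` {-\<bar>t\<bar>..\<bar>t\<bar>})"
    by (intro compact_imp_bounded compact_continuous_image) auto
  then obtain R where R: "\<And>s. \<bar>s\<bar> \<le> \<bar>t\<bar> \<Longrightarrow> norm (u s) \<le> R"
    unfolding bounded_iff by (force simp: abs_le_iff)
  \<comment> \<open>This radius contains both curves up to time t, so the Lipschitz constant of one
    ball can be fed to Gronwall's inequality.\<close>
  define K where "K = R + B * \<bar>t\<bar>"
  obtain L where L: "L \<ge> 0" "\<And>x. norm x \<le> K \<Longrightarrow> norm (v' x) \<le> L"
    using norm_v'_bounded_on_cball by metis
  have "0 \<le> B * \<bar>t\<bar>" using B_nonneg by simp
  then have "R \<le> K" by (simp add: K_def)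
  have "norm (u t - \<phi> t (u 0)) \<le> exp ((L + 1) * \<bar>t\<bar>) * (norm (u 0 - \<phi> 0 (u 0)) + 0)"
  proof (rule gronwall[of "\<bar>t\<bar>" _ "\<lambda>s. v (u s) - v (\<phi> s (u 0))"])
    show "((\<lambda>t. u t - \<phi> t (u 0)) has_vector_derivative v (u s) - v (\<phi> s (u 0))) (at s)" for s
      by (intro has_vector_derivative_diff u phi_deriv)
    show "norm (v (u s) - v (\<phi> s (u 0))) \<le> L * norm (u s - \<phi> s (u 0)) + 0" if "\<bar>s\<bar> \<le> \<bar>t\<bar>" for s
      using v_lipschitz_on_cball[of K L "u s" "\<phi> s (u 0)"] L R[OF that] \<open>R \<le> K\<close>
        norm_phi_le[OF that, of "u 0" R] R[of 0] by (auto simp: K_def)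
  qed (use L in auto)
  then show ?thesis by simp
qed

text \<open>Both sides solve the equation in s and agree at s = 0.\<close>

lemma phi_add: "\<phi> (s + t) x = \<phi> s (\<phi> t x)"
proof -
  have "((\<lambda>s. \<phi> (s + t) x) has_vector_derivative v (\<phi> (s + t) x)) (at s)" for s
  proof -
    have "(((\<lambda>s. \<phi> s x) \<circ> (\<lambda>s. s + t)) has_vector_derivative 1 *\<^sub>R v (\<phi> (s + t) x)) (at s)"
      by (intro vector_diff_chain_at phi_deriv) (auto intro!: derivative_eq_intros)
    then show ?thesis by (simp add: o_def)
  qed
  from phi_unique[OF this, of s] show ?thesis by simp
qed

lemma phi_minus [simp]: "\<phi> (- t) (\<phi> t x) = x" "\<phi> t (\<phi> (- t) x) = x"
  using phi_add[of "- t" t x] phi_add[of t "- t" x] by auto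

text \<open>Trajectories starting within radius R stay within R + B * T up to time T, so one
  Lipschitz constant of the field serves them all in Gronwall's inequality.\<close>

lemma phi_lipschitz:
  "\<exists>G\<ge>0. \<forall>x y t. norm x \<le> R \<longrightarrow> norm y \<le> R \<longrightarrow> \<bar>t\<bar> \<le> T \<longrightarrow>
     norm (\<phi> t x - \<phi> t y) \<le> G * norm (x - y)"
proof -
  obtain L where L: "L \<ge> 0" "\<And>x. norm x \<le> R + B * T \<Longrightarrow> norm (v' x) \<le> L"
    using norm_v'_bounded_on_cball by metis
  have "norm (\<phi> t x - \<phi> t y) \<le> exp ((L + 1) * T) * (norm (\<phi> 0 x - \<phi> 0 y) + 0)"
    if "norm x \<le> R" "norm y \<le> R" "\<bar>t\<bar> \<le> T" for x y t
  proof (rule gronwall[of T _ "\<lambda>s. v (\<phi> s x) - v (\<phi> s y)"])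
    show "((\<lambda>t. \<phi> t x - \<phi> t y) has_vector_derivative v (\<phi> s x) - v (\<phi> s y)) (at s)" for s
      by (intro has_vector_derivative_diff phi_deriv)
    show "norm (v (\<phi> s x) - v (\<phi> s y)) \<le> L * norm (\<phi> s x - \<phi> s y) + 0" if "\<bar>s\<bar> \<le> T" for s
      using v_lipschitz_on_cball[of "R + B * T" L "\<phi> s x" "\<phi> s y"] L
        norm_phi_le[OF that, of x R] norm_phi_le[OF that, of y R] \<open>norm x \<le> R\<close> \<open>norm y \<le> R\<close> by auto
  qed (use L that in auto)
  then show ?thesis by (intro exI[of _ "exp ((L + 1) * T)"]) auto
qed

lemma continuous_phi: "continuous_on UNIV (\<lambda>(t, x). \<phi> t x)"
proof -
  have "((\<lambda>(t, x). \<phi> t x) \<longlongrightarrow> \<phi> t x) (at (t, x))" for t x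
  proof -
    obtain G where G: "G \<ge> 0" "\<And>y z s. norm y \<le> norm x + 1 \<Longrightarrow> norm z \<le> norm x + 1 \<Longrightarrow> \<bar>s\<bar> \<le> \<bar>t\<bar> \<Longrightarrow>
       norm (\<phi> s y - \<phi> s z) \<le> G * norm (y - z)"
      using phi_lipschitz[of "norm x + 1" "\<bar>t\<bar>"] by metis
    have lims: "((\<lambda>p. fst p) \<longlongrightarrow> t) (at (t, x))" "((\<lambda>p. snd p) \<longlongrightarrow> x) (at (t, x))"
      by (auto intro!: tendsto_eq_intros)
    have "\<forall>\<^sub>F p in at (t, x). norm (snd p) < norm x + 1"
      by (rule order_tendstoD(2)[OF tendsto_norm[OF lims(2)]]) simp
    then have "\<forall>\<^sub>F p in at (t, x). norm ((\<lambda>(t, x). \<phi> t x) p - \<phi> t x) \<le> B * \<bar>fst p - t\<bar> + G * norm (snd p - x)"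
    proof eventually_elim
      case (elim p)
      then show ?case
        using G(2)[of "snd p" x t] norm_phi_diff_le[of "fst p" "snd p" t]
          norm_triangle_ineq[of "\<phi> (fst p) (snd p) - \<phi> t (snd p)" "\<phi> t (snd p) - \<phi> t x"]
        by (auto simp: case_prod_beta)
    qed
    moreover have "((\<lambda>p. B * \<bar>fst p - t\<bar> + G * norm (snd p - x)) \<longlongrightarrow> 0) (at (t, x))"
      by (auto intro!: tendsto_eq_intros lims)
    ultimately show ?thesis
      by (subst Lim_null) (rule Lim_null_comparison)
  qed
  then show ?thesis
    by (auto simp: continuous_on_eq_continuous_at continuous_at)
qed

end

section \<open>Derivative of the flow in the starting point\<close>

context C1_flow begin

text \<open>The difference quotients satisfy the variational equation w' = v' (\<phi> t x) w up to
  an error that is uniformly small for small h. Gronwall's inequality then shows that they converge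
  as h tends to 0 and that the limit is linear in the direction, so the variational equation never
  has to be solved separately.\<close>

definition quot :: "real \<Rightarrow> 'a \<Rightarrow> 'a \<Rightarrow> real \<Rightarrow> 'a" where
  "quot h x e t = (\<phi> t (x + h *\<^sub>R e) - \<phi> t x) /\<^sub>R h"

definition quot' :: "real \<Rightarrow> 'a \<Rightarrow> 'a \<Rightarrow> real \<Rightarrow> 'a" where
  "quot' h x e t = (v (\<phi> t (x + h *\<^sub>R e)) - v (\<phi> t x)) /\<^sub>R h"

abbreviation small :: "real \<Rightarrow> real \<Rightarrow> bool" where
  "small \<delta> h \<equiv> 0 < \<bar>h\<bar> \<and> \<bar>h\<bar> < \<delta>"

lemma quot_0: "h \<noteq> 0 \<Longrightarrow> quot h x e 0 = e"
  by (simp add: quot_def)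

lemma quot_deriv: "(quot h x e has_vector_derivative quot' h x e t) (at t)"
proof -
  have "((\<lambda>t. (\<phi> t (x + h *\<^sub>R e) - \<phi> t x) /\<^sub>R h) has_vector_derivative
      (v (\<phi> t (x + h *\<^sub>R e)) - v (\<phi> t x)) /\<^sub>R h) (at t)"
    by (intro bounded_linear.has_vector_derivative[OF bounded_linear_scaleR_right]
        has_vector_derivative_diff phi_deriv)
  then show ?thesis
    by (simp add: quot_def[abs_def] quot'_def)
qed

lemma quot_approx:
  assumes "0 < \<epsilon>"
  shows "\<exists>\<delta>>0. \<forall>h x e t. small \<delta> h \<longrightarrow> norm x \<le> R \<longrightarrow> norm e \<le> E \<longrightarrow> \<bar>t\<bar> \<le> T \<longrightarrow>
     norm (quot' h x e t - v' (\<phi> t x) (quot h x e t)) \<le> \<epsilon>"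
proof -
  define E1 where "E1 = max E 1"
  have E1: "E1 \<ge> 1" "E \<le> E1" by (auto simp: E1_def)
  obtain G where G: "G \<ge> 0" "\<And>x y t. norm x \<le> R + 1 \<Longrightarrow> norm y \<le> R + 1 \<Longrightarrow> \<bar>t\<bar> \<le> T \<Longrightarrow>
     norm (\<phi> t x - \<phi> t y) \<le> G * norm (x - y)"
    using phi_lipschitz[of "R + 1" T] by metis
  \<comment> \<open>The flow displaces the perturbed start by at most G * E1 * \<bar>h\<bar>, so
    this accuracy costs at most \<epsilon> after division by h. Taking G + 1 excludes a zero
    denominator.\<close>
  define \<eta> where "\<eta> = \<epsilon> / ((G + 1) * E1)"
  have \<eta>: "\<eta> > 0" using assms G E1 by (simp add: \<eta>_def)
  obtain \<delta> where \<delta>: "\<delta> > 0" "\<And>a b. norm a \<le> R + 1 + B * T \<Longrightarrow> norm b \<le> R + 1 + B * T \<Longrightarrow> norm (b - a) < \<delta> \<Longrightarrow>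
           norm (v b - v a - v' a (b - a)) \<le> \<eta> * norm (b - a)"
    using v_linearization[OF \<eta>, of "R + 1 + B * T"] by metis
  \<comment> \<open>The first bound keeps the perturbed start within radius R + 1, the second keeps
    the two trajectories close enough for the linearization.\<close>
  define d where "d = min (1 / E1) (\<delta> / ((G + 1) * E1))"
  have d: "d > 0" using \<delta> E1 G by (simp add: d_def)
  have "norm (quot' h x e t - v' (\<phi> t x) (quot h x e t)) \<le> \<epsilon>"
    if h: "small d h" and x: "norm x \<le> R" and e: "norm e \<le> E" and t: "\<bar>t\<bar> \<le> T" for h x e t
  proof -
    let ?y = "x + h *\<^sub>R e"
    have he: "norm (h *\<^sub>R e) \<le> \<bar>h\<bar> * E1" using e E1 by (simp add: mult_left_mono)
    have "\<bar>h\<bar> * E1 \<le> 1" using h E1 by (simp add: d_def field_simps)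
    then have y: "norm ?y \<le> R + 1" using he x norm_triangle_ineq[of x "h *\<^sub>R e"] by linarith
    have diff: "norm (\<phi> t ?y - \<phi> t x) \<le> G * (\<bar>h\<bar> * E1)"
    proof -
      have "norm (\<phi> t ?y - \<phi> t x) \<le> G * norm (?y - x)" using G(2)[OF y _ t, of x] x by simp
      also have "\<dots> \<le> G * (\<bar>h\<bar> * E1)" using he G by (simp add: mult_left_mono)
      finally show ?thesis .
    qed
    have "G * (\<bar>h\<bar> * E1) \<le> \<bar>h\<bar> * ((G + 1) * E1)" using E1 by (simp add: algebra_simps)
    also have "\<dots> < \<delta>" 
    proof -
      have "\<bar>h\<bar> < \<delta> / ((G + 1) * E1)" using h by (simp add: d_def)
      moreover have "(G + 1) * E1 > 0" using G E1 by simp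
      ultimately show ?thesis by (simp only: pos_less_divide_eq)
    qed
    finally have "G * (\<bar>h\<bar> * E1) < \<delta>" .
    then have "norm (v (\<phi> t ?y) - v (\<phi> t x) - v' (\<phi> t x) (\<phi> t ?y - \<phi> t x)) \<le> \<eta> * norm (\<phi> t ?y - \<phi> t x)"
      using diff norm_phi_le[OF t x] norm_phi_le[OF t y] by (intro \<delta>(2)) auto
    also have "\<dots> \<le> \<eta> * (G * (\<bar>h\<bar> * E1))" using diff \<eta> by (simp add: mult_left_mono)
    also have "\<dots> \<le> \<epsilon> * \<bar>h\<bar>"
    proof -
      have "\<eta> * (G * (\<bar>h\<bar> * E1)) \<le> \<eta> * (\<bar>h\<bar> * ((G + 1) * E1))"
        using \<eta> E1 by (intro mult_left_mono) (auto simp: algebra_simps)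
      also have "\<dots> = \<epsilon> * \<bar>h\<bar>" using G E1 by (simp add: \<eta>_def)
      finally show ?thesis .
    qed
    finally have *: "norm (v (\<phi> t ?y) - v (\<phi> t x) - v' (\<phi> t x) (\<phi> t ?y - \<phi> t x)) \<le> \<epsilon> * \<bar>h\<bar>" .
    have "quot' h x e t - v' (\<phi> t x) (quot h x e t)
        = (v (\<phi> t ?y) - v (\<phi> t x) - v' (\<phi> t x) (\<phi> t ?y - \<phi> t x)) /\<^sub>R h"
      by (simp add: quot'_def quot_def blinfun.scaleR_right blinfun.diff_right scaleR_diff_right)
    then have "norm (quot' h x e t - v' (\<phi> t x) (quot h x e t)) = 
        norm (v (\<phi> t ?y) - v (\<phi> t x) - v' (\<phi> t x) (\<phi> t ?y - \<phi> t x)) / \<bar>h\<bar>"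
      by (simp add: divide_inverse mult.commute)
    also have "\<dots> \<le> \<epsilon>" using * h by (simp add: pos_divide_le_eq)
    finally show ?thesis .
  qed
  then show ?thesis using d by blast
qed

text \<open>One Gronwall estimate for two purposes: with \<open>a = 1\<close> and
  \<open>e3 = 0\<close> it compares two step sizes, and with equal step sizes it gives linearity of
  the limit. The combination vanishes at time 0, so only the error of the equation
  accumulates.\<close>

lemma quot_combination:
  assumes "0 < \<epsilon>"
  shows "\<exists>\<delta>>0. \<forall>h k l x e2 e3 t. small \<delta> h \<longrightarrow> small \<delta> k \<longrightarrow> small \<delta> l \<longrightarrow> norm x \<le> R \<longrightarrow>
     norm (a *\<^sub>R e2 + e3) \<le> E \<longrightarrow> norm e2 \<le> E \<longrightarrow> norm e3 \<le> E \<longrightarrow> \<bar>t\<bar> \<le> T \<longrightarrow>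
     norm (quot h x (a *\<^sub>R e2 + e3) t - a *\<^sub>R quot k x e2 t - quot l x e3 t) \<le> \<epsilon>"
proof -
  obtain L where L: "L \<ge> 0" "\<And>x. norm x \<le> R + B * T \<Longrightarrow> norm (v' x) \<le> L"
    using norm_v'_bounded_on_cball by metis
  define C where "C = exp ((L + 1) * T)"
  \<comment> \<open>C is the Gronwall factor; the three quotients enter with weights 1,
    \<bar>a\<bar> and 1.\<close>
  define \<epsilon>' where "\<epsilon>' = \<epsilon> / (C * (2 + \<bar>a\<bar>))"
  have "C > 0" by (simp add: C_def)
  have a2: "2 + \<bar>a\<bar> > 0" by linarith
  have \<epsilon>': "\<epsilon>' > 0" "C * ((2 + \<bar>a\<bar>) * \<epsilon>') = \<epsilon>"
    using assms \<open>C > 0\<close> a2 by (simp_all add: \<epsilon>'_def)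
  obtain \<delta> where \<delta>: "\<delta> > 0" "\<And>h x e t. small \<delta> h \<Longrightarrow> norm x \<le> R \<Longrightarrow> norm e \<le> E \<Longrightarrow> \<bar>t\<bar> \<le> T \<Longrightarrow>
    norm (quot' h x e t - v' (\<phi> t x) (quot h x e t)) \<le> \<epsilon>'"
    using quot_approx[OF \<epsilon>'(1), of R E T] by metis
  have "norm (quot h x (a *\<^sub>R e2 + e3) t - a *\<^sub>R quot k x e2 t - quot l x e3 t) \<le> \<epsilon>"
    if hkl: "small \<delta> h" "small \<delta> k" "small \<delta> l" and x: "norm x \<le> R"
      and e: "norm (a *\<^sub>R e2 + e3) \<le> E" "norm e2 \<le> E" "norm e3 \<le> E" and t: "\<bar>t\<bar> \<le> T"
    for h k l x e2 e3 t
  proof -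
    let ?e1 = "a *\<^sub>R e2 + e3"
    let ?u = "\<lambda>t. quot h x ?e1 t - a *\<^sub>R quot k x e2 t - quot l x e3 t"
    let ?u' = "\<lambda>t. quot' h x ?e1 t - a *\<^sub>R quot' k x e2 t - quot' l x e3 t"
    have "norm (?u t) \<le> exp ((L + 1) * T) * (norm (?u 0) + (2 + \<bar>a\<bar>) * \<epsilon>')"
    proof (rule gronwall[of T ?u ?u'])
      show "(?u has_vector_derivative ?u' s) (at s)" for s
        by (intro has_vector_derivative_diff quot_deriv
            bounded_linear.has_vector_derivative[OF bounded_linear_scaleR_right])
      show "norm (?u' s) \<le> L * norm (?u s) + (2 + \<bar>a\<bar>) * \<epsilon>'" if s: "\<bar>s\<bar> \<le> T" for s
      proof -
        let ?r = "\<lambda>h e. quot' h x e s - v' (\<phi> s x) (quot h x e s)"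
        have eq: "?u' s = v' (\<phi> s x) (?u s) + (?r h ?e1 - a *\<^sub>R ?r k e2 - ?r l e3)"
          by (simp add: blinfun.diff_right blinfun.scaleR_right scaleR_diff_right)
        have "norm (v' (\<phi> s x) (?u s)) \<le> norm (v' (\<phi> s x)) * norm (?u s)"
          by (rule norm_blinfun)
        also have "\<dots> \<le> L * norm (?u s)"
          using L(2)[OF norm_phi_le[OF s x]] by (simp add: mult_right_mono)
        finally have 1: "norm (v' (\<phi> s x) (?u s)) \<le> L * norm (?u s)" .
        have r: "norm (?r h ?e1) \<le> \<epsilon>'" "norm (?r k e2) \<le> \<epsilon>'" "norm (?r l e3) \<le> \<epsilon>'"
          using \<delta>(2) hkl x e s by auto
        have "norm (?r h ?e1 - a *\<^sub>R ?r k e2 - ?r l e3) \<le> norm (?r h ?e1) + \<bar>a\<bar> * norm (?r k e2) + norm (?r l e3)"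
          using norm_triangle_ineq4[of "?r h ?e1 - a *\<^sub>R ?r k e2" "?r l e3"]
            norm_triangle_ineq4[of "?r h ?e1" "a *\<^sub>R ?r k e2"] unfolding norm_scaleR by linarith
        also have "\<dots> \<le> \<epsilon>' + \<bar>a\<bar> * \<epsilon>' + \<epsilon>'"
          using r by (intro add_mono mult_left_mono) auto
        finally have 2: "norm (?r h ?e1 - a *\<^sub>R ?r k e2 - ?r l e3) \<le> (2 + \<bar>a\<bar>) * \<epsilon>'"
          by (simp add: algebra_simps)
        show ?thesis
          unfolding eq using 1 2 norm_triangle_ineq[of "v' (\<phi> s x) (?u s)" "?r h ?e1 - a *\<^sub>R ?r k e2 - ?r l e3"]
          by linarith
      qed
    qed (use L t \<epsilon>'(1) in auto)
    moreover have "?u 0 = 0" using hkl by (simp add: quot_0)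
    ultimately show ?thesis using \<epsilon>'(2) by (simp add: C_def)
  qed
  then show ?thesis using \<delta>(1) by blast
qed

text \<open>The choice of step sizes is immaterial: by \<open>quot_Z_uniform\<close> all small steps
  lead to this limit, uniformly on bounded sets.\<close>

definition Z :: "real \<Rightarrow> 'a \<Rightarrow> 'a \<Rightarrow> 'a" where
  "Z t x e = lim (\<lambda>n. quot (inverse (real (Suc n))) x e t)"

lemma quot_0_vec [simp]: "quot h x 0 t = 0"
  by (simp add: quot_def)

lemma quot_Cauchy:
  assumes "0 < \<epsilon>"
  shows "\<exists>\<delta>>0. \<forall>h k x e t. small \<delta> h \<longrightarrow> small \<delta> k \<longrightarrow> norm x \<le> R \<longrightarrow> norm e \<le> E \<longrightarrow> \<bar>t\<bar> \<le> T \<longrightarrow>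
     norm (quot h x e t - quot k x e t) \<le> \<epsilon>"
proof -
  obtain \<delta> where "\<delta> > 0" and \<delta>: "\<And>h k l x e2 e3 t. small \<delta> h \<Longrightarrow> small \<delta> k \<Longrightarrow> small \<delta> l \<Longrightarrow> norm x \<le> R \<Longrightarrow>
     norm (1 *\<^sub>R e2 + e3) \<le> max E 0 \<Longrightarrow> norm e2 \<le> max E 0 \<Longrightarrow> norm e3 \<le> max E 0 \<Longrightarrow> \<bar>t\<bar> \<le> T \<Longrightarrow>
     norm (quot h x (1 *\<^sub>R e2 + e3) t - 1 *\<^sub>R quot k x e2 t - quot l x e3 t) \<le> \<epsilon>"
    using quot_combination[OF assms, of R 1 "max E 0" T] by metis
  have "norm (quot h x e t - quot k x e t) \<le> \<epsilon>" if "small \<delta> h" "small \<delta> k" "norm x \<le> R" "norm e \<le> E" "\<bar>t\<bar> \<le> T"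
    for h k x e t
    using \<delta>[of h k "\<delta>/2" x e 0 t] that \<open>\<delta> > 0\<close> by auto
  then show ?thesis using \<open>\<delta> > 0\<close> by blast
qed

lemma inverse_Suc_tendsto: "(\<lambda>n. inverse (real (Suc n))) \<longlonglongrightarrow> 0"
  by (rule LIMSEQ_inverse_real_of_nat)

lemma quot_tendsto: "(\<lambda>n. quot (inverse (real (Suc n))) x e t) \<longlonglongrightarrow> Z t x e"
proof -
  have "Cauchy (\<lambda>n. quot (inverse (real (Suc n))) x e t)"
  proof (rule CauchyI)
    fix r :: real assume "0 < r"
    then obtain \<delta> where \<delta>: "\<delta> > 0" "\<And>h k. small \<delta> h \<Longrightarrow> small \<delta> k \<Longrightarrow>
     norm (quot h x e t - quot k x e t) \<le> r / 2"
      using quot_Cauchy[of "r/2" "norm x" "norm e" "\<bar>t\<bar>"] by (metis half_gt_zero order_refl)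
    obtain N where N: "\<And>n. n \<ge> N \<Longrightarrow> inverse (real (Suc n)) < \<delta>"
      using order_tendstoD(2)[OF inverse_Suc_tendsto \<delta>(1)] unfolding eventually_sequentially by blast
    have "norm (quot (inverse (real (Suc m))) x e t - quot (inverse (real (Suc n))) x e t) < r" if "m \<ge> N" "n \<ge> N" for m n
    proof -
      have "norm (quot (inverse (real (Suc m))) x e t - quot (inverse (real (Suc n))) x e t) \<le> r / 2"
        using N[OF that(1)] N[OF that(2)] by (intro \<delta>(2)) auto
      then show ?thesis using \<open>0 < r\<close> by linarith
    qed
    then show "\<exists>M. \<forall>m\<ge>M. \<forall>n\<ge>M. norm (quot (inverse (real (Suc m))) x e t - quot (inverse (real (Suc n))) x e t) < r"
      by blast
  qed
  then show ?thesis
    unfolding Z_def by (simp add: Cauchy_convergent_iff convergent_LIMSEQ_iff)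
qed

lemma quot_Z_uniform:
  assumes "0 < \<epsilon>"
  shows "\<exists>\<delta>>0. \<forall>h x e t. small \<delta> h \<longrightarrow> norm x \<le> R \<longrightarrow> norm e \<le> E \<longrightarrow> \<bar>t\<bar> \<le> T \<longrightarrow>
     norm (quot h x e t - Z t x e) \<le> \<epsilon>"
proof -
  obtain \<delta> where \<delta>: "\<delta> > 0" "\<And>h k x e t. small \<delta> h \<Longrightarrow> small \<delta> k \<Longrightarrow> norm x \<le> R \<Longrightarrow> norm e \<le> E \<Longrightarrow> \<bar>t\<bar> \<le> T \<Longrightarrow>
     norm (quot h x e t - quot k x e t) \<le> \<epsilon>"
    using quot_Cauchy[OF assms, of R E T] by metis
  have "norm (quot h x e t - Z t x e) \<le> \<epsilon>"
    if h: "small \<delta> h" and x: "norm x \<le> R" and e: "norm e \<le> E" and t: "\<bar>t\<bar> \<le> T" for h x e t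
  proof (rule tendsto_upperbound)
    show "(\<lambda>n. norm (quot h x e t - quot (inverse (real (Suc n))) x e t)) \<longlonglongrightarrow> norm (quot h x e t - Z t x e)"
      by (intro tendsto_intros quot_tendsto)
    have "\<forall>\<^sub>F n in sequentially. inverse (real (Suc n)) < \<delta>"
      by (rule order_tendstoD(2)[OF inverse_Suc_tendsto \<delta>(1)])
    then show "\<forall>\<^sub>F n in sequentially. norm (quot h x e t - quot (inverse (real (Suc n))) x e t) \<le> \<epsilon>"
      by eventually_elim (rule \<delta>(2), use h x e t in auto)
  qed simp
  then show ?thesis using \<delta>(1) by blast
qed

lemma Z_combination: "Z t x (a *\<^sub>R e2 + e3) = a *\<^sub>R Z t x e2 + Z t x e3"
proof -
  let ?h = "\<lambda>n. inverse (real (Suc n))"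
  let ?u = "\<lambda>n. quot (?h n) x (a *\<^sub>R e2 + e3) t - a *\<^sub>R quot (?h n) x e2 t - quot (?h n) x e3 t"
  have lim: "?u \<longlonglongrightarrow> Z t x (a *\<^sub>R e2 + e3) - a *\<^sub>R Z t x e2 - Z t x e3"
    by (intro tendsto_intros quot_tendsto)
  have "?u \<longlonglongrightarrow> 0"
  proof (rule LIMSEQ_I)
    fix r :: real assume "0 < r"
    define E where "E = max (norm (a *\<^sub>R e2 + e3)) (max (norm e2) (norm e3))"
    obtain \<delta> where "\<delta> > 0" and \<delta>: "\<And>h k l e2 e3. small \<delta> h \<Longrightarrow> small \<delta> k \<Longrightarrow> small \<delta> l \<Longrightarrow>
       norm (a *\<^sub>R e2 + e3) \<le> E \<Longrightarrow> norm e2 \<le> E \<Longrightarrow> norm e3 \<le> E \<Longrightarrow>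
       norm (quot h x (a *\<^sub>R e2 + e3) t - a *\<^sub>R quot k x e2 t - quot l x e3 t) \<le> r / 2"
      using quot_combination[of "r/2" "norm x" a E "\<bar>t\<bar>"] \<open>0 < r\<close> by (metis half_gt_zero order_refl)
    obtain N where N: "\<And>n. n \<ge> N \<Longrightarrow> ?h n < \<delta>"
      using order_tendstoD(2)[OF inverse_Suc_tendsto \<open>\<delta> > 0\<close>] unfolding eventually_sequentially by blast
    have "norm (?u n - 0) < r" if "n \<ge> N" for n
    proof -
      have "norm (?u n) \<le> r / 2"
        using N[OF that] by (intro \<delta>) (auto simp: E_def)
      then show ?thesis using \<open>0 < r\<close> by simp
    qed
    then show "\<exists>no. \<forall>n\<ge>no. norm (?u n - 0) < r" by blast
  qed
  then have "Z t x (a *\<^sub>R e2 + e3) - a *\<^sub>R Z t x e2 - Z t x e3 = 0"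
    using lim LIMSEQ_unique by blast
  then show ?thesis by (simp add: algebra_simps)
qed

lemma Z_0 [simp]: "Z t x 0 = 0"
  using LIMSEQ_unique[OF quot_tendsto[of x 0 t]] by simp

lemma linear_Z: "linear (Z t x)"
proof
  show "Z t x (a + b) = Z t x a + Z t x b" for a b
    using Z_combination[of t x 1 a b] by simp
  show "Z t x (c *\<^sub>R a) = c *\<^sub>R Z t x a" for c a
    using Z_combination[of t x c a 0] by simp
qed

text \<open>Uniformity over all directions of norm at most 1 turns directional derivatives into a
  Frechet derivative: \<open>y - x\<close> is split into its length and a unit direction.\<close>

lemma has_derivative_phi_Z: "(\<phi> t has_derivative Z t x) (at x)"
  unfolding has_derivative_at_alt
proof (intro conjI allI impI)
  show "bounded_linear (Z t x)" using linear_Z by (simp add: linear_conv_bounded_linear)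
  fix e :: real assume "0 < e"
  then obtain \<delta> where \<delta>: "\<delta> > 0" "\<And>h e'. small \<delta> h \<Longrightarrow> norm e' \<le> 1 \<Longrightarrow> 
     norm (quot h x e' t - Z t x e') \<le> e"
    using quot_Z_uniform[of e "norm x" 1 "\<bar>t\<bar>"] by (metis order_refl)
  have "norm (\<phi> t y - \<phi> t x - Z t x (y - x)) \<le> e * norm (y - x)" if "norm (y - x) < \<delta>" for y
  proof (cases "y = x")
    case False
    define h where "h = norm (y - x)"
    define e' where "e' = (y - x) /\<^sub>R h"
    have h: "h > 0" "h < \<delta>" using False that by (auto simp: h_def)
    have e': "norm e' \<le> 1" "y - x = h *\<^sub>R e'" "x + h *\<^sub>R e' = y" using h by (auto simp: e'_def h_def)
    have "\<phi> t y - \<phi> t x = h *\<^sub>R quot h x e' t" using h e' by (simp add: quot_def)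
    moreover have "Z t x (y - x) = h *\<^sub>R Z t x e'" using e'(2) linear_Z by (simp add: linear_scale)
    ultimately have "\<phi> t y - \<phi> t x - Z t x (y - x) = h *\<^sub>R (quot h x e' t - Z t x e')"
      by (simp add: scaleR_diff_right)
    then have "norm (\<phi> t y - \<phi> t x - Z t x (y - x)) = h * norm (quot h x e' t - Z t x e')"
      using h by simp
    also have "\<dots> \<le> h * e" using \<delta>(2)[of h e'] h e' by (intro mult_left_mono) auto
    finally show ?thesis by (simp add: h_def mult.commute)
  qed simp
  then show "\<exists>d>0. \<forall>y. norm (y - x) < d \<longrightarrow> norm (\<phi> t y - \<phi> t x - Z t x (y - x)) \<le> e * norm (y - x)"
    using \<delta>(1) by blast
qed

lemma continuous_phi_compose [continuous_intros]:
  "continuous_on S f \<Longrightarrow> continuous_on S g \<Longrightarrow> continuous_on S (\<lambda>z. \<phi> (f z) (g z))"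
  using continuous_on_compose2[OF continuous_phi, of S "\<lambda>z. (f z, g z)"] continuous_on_Pair by fastforce

text \<open>On bounded sets \<open>Z\<close> is a uniform limit of difference quotients, which are
  continuous in time and start.\<close>

lemma continuous_Z: "continuous_on UNIV (\<lambda>(t, x). Z t x e)"
proof -
  have "continuous_on (ball 0 T \<times> ball 0 R) (\<lambda>(t, x). Z t x e)" for T R
  proof (rule uniform_limit_theorem)
    show "\<forall>\<^sub>F n in sequentially. continuous_on (ball 0 T \<times> ball 0 R) (\<lambda>(t, x). quot (inverse (real (Suc n))) x e t)"
      unfolding quot_def case_prod_beta by (intro always_eventually allI continuous_intros)
    show "uniform_limit (ball 0 T \<times> ball 0 R) (\<lambda>n (t, x). quot (inverse (real (Suc n))) x e t) (\<lambda>(t, x). Z t x e) sequentially"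
    proof (rule uniform_limitI)
      fix r :: real assume "0 < r"
      then obtain \<delta> where \<delta>: "\<delta> > 0" "\<And>h x t. small \<delta> h \<Longrightarrow> norm x \<le> R \<Longrightarrow> \<bar>t\<bar> \<le> T \<Longrightarrow>
         norm (quot h x e t - Z t x e) \<le> r / 2"
        using quot_Z_uniform[of "r/2" R "norm e" T] by (metis half_gt_zero order_refl)
      have "\<forall>\<^sub>F n in sequentially. inverse (real (Suc n)) < \<delta>"
        by (rule order_tendstoD(2)[OF inverse_Suc_tendsto \<delta>(1)])
      then show "\<forall>\<^sub>F n in sequentially. \<forall>p\<in>ball 0 T \<times> ball 0 R.
          dist ((\<lambda>(t, x). quot (inverse (real (Suc n))) x e t) p) ((\<lambda>(t, x). Z t x e) p) < r"
      proof eventually_elim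
        case (elim n)
        have "norm (quot (inverse (real (Suc n))) x e t - Z t x e) < r" if "norm x < R" "\<bar>t\<bar> < T" for t x
        proof -
          have "norm (quot (inverse (real (Suc n))) x e t - Z t x e) \<le> r / 2"
            using elim that by (intro \<delta>(2)) auto
          then show ?thesis using \<open>0 < r\<close> by linarith
        qed
        then show ?case by (auto simp: dist_norm)
      qed
    qed
  qed auto
  then have "continuous (at (t, x)) (\<lambda>(t, x). Z t x e)" for t x
    using continuous_on_eq_continuous_at[of "ball 0 (\<bar>t\<bar> + 1) \<times> ball 0 (norm x + 1)" "\<lambda>(t, x). Z t x e"]
    by (simp add: open_Times)
  then show ?thesis by (auto intro: continuous_at_imp_continuous_on)
qed

definition D\<phi> :: "real \<Rightarrow> 'a \<Rightarrow> 'a \<Rightarrow>\<^sub>L 'a" where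
  "D\<phi> t x = Blinfun (Z t x)"

lemma D\<phi>_apply: "blinfun_apply (D\<phi> t x) = Z t x"
  unfolding D\<phi>_def using linear_Z by (intro bounded_linear_Blinfun_apply) (simp add: linear_conv_bounded_linear)

lemma has_derivative_phi: "(\<phi> t has_derivative D\<phi> t x) (at x)"
  unfolding D\<phi>_apply by (rule has_derivative_phi_Z)

lemma continuous_D\<phi>: "continuous_on UNIV (\<lambda>(t, x). D\<phi> t x)"
proof (rule continuous_on_blinfun_componentwise)
  show "continuous_on UNIV (\<lambda>p. blinfun_apply ((\<lambda>(t, x). D\<phi> t x) p) i)" for i
    using continuous_Z[of i] by (simp add: case_prod_beta D\<phi>_apply)
qed

lemma continuous_D\<phi>_compose [continuous_intros]:
  "continuous_on S f \<Longrightarrow> continuous_on S g \<Longrightarrow> continuous_on S (\<lambda>z. D\<phi> (f z) (g z))"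
  using continuous_on_compose2[OF continuous_D\<phi>, of S "\<lambda>z. (f z, g z)"] continuous_on_Pair by fastforce

lemma D\<phi>_0 [simp]: "D\<phi> 0 x = id_blinfun"
proof (intro blinfun_eqI)
  fix e
  have "\<phi> 0 = (\<lambda>x. x)" by (simp add: fun_eq_iff)
  then have "blinfun_apply (D\<phi> 0 x) = (\<lambda>x. x)"
    using has_derivative_phi[of 0 x] has_derivative_unique[OF _ has_derivative_ident] by metis
  then show "D\<phi> 0 x e = id_blinfun e" by simp
qed

lemma D\<phi>_inverse: "D\<phi> (- t) (\<phi> t x) (D\<phi> t x e) = e" "D\<phi> t x (D\<phi> (- t) (\<phi> t x) e) = e"
proof -
  have 1: "D\<phi> (- t) (\<phi> t x) (D\<phi> t x e) = e" for t x e
  proof -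
    have "((\<phi> (- t) \<circ> \<phi> t) has_derivative (D\<phi> (- t) (\<phi> t x) \<circ> D\<phi> t x)) (at x)"
      by (intro diff_chain_at has_derivative_phi)
    moreover have "\<phi> (- t) \<circ> \<phi> t = (\<lambda>x. x)" by (simp add: fun_eq_iff)
    ultimately have "(\<lambda>x. x) = (blinfun_apply (D\<phi> (- t) (\<phi> t x)) \<circ> D\<phi> t x)"
      using has_derivative_unique[OF has_derivative_ident] by metis
    then show ?thesis by (metis comp_apply)
  qed
  show "D\<phi> (- t) (\<phi> t x) (D\<phi> t x e) = e" by (rule 1)
  show "D\<phi> t x (D\<phi> (- t) (\<phi> t x) e) = e" using 1[of "- t" "\<phi> t x" e] by simp
qed

text \<open>The variational equation at time 0, for the computation of brackets. The time
  derivatives of the difference quotients converge uniformly on a time interval, so differentiation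
  passes to the limit.\<close>

lemma D\<phi>_deriv_0: "((\<lambda>t. D\<phi> t x e) has_vector_derivative v' x e) (at 0)"
proof -
  let ?h = "\<lambda>n. inverse (real (Suc n))"
  obtain L where L: "L \<ge> 0" "\<And>y. norm y \<le> norm x + B * 1 \<Longrightarrow> norm (v' y) \<le> L"
    using norm_v'_bounded_on_cball by metis
  have "\<exists>g. \<forall>t\<in>{-1..1}. (\<lambda>n. quot (?h n) x e t) \<longlonglongrightarrow> g t \<and>
      (g has_derivative (\<lambda>c. c *\<^sub>R v' (\<phi> t x) (Z t x e))) (at t within {-1..1})"
  proof (rule has_derivative_sequence[where ?x0.0 = 0])
    show "(quot (?h n) x e has_derivative (\<lambda>c. c *\<^sub>R quot' (?h n) x e t)) (at t within {-1..1})" for n t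
      using quot_deriv[of "?h n" x e t] by (simp add: has_vector_derivative_def has_derivative_at_withinI)
    show "(\<lambda>n. quot (?h n) x e 0) \<longlonglongrightarrow> e" by (simp add: quot_0)
    fix r :: real assume "0 < r"
    \<comment> \<open>The error is at most r' from the equation of the quotient and L * r' from
      replacing the quotient by its limit.\<close>
    define r' where "r' = r / (L + 1)"
    have "r' > 0" using \<open>0 < r\<close> L by (simp add: r'_def)
    obtain \<delta>1 where \<delta>1: "\<delta>1 > 0" "\<And>h t. small \<delta>1 h \<Longrightarrow> \<bar>t\<bar> \<le> 1 \<Longrightarrow> norm (quot h x e t - Z t x e) \<le> r'"
      using quot_Z_uniform[OF \<open>r' > 0\<close>, of "norm x" "norm e" 1] by (metis order_refl)
    obtain \<delta>2 where \<delta>2: "\<delta>2 > 0" "\<And>h t. small \<delta>2 h \<Longrightarrow> \<bar>t\<bar> \<le> 1 \<Longrightarrow>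
        norm (quot' h x e t - v' (\<phi> t x) (quot h x e t)) \<le> r'"
      using quot_approx[OF \<open>r' > 0\<close>, of "norm x" "norm e" 1] by (metis order_refl)
    have "\<forall>\<^sub>F n in sequentially. ?h n < min \<delta>1 \<delta>2"
      by (rule order_tendstoD(2)[OF inverse_Suc_tendsto]) (use \<delta>1 \<delta>2 in auto)
    then show "\<forall>\<^sub>F n in sequentially. \<forall>t\<in>{-1..1}. \<forall>c.
        norm (c *\<^sub>R quot' (?h n) x e t - c *\<^sub>R v' (\<phi> t x) (Z t x e)) \<le> r * norm c"
    proof (eventually_elim, intro ballI allI)
      fix n :: nat and t c :: real assume n: "?h n < min \<delta>1 \<delta>2" and "t \<in> {-1..1}"
      then have t: "\<bar>t\<bar> \<le> 1" by auto
      have "norm (v' (\<phi> t x) (quot (?h n) x e t - Z t x e)) \<le> norm (v' (\<phi> t x)) * norm (quot (?h n) x e t - Z t x e)"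
        by (rule norm_blinfun)
      also have "\<dots> \<le> L * r'"
        using norm_phi_le[OF t, of x "norm x"] n t L by (intro mult_mono \<delta>1(2) L(2)) auto
      finally have 1: "norm (v' (\<phi> t x) (quot (?h n) x e t) - v' (\<phi> t x) (Z t x e)) \<le> L * r'"
        by (simp add: blinfun.diff_right)
      have 2: "norm (quot' (?h n) x e t - v' (\<phi> t x) (quot (?h n) x e t)) \<le> r'"
        using n t by (intro \<delta>2(2)) auto
      have "norm (quot' (?h n) x e t - v' (\<phi> t x) (Z t x e)) \<le> (L + 1) * r'"
        using norm_triangle_le[OF add_mono[OF 1 2]] by (simp add: algebra_simps)
      also have "\<dots> = r" using L by (simp add: r'_def)
      finally have "\<bar>c\<bar> * norm (quot' (?h n) x e t - v' (\<phi> t x) (Z t x e)) \<le> \<bar>c\<bar> * r"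
        by (rule mult_left_mono) simp
      then show "norm (c *\<^sub>R quot' (?h n) x e t - c *\<^sub>R v' (\<phi> t x) (Z t x e)) \<le> r * norm c"
        by (simp add: scaleR_diff_right[symmetric] mult.commute)
    qed
  qed auto
  then obtain g where g: "\<And>t. t \<in> {-1..1} \<Longrightarrow> (\<lambda>n. quot (?h n) x e t) \<longlonglongrightarrow> g t"
    "\<And>t. t \<in> {-1..1} \<Longrightarrow> (g has_derivative (\<lambda>c. c *\<^sub>R v' (\<phi> t x) (Z t x e))) (at t within {-1..1})"
    by blast
  have gZ: "g t = D\<phi> t x e" if "t \<in> {-1..1}" for t
    unfolding D\<phi>_apply using LIMSEQ_unique[OF g(1)[OF that] quot_tendsto] .
  have "(g has_derivative (\<lambda>c. c *\<^sub>R v' x e)) (at 0)"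
  proof -
    have "at (0::real) within {-1..1} = at 0"
      by (rule at_within_interior) (simp add: interior_atLeastAtMost_real)
    moreover have "Z 0 x e = e" using D\<phi>_0[of x] D\<phi>_apply[of 0 x] by (metis id_blinfun.rep_eq)
    ultimately show ?thesis using g(2)[of 0] by simp
  qed
  then have "((\<lambda>t. D\<phi> t x e) has_derivative (\<lambda>c. c *\<^sub>R v' x e)) (at 0)"
    by (rule has_derivative_transform_within_open[of _ _ _ _ "{-1<..<1}"]) (use gZ in auto)
  then show ?thesis by (simp add: has_vector_derivative_def)
qed

end

section \<open>Brackets and paths of full rank\<close>

lemma Ck_mono_Suc: "Ck (Suc k) f \<Longrightarrow> Ck k f"
proof (induction k arbitrary: f)
  case 0
  then show ?case
    by (auto intro!: continuous_at_imp_continuous_on differentiable_imp_continuous_within)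
next
  case (Suc k)
  from Suc.prems have "f differentiable at x" "Ck (Suc k) (\<lambda>x. frechet_derivative f (at x) h)" for x h
    by auto
  with Suc.IH show ?case by simp
qed

lemma Ck_const: "Ck k (\<lambda>x. c)"
proof (induction k arbitrary: c)
  case (Suc k)
  have "frechet_derivative (\<lambda>x. c) (at x) h = 0" for x h
    by (simp add: frechet_derivative_const)
  with Suc show ?case by simp
qed (simp add: continuous_on_const)

lemma frechet_derivative_eqI: "(f has_derivative f') (at x) \<Longrightarrow> frechet_derivative f (at x) = f'"
  by (rule frechet_derivative_at[symmetric])

lemma differentiable_has_frechet:
  "f differentiable at x \<Longrightarrow> (f has_derivative frechet_derivative f (at x)) (at x)"
  by (simp add: frechet_derivative_works)

lemma Ck_add: "Ck k f \<Longrightarrow> Ck k g \<Longrightarrow> Ck k (\<lambda>x. f x + g x)"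
proof (induction k arbitrary: f g)
  case 0
  then show ?case by (simp add: continuous_on_add)
next
  case (Suc k)
  have d: "((\<lambda>x. f x + g x) has_derivative (\<lambda>h. frechet_derivative f (at x) h + frechet_derivative g (at x) h)) (at x)" for x
    using Suc.prems by (intro has_derivative_add differentiable_has_frechet) auto
  show ?case
    using Suc d by (auto simp: frechet_derivative_eqI[OF d] intro: differentiableI)
qed

lemma Ck_bounded_linear: "bounded_linear T \<Longrightarrow> Ck k f \<Longrightarrow> Ck k (\<lambda>x. T (f x))"
proof (induction k arbitrary: f)
  case 0
  then show ?case by (simp add: bounded_linear.continuous_on)
next
  case (Suc k)
  have d: "((\<lambda>x. T (f x)) has_derivative (\<lambda>h. T (frechet_derivative f (at x) h))) (at x)" for x
    using Suc.prems by (intro bounded_linear.has_derivative[OF Suc.prems(1)] differentiable_has_frechet) auto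
  show ?case
    using Suc d by (auto simp: frechet_derivative_eqI[OF d] intro: differentiableI)
qed

lemma Ck_scaleR: "Ck k f \<Longrightarrow> Ck k g \<Longrightarrow> Ck k (\<lambda>x. f x *\<^sub>R g x)"
proof (induction k arbitrary: f g)
  case 0
  then show ?case by (simp add: continuous_on_scaleR)
next
  case (Suc k)
  have d: "((\<lambda>x. f x *\<^sub>R g x) has_derivative
      (\<lambda>h. f x *\<^sub>R frechet_derivative g (at x) h + frechet_derivative f (at x) h *\<^sub>R g x)) (at x)" for x
    using Suc.prems by (intro has_derivative_scaleR differentiable_has_frechet) auto
  have "Ck k f" "Ck k g" using Suc.prems Ck_mono_Suc by blast+
  then show ?case
    using Suc d by (auto simp: frechet_derivative_eqI[OF d] intro!: Ck_add intro: differentiableI)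
qed

lemma Ck_sum: "(\<And>i. i \<in> A \<Longrightarrow> Ck k (f i)) \<Longrightarrow> Ck k (\<lambda>x. \<Sum>i\<in>A. f i x)"
  by (induction A rule: infinite_finite_induct) (simp_all add: Ck_const Ck_add)

lemma smooth_imp_differentiable: "smooth f \<Longrightarrow> f differentiable at x"
  unfolding smooth_def by (metis Ck.simps(2))

lemma smooth_imp_continuous: "smooth f \<Longrightarrow> continuous_on UNIV f"
  unfolding smooth_def by (metis Ck.simps(1))

text \<open>\<open>Ck\<close> controls derivatives in constant directions, so the variable direction
  \<open>V x\<close> is expanded in the standard basis.\<close>

lemma Ck_frechet_apply:
  assumes "smooth V" "smooth W"
  shows "Ck k (\<lambda>x. frechet_derivative W (at x) (V x))"
proof -
  have eq: "frechet_derivative W (at x) (V x) = (\<Sum>b\<in>Basis. (V x \<bullet> b) *\<^sub>R frechet_derivative W (at x) b)" for x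
  proof -
    have lin: "linear (frechet_derivative W (at x))"
      using assms by (intro linear_frechet_derivative smooth_imp_differentiable)
    have "frechet_derivative W (at x) (V x) = frechet_derivative W (at x) (\<Sum>b\<in>Basis. (V x \<bullet> b) *\<^sub>R b)"
      by (simp add: euclidean_representation)
    also have "\<dots> = (\<Sum>b\<in>Basis. (V x \<bullet> b) *\<^sub>R frechet_derivative W (at x) b)"
      using lin by (simp add: linear_sum linear_scale)
    finally show ?thesis .
  qed
  have "Ck k V" "Ck (Suc k) W" using assms by (simp_all only: smooth_def)
  then show ?thesis
    unfolding eq by (intro Ck_sum Ck_scaleR Ck_bounded_linear[OF bounded_linear_inner_left]) auto
qed

lemma smooth_lie_bracket:
  assumes "smooth V" "smooth W"
  shows "smooth (lie_bracket V W)"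
  unfolding smooth_def
proof
  fix k
  have "Ck k (\<lambda>x. frechet_derivative W (at x) (V x) + - frechet_derivative V (at x) (W x))"
    using assms by (intro Ck_add Ck_bounded_linear[OF bounded_linear_minus[OF bounded_linear_ident]] Ck_frechet_apply)
  then show "Ck k (lie_bracket V W)"
    by (simp add: lie_bracket_def[abs_def])
qed

text \<open>\<open>frechet_derivative\<close> carries information only for differentiable functions,
  so this is what makes iterated brackets usable, both for differentiation and as continuous
  fields.\<close>

lemma smooth_bracket_fields:
  assumes "\<And>i. smooth (v i)" "W \<in> bracket_fields v k"
  shows "smooth W"
  using assms(2)
proof (induction k arbitrary: W)
  case 0 then show ?case using assms(1) by auto
next
  case (Suc k) then show ?case using assms(1) by (auto intro!: smooth_lie_bracket)
qed

section \<open>Linear maps near the identity and openness of the bracket condition\<close>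

lemma norm_linear_minus_identity_le:
  fixes A :: "'a::euclidean_space \<Rightarrow> 'a"
  assumes "linear A" and "\<And>e. e \<in> Basis \<Longrightarrow> norm (A e - e) \<le> \<epsilon> / DIM('a)" and "0 \<le> \<epsilon>"
  shows "norm (A z - z) \<le> \<epsilon> * norm z"
proof -
  have "A z - z = A (\<Sum>e\<in>Basis. (z \<bullet> e) *\<^sub>R e) - (\<Sum>e\<in>Basis. (z \<bullet> e) *\<^sub>R e)"
    by (simp add: euclidean_representation)
  also have "\<dots> = (\<Sum>e\<in>Basis. (z \<bullet> e) *\<^sub>R (A e - e))"
    using assms(1) by (simp add: linear_sum linear_scale sum_subtractf scaleR_diff_right)
  finally have "norm (A z - z) \<le> (\<Sum>e\<in>Basis. norm ((z \<bullet> e) *\<^sub>R (A e - e)))"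
    by (metis norm_sum)
  also have "\<dots> \<le> (\<Sum>e\<in>(Basis::'a set). norm z * (\<epsilon> / DIM('a)))"
  proof (rule sum_mono)
    fix e :: 'a assume "e \<in> Basis"
    then show "norm ((z \<bullet> e) *\<^sub>R (A e - e)) \<le> norm z * (\<epsilon> / DIM('a))"
      using assms(2)[of e] Basis_le_norm[of e z] assms(3) unfolding norm_scaleR real_norm_def
      by (intro mult_mono) auto
  qed
  also have "\<dots> = \<epsilon> * norm z" by simp
  finally show ?thesis .
qed

lemma surj_near_identity:
  fixes A :: "'a::euclidean_space \<Rightarrow> 'a"
  assumes "linear A" and "\<And>e. e \<in> Basis \<Longrightarrow> norm (A e - e) \<le> (1 / 2) / DIM('a)"
  shows "surj A"
proof -
  have "z = 0" if "A z = 0" for z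
    using norm_linear_minus_identity_le[OF assms, of z] that by simp
  then show ?thesis
    using assms(1) linear_injective_0 linear_injective_imp_surjective by blast
qed

text \<open>Every vector of the span at \<open>x\<close> is the value at \<open>x\<close> of a
  continuous field that stays in the spans of the bracket fields. The fields through the basis
  vectors stay close to them near \<open>x\<close>, and a linear map close to the identity is
  onto.\<close>

lemma weak_Hormander_eventually:
  fixes v :: "'n \<Rightarrow> 'a::euclidean_space \<Rightarrow> 'a"
  assumes smooth: "\<And>i. smooth (v i)" and wH: "weak_Hormander v x"
  shows "\<forall>\<^sub>F y in nhds x. weak_Hormander v y"
proof -
  let ?F = "\<Union>k. bracket_fields v k"
  have "\<exists>E. continuous_on UNIV E \<and> E x = e \<and> (\<forall>y. E y \<in> span {V y |V. V \<in> ?F})" for e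
  proof -
    have "e \<in> span {V x |V. V \<in> ?F}" using wH by (simp add: weak_Hormander_def)
    then show ?thesis
    proof (induction rule: span_induct_alt)
      case base
      show ?case by (rule exI[of _ "\<lambda>_. 0"]) (auto intro: span_zero)
    next
      case (step c w z)
      then obtain V E where V: "V \<in> ?F" "w = V x" and E: "continuous_on UNIV E" "E x = z" "\<And>y. E y \<in> span {V y |V. V \<in> ?F}"
        by blast
      have "continuous_on UNIV V" using V(1) by (auto intro: smooth_imp_continuous smooth_bracket_fields[of v, OF smooth])
      moreover have "c *\<^sub>R V y + E y \<in> span {V y |V. V \<in> ?F}" for y
        using V(1) by (intro span_add span_scale E(3) span_base) auto
      ultimately show ?case
        using V(2) E by (intro exI[of _ "\<lambda>y. c *\<^sub>R V y + E y"]) (auto intro!: continuous_intros)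
    qed
  qed
  then have "\<exists>E. \<forall>e. continuous_on UNIV (E e) \<and> E e x = e \<and> (\<forall>y. E e y \<in> span {V y |V. V \<in> ?F})"
    by (intro choice allI)
  then obtain E where E: "\<And>e. continuous_on UNIV (E e)" "\<And>e. E e x = e"
     "\<And>e y. E e y \<in> span {V y |V. V \<in> ?F}"
    by blast
  have "\<forall>\<^sub>F y in nhds x. \<forall>e\<in>Basis. norm (E e y - e) < (1 / 2) / DIM('a)"
  proof (rule eventually_ball_finite, simp, rule ballI)
    fix e :: 'a
    have "(E e \<longlongrightarrow> E e x) (nhds x)"
      using E(1)[of e] by (simp add: continuous_on_eq_continuous_at continuous_at tendsto_at_iff_tendsto_nhds)
    then have "((\<lambda>y. norm (E e y - e)) \<longlongrightarrow> norm (E e x - e)) (nhds x)"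
      by (intro tendsto_intros)
    then show "\<forall>\<^sub>F y in nhds x. norm (E e y - e) < (1 / 2) / DIM('a)"
      by (rule order_tendstoD) (simp add: E(2))
  qed
  then show ?thesis
  proof eventually_elim
    case (elim y)
    define A where "A z = (\<Sum>e\<in>Basis. (z \<bullet> e) *\<^sub>R E e y)" for z
    have lin: "linear A"
      unfolding A_def by (rule linearI) (simp_all add: inner_add_left scaleR_left_distrib sum.distrib scaleR_sum_right)
    have "A e = E e y" if "e \<in> Basis" for e
    proof -
      have "A e = (\<Sum>b\<in>Basis. if b = e then E b y else 0)"
        unfolding A_def using that by (intro sum.cong) (auto simp: inner_Basis)
      then show ?thesis using that by simp
    qed
    then have "surj A" using elim by (intro surj_near_identity lin) (auto intro: less_imp_le)
    moreover have "range A \<subseteq> span {V y |V. V \<in> ?F}"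
      unfolding A_def by (intro image_subsetI span_sum span_scale E)
    ultimately show ?case unfolding weak_Hormander_def by (simp add: top.extremum_unique)
  qed
qed

lemma has_vector_derivative_quotient:
  assumes "(g has_vector_derivative L) (at 0)"
  shows "((\<lambda>t. (g t - g 0) /\<^sub>R t) \<longlongrightarrow> L) (at 0)"
proof -
  have "((\<lambda>t. norm (g t - g 0 - t *\<^sub>R L) / norm t) \<longlongrightarrow> 0) (at 0)"
    using assms by (simp add: has_vector_derivative_def has_derivative_iff_norm)
  moreover have "\<forall>\<^sub>F t in at 0. norm (g t - g 0 - t *\<^sub>R L) / norm t = norm ((g t - g 0) /\<^sub>R t - L)"
    unfolding eventually_at_filter
  proof (intro always_eventually allI impI)
    fix t :: real assume "t \<noteq> 0"
    then have "(g t - g 0) /\<^sub>R t - L = (g t - g 0 - t *\<^sub>R L) /\<^sub>R t"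
      by (simp add: scaleR_diff_right)
    then show "norm (g t - g 0 - t *\<^sub>R L) / norm t = norm ((g t - g 0) /\<^sub>R t - L)"
      by (simp add: divide_inverse mult.commute)
  qed
  ultimately have "((\<lambda>t. norm ((g t - g 0) /\<^sub>R t - L)) \<longlongrightarrow> 0) (at 0)"
    by (rule Lim_transform_eventually)
  then show ?thesis
    by (subst Lim_null) (rule tendsto_norm_zero_cancel)
qed

section \<open>Tangent spaces reached by varying durations\<close>

locale C1_flows =
  fixes v :: "'n::finite \<Rightarrow> 'a::euclidean_space \<Rightarrow> 'a" and v' :: "'n \<Rightarrow> 'a \<Rightarrow> 'a \<Rightarrow>\<^sub>L 'a"
    and \<phi> :: "'n \<Rightarrow> real \<Rightarrow> 'a \<Rightarrow> 'a" and B :: real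
  assumes C1: "C1_flow (v i) (v' i) (\<phi> i) B"
begin

sublocale C1_flow "v i" "v' i" "\<phi> i" B for i by (rule C1)

abbreviation D where "D i \<equiv> C1_flow.D\<phi> (\<phi> i)"

text \<open>In lists of steps the head is the last step.\<close>

fun endpoint :: "'a \<Rightarrow> ('n \<times> real) list \<Rightarrow> 'a" where
  "endpoint x [] = x"
| "endpoint x ((i, t) # p) = \<phi> i t (endpoint x p)"

text \<open>The image of the derivative of the endpoint with respect to the durations: earlier
  variations are carried along by the linearized last flow, and a change of the last duration adds a
  multiple of its field.\<close>

fun reach :: "'a \<Rightarrow> ('n \<times> real) list \<Rightarrow> 'a set" where
  "reach x [] = {0}"
| "reach x ((i, t) # p) =
     {D i t (endpoint x p) u + c *\<^sub>R v i (endpoint x ((i, t) # p)) | u c. u \<in> reach x p}"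

lemma subspace_reach: "subspace (reach x p)"
proof (induction p)
  case (Cons it p)
  obtain i t where it: "it = (i, t)" by force
  let ?D = "D i t (endpoint x p)" and ?w = "v i (\<phi> i t (endpoint x p))"
  have "reach x (it # p) = {a + b |a b. a \<in> ?D ` reach x p \<and> b \<in> span {?w}}"
    unfolding it by (auto simp: span_singleton) 
  moreover have "subspace (?D ` reach x p)"
    using Cons by (intro linear_subspace_image) (auto simp: bounded_linear.linear[OF blinfun.bounded_linear_right])
  ultimately show ?case by (simp add: subspace_sums)
qed simp

lemma image_reach_subset: "D i t (endpoint x p) ` reach x p \<subseteq> reach x ((i, t) # p)"
proof
  fix w assume "w \<in> D i t (endpoint x p) ` reach x p"
  then obtain u where "u \<in> reach x p" "w = D i t (endpoint x p) u + 0 *\<^sub>R v i (endpoint x ((i, t) # p))"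
    by auto
  then show "w \<in> reach x ((i, t) # p)" unfolding reach.simps by blast
qed

lemma field_in_reach: "v i (endpoint x ((i, t) # p)) \<in> reach x ((i, t) # p)"
proof -
  have "v i (endpoint x ((i, t) # p)) = D i t (endpoint x p) 0 + 1 *\<^sub>R v i (endpoint x ((i, t) # p))"
    by (simp add: blinfun.zero_right)
  moreover have "0 \<in> reach x p" by (rule subspace_0[OF subspace_reach])
  ultimately show ?thesis unfolding reach.simps by blast
qed

lemma dim_image_reach: "dim (D i t (endpoint x p) ` reach x p) = dim (reach x p)"
proof (rule dim_image_eq)
  show "inj_on (D i t (endpoint x p)) (span (reach x p))"
    by (rule inj_on_inverseI) (rule D\<phi>_inverse(1))
qed (simp add: bounded_linear.linear[OF blinfun.bounded_linear_right])

lemma norm_endpoint_diff_le: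
  "\<forall>(i, t)\<in>set p. 0 \<le> t \<Longrightarrow> norm (endpoint x p - x) \<le> B * sum_list (map snd p)"
proof (induction p)
  case (Cons it p)
  obtain i t where it: "it = (i, t)" by force
  have "norm (\<phi> i t (endpoint x p) - endpoint x p) \<le> B * t"
    using norm_phi_diff_le[of i t "endpoint x p" 0] Cons.prems by (simp add: it)
  moreover have "norm (endpoint x p - x) \<le> B * sum_list (map snd p)" using Cons by auto
  ultimately show ?case
    using norm_triangle_ineq[of "\<phi> i t (endpoint x p) - endpoint x p" "endpoint x p - x"]
    by (simp add: it algebra_simps)
qed simp

text \<open>A path whose reachable tangent space has maximal dimension cannot be improved by further steps.
  Hence that space is invariant under the linearized flows, contains the vector fields, and by
  differentiation at time \<open>0\<close> contains their brackets.\<close>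

lemma ex_full_reach:
  assumes smooth: "\<And>i. smooth (v i)" and wH: "weak_Hormander v x"
  shows "\<exists>p. (\<forall>(i, t)\<in>set p. 0 \<le> t) \<and> reach x p = UNIV"
proof -
  obtain \<delta> where \<delta>: "\<delta> > 0" "\<And>y. dist y x < \<delta> \<Longrightarrow> weak_Hormander v y"
    using weak_Hormander_eventually[OF smooth wH] unfolding eventually_nhds_metric by blast
  \<comment> \<open>Speeds are at most B, so paths of total duration below \<epsilon> end within
    \<delta> of \<open>x\<close>, where the bracket condition still holds.\<close>
  define \<epsilon> where "\<epsilon> = \<delta> / (B + 1)"
  have \<epsilon>: "\<epsilon> > 0" using \<delta> B_nonneg by (simp add: \<epsilon>_def)
  define P where "P p \<longleftrightarrow> (\<forall>(i, t)\<in>set p. 0 \<le> t) \<and> sum_list (map snd p) < \<epsilon>" for p :: "('n \<times> real) list"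
  \<comment> \<open>A maximum exists because dimensions are bounded by that of the space. The strict
    bound on the total duration in \<open>P\<close> leaves room for one more short step.\<close>
  define best where "best p \<longleftrightarrow> P p \<and> (\<forall>q. P q \<longrightarrow> dim (reach x q) \<le> dim (reach x p))" for p
  have "\<exists>p. best p"
    unfolding best_def using arg_max_nat_lemma[of P "[]" "\<lambda>q. dim (reach x q)" "Suc DIM('a)"] \<epsilon>
    by (auto simp: P_def dim_subset_UNIV less_Suc_eq_le)
  then obtain p where p: "best p" ..
  \<comment> \<open>The linearized flow is injective, so the pushed-forward space already has the
    maximal dimension, and its inclusion in the new space is an equality.\<close>
  have ext: "reach x ((i, t) # q) = D i t (endpoint x q) ` reach x q"
    if "best q" "0 \<le> t" "t + sum_list (map snd q) < \<epsilon>" for i t q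
  proof (rule subspace_dim_equal[symmetric])
    show "subspace (D i t (endpoint x q) ` reach x q)"
      by (intro linear_subspace_image subspace_reach) (simp add: bounded_linear.linear[OF blinfun.bounded_linear_right])
    show "dim (D i t (endpoint x q) ` reach x q) \<ge> dim (reach x ((i, t) # q))"
      using that unfolding dim_image_reach best_def by (auto simp: P_def simp del: reach.simps)
  qed (intro subspace_reach image_reach_subset)+
  have best_ext: "best ((i, t) # q)" if "best q" "0 \<le> t" "t + sum_list (map snd q) < \<epsilon>" for i t q
    using that ext[OF that] dim_image_reach unfolding best_def by (auto simp: P_def simp del: reach.simps)
  have main: "W (endpoint x q) \<in> reach x q" if "W \<in> bracket_fields v k" "best q" for W k q
    using that
  proof (induction k arbitrary: W q)
    case 0
    then obtain i where i: "W = v i" by auto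
    \<comment> \<open>A step of duration 0 changes neither the endpoint nor the space, but the space
      it produces contains the field of its index.\<close>
    have "reach x ((i, 0) # q) = D i 0 (endpoint x q) ` reach x q"
      using 0 by (intro ext) (auto simp: best_def P_def)
    also have "\<dots> = reach x q" by simp
    finally show ?case using field_in_reach[of i x 0 q] i by simp
  next
    case (Suc k)
    have "lie_bracket (v i) W (endpoint x q) \<in> reach x q" if W: "W \<in> bracket_fields v k" for i W
    proof -
      let ?S = "reach x q" and ?y = "endpoint x q"
      let ?L = "lie_bracket (v i) W ?y"
      let ?I = "\<lambda>t. D i (- t) (\<phi> i t ?y)"
      define W' where "W' = frechet_derivative W (at ?y)"
      have dW: "(W has_derivative W') (at ?y)"
        using smooth_imp_differentiable[OF smooth_bracket_fields[of v, OF smooth W]]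
        by (simp add: W'_def frechet_derivative_works)
      \<comment> \<open>The derivative of \<open>g\<close> at 0 is the Lie bracket. Pulled back by
        \<open>?I t\<close> to the endpoint of \<open>q\<close>, the quotients of \<open>g t\<close>
        by t lie in the fixed closed subspace \<open>?S\<close>, and so does their limit.\<close>
      define g where "g t = W (\<phi> i t ?y) - D i t ?y (W ?y)" for t
      have "((W \<circ> (\<lambda>t. \<phi> i t ?y)) has_vector_derivative W' (v i ?y)) (at 0)"
      proof -
        have "((\<lambda>t. \<phi> i t ?y) has_derivative (\<lambda>h. h *\<^sub>R v i ?y)) (at 0)"
          using phi_deriv[of i ?y 0] by (simp add: has_vector_derivative_def)
        then have "((W \<circ> (\<lambda>t. \<phi> i t ?y)) has_derivative (W' \<circ> (\<lambda>h. h *\<^sub>R v i ?y))) (at 0)"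
          using dW by (intro diff_chain_at) simp_all
        moreover have "W' \<circ> (\<lambda>h. h *\<^sub>R v i ?y) = (\<lambda>h. h *\<^sub>R W' (v i ?y))"
          using dW has_derivative_bounded_linear bounded_linear.linear by (fastforce simp: linear_scale)
        ultimately show ?thesis by (simp add: has_vector_derivative_def)
      qed
      then have "(g has_vector_derivative W' (v i ?y) - v' i ?y (W ?y)) (at 0)"
        unfolding g_def[abs_def] o_def by (intro has_vector_derivative_diff D\<phi>_deriv_0)
      moreover have "W' (v i ?y) - v' i ?y (W ?y) = ?L"
        using frechet_derivative_eqI[OF has_derivative_v[of i ?y]] by (simp add: lie_bracket_def W'_def)
      ultimately have "((\<lambda>t. (g t - g 0) /\<^sub>R t) \<longlongrightarrow> ?L) (at 0)"
        by (intro has_vector_derivative_quotient) simp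
      moreover have "g 0 = 0" by (simp add: g_def)
      ultimately have lim: "((\<lambda>t. g t /\<^sub>R t) \<longlongrightarrow> ?L) (at_right 0)"
        by (auto intro: filterlim_at_split[THEN iffD1, THEN conjunct2])
      have "continuous_on UNIV ?I" by (intro continuous_intros)
      then have "(?I \<longlongrightarrow> ?I 0) (at_right 0)"
        unfolding continuous_on_def by (meson UNIV_I subset_UNIV tendsto_within_subset)
      then have "((\<lambda>t. ?I t (g t /\<^sub>R t)) \<longlongrightarrow> ?I 0 ?L) (at_right 0)"
        using lim by (intro tendsto_intros)
      then have lim': "((\<lambda>t. ?I t (g t /\<^sub>R t)) \<longlongrightarrow> ?L) (at_right 0)" by simp
      have "\<forall>\<^sub>F t in at_right 0. t < \<epsilon> - sum_list (map snd q)"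
        using Suc.prems(2) by (intro order_tendstoD(2)[OF tendsto_ident_at]) (auto simp: best_def P_def)
      moreover have "\<forall>\<^sub>F t in at_right (0::real). 0 < t"
        by (simp add: eventually_at_right_less)
      ultimately have "\<forall>\<^sub>F t in at_right 0. ?I t (g t /\<^sub>R t) \<in> ?S"
      proof eventually_elim
        case (elim t)
        then have t: "0 \<le> t" "t + sum_list (map snd q) < \<epsilon>" by auto
        have "W (endpoint x ((i, t) # q)) \<in> reach x ((i, t) # q)"
          by (intro Suc.IH W best_ext Suc.prems t)
        then obtain u where u: "u \<in> ?S" "W (\<phi> i t ?y) = D i t ?y u"
          unfolding ext[OF Suc.prems(2) t] by auto
        have "W ?y \<in> ?S" by (intro Suc.IH W Suc.prems)
        with u have "(u - W ?y) /\<^sub>R t \<in> ?S"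
          using subspace_reach by (intro subspace_scale subspace_diff)
        moreover have "?I t (g t /\<^sub>R t) = (u - W ?y) /\<^sub>R t"
          by (simp add: g_def u(2) blinfun.scaleR_right blinfun.diff_right D\<phi>_inverse)
        ultimately show ?case by simp
      qed
      then show ?thesis
        using lim' by (intro Lim_in_closed_set[OF closed_subspace[OF subspace_reach]]) auto
    qed
    then show ?case using Suc by auto
  qed
  have "dist (endpoint x p) x < \<delta>"
  proof -
    have "norm (endpoint x p - x) \<le> B * sum_list (map snd p)"
      using p by (intro norm_endpoint_diff_le) (simp add: best_def P_def)
    also have "\<dots> \<le> B * \<epsilon>" using p B_nonneg by (intro mult_left_mono) (auto simp: best_def P_def)
    also have "\<dots> < \<delta>" using \<delta> B_nonneg by (simp add: \<epsilon>_def field_simps)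
    finally show ?thesis by (simp add: dist_norm)
  qed
  then have "span {V (endpoint x p) |V. V \<in> (\<Union>k. bracket_fields v k)} = UNIV"
    using \<delta>(2) by (simp add: weak_Hormander_def)
  moreover have "span {V (endpoint x p) |V. V \<in> (\<Union>k. bracket_fields v k)} \<subseteq> reach x p"
    using main p by (intro span_minimal subspace_reach) auto
  ultimately have "reach x p = UNIV" by auto
  then show ?thesis using p by (auto simp: best_def P_def)
qed

end

section \<open>Change of variables\<close>

text \<open>A finite image makes the Jacobian integrable with the right value. Only an infinite
  image remains, and there a finite integral would force the image to have finite measure.\<close>

lemma emeasure_differentiable_image:
  fixes f :: "real^'m::{finite,wellorder} \<Rightarrow> real^'m::_"
  assumes A: "A \<in> sets borel" and fA: "f ` A \<in> sets borel"
    and der: "\<And>x. x \<in> A \<Longrightarrow> (f has_derivative f' x) (at x)" and inj: "inj_on f A"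
    and [measurable]: "(\<lambda>x. det (matrix (f' x))) \<in> borel_measurable borel"
  shows "emeasure lborel (f ` A) = (\<integral>\<^sup>+x. ennreal (indicator A x * \<bar>det (matrix (f' x))\<bar>) \<partial>lborel)"
proof (cases "emeasure lborel (f ` A) = \<infinity>")
  case False
  have AL: "A \<in> sets lebesgue" using A by simp
  have em: "emeasure lebesgue (f ` A) = emeasure lborel (f ` A)" using fA by simp
  have "f ` A \<in> lmeasurable"
    using fA False by (intro fmeasurableI) (auto simp: em less_top)
  then have "((\<lambda>x. \<bar>det (matrix (f' x))\<bar>) has_integral measure lebesgue (f ` A)) A"
    using has_measure_differentiable_image[OF AL _ inj, of f' "measure lebesgue (f ` A)"]
      has_derivative_at_withinI[OF der] by blast
  from nn_integral_has_integral_lebesgue[OF _ this]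
  have "(\<integral>\<^sup>+x. ennreal (indicator A x * \<bar>det (matrix (f' x))\<bar>) \<partial>lborel) = ennreal (measure lebesgue (f ` A))"
    by simp
  also have "\<dots> = emeasure lborel (f ` A)"
    using False em by (simp add: measure_def ennreal_enn2real_if less_top[symmetric])
  finally show ?thesis by simp
next
  case True
  have AL: "A \<in> sets lebesgue" using A by simp
  have "(\<integral>\<^sup>+x. ennreal (indicator A x * \<bar>det (matrix (f' x))\<bar>) \<partial>lborel) = \<infinity>"
  proof (rule ccontr)
    assume "(\<integral>\<^sup>+x. ennreal (indicator A x * \<bar>det (matrix (f' x))\<bar>) \<partial>lborel) \<noteq> \<infinity>"
    then have "(\<lambda>x. indicator A x * \<bar>det (matrix (f' x))\<bar>) integrable_on UNIV"
      using A by (intro nn_integral_integrable_on) (auto simp: less_top)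
    then have "(\<lambda>x. if x \<in> A then \<bar>det (matrix (f' x))\<bar> else 0) integrable_on UNIV"
      by (rule integrable_eq) (auto simp: indicator_def)
    then have "(\<lambda>x. \<bar>det (matrix (f' x))\<bar>) integrable_on A"
      by (simp only: integrable_restrict_UNIV)
    then have "f ` A \<in> lmeasurable"
      using measurable_differentiable_image_eq[OF AL _ inj, of f'] has_derivative_at_withinI[OF der] by blast
    from fmeasurableD2[OF this] show False using True fA by simp
  qed
  with True show ?thesis by simp
qed

text \<open>The change of variables theorem of the library is restricted to well-ordered index types.  Since
  only the continuity of the Jacobian matters here, it is transferred to an arbitrary finite index type
  along a copy of that type.\<close>

typedef 'a wo = "UNIV :: 'a set" morphisms of_wo to_wo by auto

lemmas wo_inverses [simp] = of_wo_inverse to_wo_inverse[OF UNIV_I]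

instance wo :: (finite) finite
proof
  have "(UNIV :: 'a wo set) = to_wo ` UNIV"
    by (metis UNIV_eq_I of_wo_inverse rangeI)
  then show "finite (UNIV :: 'a wo set)" by (metis finite_imageI finite)
qed

instantiation wo :: (countable) wellorder
begin

definition less_eq_wo :: "'a wo \<Rightarrow> 'a wo \<Rightarrow> bool" where
  "less_eq_wo a b \<longleftrightarrow> to_nat (of_wo a) \<le> to_nat (of_wo b)"

definition less_wo :: "'a wo \<Rightarrow> 'a wo \<Rightarrow> bool" where
  "less_wo a b \<longleftrightarrow> to_nat (of_wo a) < to_nat (of_wo b)"

instance
proof
  fix x y :: "'a wo"
  show "x \<le> y \<Longrightarrow> y \<le> x \<Longrightarrow> x = y"
    by (simp add: less_eq_wo_def of_wo_inject)
next
  fix P :: "'a wo \<Rightarrow> bool" and a :: "'a wo"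
  assume step: "\<And>x. (\<And>y. y < x \<Longrightarrow> P y) \<Longrightarrow> P x"
  show "P a"
    by (induction a rule: measure_induct_rule[of "\<lambda>a. to_nat (of_wo a)"]) (auto simp: less_wo_def intro: step)
qed (auto simp: less_eq_wo_def less_wo_def)

end

definition vec_to_wo :: "real^'d \<Rightarrow> real^('d wo)" where
  "vec_to_wo x = (\<chi> i. x $ of_wo i)"

definition vec_of_wo :: "real^('d wo) \<Rightarrow> real^'d" where
  "vec_of_wo x = (\<chi> i. x $ to_wo i)"

lemma vec_wo_inverses [simp]: "vec_of_wo (vec_to_wo x) = x" "vec_to_wo (vec_of_wo y) = y"
  by (simp_all add: vec_of_wo_def vec_to_wo_def vec_eq_iff)

lemma linear_vec_to_wo: "linear vec_to_wo"
  by (rule linearI) (simp_all add: vec_to_wo_def vec_eq_iff)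

lemma linear_vec_of_wo: "linear vec_of_wo"
  by (rule linearI) (simp_all add: vec_of_wo_def vec_eq_iff)

lemma bounded_linear_vec_wo:
  "bounded_linear (vec_to_wo :: real^'d \<Rightarrow> _)" "bounded_linear (vec_of_wo :: _ \<Rightarrow> real^'d)"
  using linear_vec_to_wo linear_vec_of_wo by (simp_all add: linear_conv_bounded_linear)

lemma measurable_vec_wo [measurable]:
  "vec_to_wo \<in> borel \<rightarrow>\<^sub>M borel" "vec_of_wo \<in> borel \<rightarrow>\<^sub>M borel"
  using bounded_linear_vec_wo
  by (auto intro!: borel_measurable_continuous_onI linear_continuous_on)

lemma image_vec_to_wo: "vec_to_wo ` A = vec_of_wo -` A"
  by (force simp: image_iff)

text \<open>Relabelling coordinates maps boxes to boxes with the same side lengths, and boxes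
  determine Lebesgue measure.\<close>

lemma distr_vec_to_wo: "distr lborel borel (vec_to_wo :: real^'d \<Rightarrow> _) = lborel"
proof (rule lborel_eqI[symmetric])
  fix l u :: "real^('d wo)"
  assume le: "\<And>b. b \<in> Basis \<Longrightarrow> l \<bullet> b \<le> u \<bullet> b"
  have pre: "vec_to_wo -` box l u = box (vec_of_wo l) (vec_of_wo u)"
  proof -
    have "(\<forall>i. l $ i < x $ of_wo i \<and> x $ of_wo i < u $ i) \<longleftrightarrow>
        (\<forall>i. l $ to_wo i < x $ i \<and> x $ i < u $ to_wo i)" for x :: "real^'d"
      by (metis of_wo_inverse wo_inverses(2))
    then show ?thesis
      by (auto simp: mem_box_cart vec_to_wo_def vec_of_wo_def set_eq_iff)
  qed
  have prod: "(\<Prod>b\<in>Basis. (u' - l') \<bullet> b) = (\<Prod>i\<in>UNIV. u' $ i - l' $ i)" for u' l' :: "real^'k"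
    unfolding Basis_vec_def
    by (simp add: image_def[symmetric] UNION_singleton_eq_range prod.reindex inj_on_def axis_eq_axis inner_axis)
  have "emeasure (distr lborel borel vec_to_wo) (box l u) = emeasure lborel (box (vec_of_wo l) (vec_of_wo u))"
    by (simp add: emeasure_distr pre)
  also have "\<dots> = (\<Prod>b\<in>Basis. (vec_of_wo u - vec_of_wo l) \<bullet> b)"
  proof (rule emeasure_lborel_box)
    fix b :: "real^'d" assume "b \<in> Basis"
    then obtain i where b: "b = axis i 1" by (auto simp: Basis_vec_def)
    have "axis (to_wo i) 1 \<in> (Basis :: (real^('d wo)) set)" by (simp add: axis_in_Basis_iff)
    from le[OF this] show "vec_of_wo l \<bullet> b \<le> vec_of_wo u \<bullet> b"
      by (simp add: b inner_axis vec_of_wo_def)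
  qed
  also have "(\<Prod>b\<in>Basis. (vec_of_wo u - vec_of_wo l) \<bullet> b) = (\<Prod>i\<in>UNIV. u $ to_wo i - l $ to_wo i)"
    by (simp add: prod vec_of_wo_def)
  also have "\<dots> = (\<Prod>i\<in>UNIV. u $ i - l $ i)"
    by (rule prod.reindex_bij_witness[of _ of_wo to_wo]) auto
  finally show "emeasure (distr lborel borel vec_to_wo) (box l u) = (\<Prod>b\<in>Basis. (u - l) \<bullet> b)"
    by (simp add: prod)
qed simp

definition jac :: "((real^'d) \<Rightarrow>\<^sub>L (real^'d)) \<Rightarrow> real" where
  "jac A = \<bar>det (matrix (\<lambda>y. vec_to_wo (A (vec_of_wo y))))\<bar>"

lemma jac_nonneg: "0 \<le> jac A" by (simp add: jac_def)

lemma continuous_det_wo: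
  "continuous_on UNIV (\<lambda>A :: (real^'d) \<Rightarrow>\<^sub>L (real^'d). det (matrix (\<lambda>y. vec_to_wo (A (vec_of_wo y)))))"
  unfolding det_def matrix_def vec_to_wo_def
  by (simp, intro continuous_intros)

lemma continuous_jac: "continuous_on UNIV jac"
  unfolding jac_def[abs_def] by (intro continuous_intros continuous_det_wo)

lemma continuous_jac_compose [continuous_intros]:
  "continuous_on S f \<Longrightarrow> continuous_on S (\<lambda>x. jac (f x))"
  using continuous_on_compose2[OF continuous_jac] by blast

lemma emeasure_image_jac:
  fixes f :: "real^'d \<Rightarrow> real^'d" and f' :: "real^'d \<Rightarrow> ((real^'d) \<Rightarrow>\<^sub>L (real^'d))"
  assumes A[measurable]: "A \<in> sets borel" and fA[measurable]: "f ` A \<in> sets borel"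
    and der: "\<And>x. x \<in> A \<Longrightarrow> (f has_derivative f' x) (at x)" and inj: "inj_on f A"
    and f': "continuous_on UNIV f'"
  shows "emeasure lborel (f ` A) = (\<integral>\<^sup>+x. ennreal (indicator A x * jac (f' x)) \<partial>lborel)"
proof -
  let ?g = "\<lambda>y. vec_to_wo (f (vec_of_wo y))" and ?g' = "\<lambda>y z. vec_to_wo (f' (vec_of_wo y) (vec_of_wo z))"
  let ?A = "vec_to_wo ` A"
  have [measurable]: "f' \<in> borel \<rightarrow>\<^sub>M borel" using f' by (rule borel_measurable_continuous_onI)
  have [measurable]: "(\<lambda>A :: (real^'d) \<Rightarrow>\<^sub>L (real^'d). det (matrix (\<lambda>y. vec_to_wo (A (vec_of_wo y))))) \<in> borel_measurable borel"
    by (rule borel_measurable_continuous_onI[OF continuous_det_wo])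
  have [measurable]: "jac \<in> borel_measurable (borel :: ((real^'d) \<Rightarrow>\<^sub>L (real^'d)) measure)"
    by (rule borel_measurable_continuous_onI[OF continuous_jac])
  have A': "?A \<in> sets borel"
    unfolding image_vec_to_wo using measurable_sets[OF measurable_vec_wo(2) A] by simp
  have gA: "?g ` ?A = vec_to_wo ` (f ` A)" by (simp add: image_image)
  have "vec_to_wo ` (f ` A) \<in> sets borel"
    unfolding image_vec_to_wo using measurable_sets[OF measurable_vec_wo(2) fA] by simp
  then have gA': "?g ` ?A \<in> sets borel" by (simp only: gA)
  have "emeasure lborel (f ` A) = emeasure lborel (vec_to_wo -` vec_to_wo ` (f ` A))"
    by (intro arg_cong[where f="emeasure lborel"]) (auto dest: arg_cong[of "vec_to_wo _" _ vec_of_wo])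
  also have "\<dots> = emeasure (distr lborel borel vec_to_wo) (?g ` ?A)"
    using gA' by (simp add: emeasure_distr gA)
  also have "\<dots> = emeasure lborel (?g ` ?A)" by (simp add: distr_vec_to_wo)
  also have "\<dots> = (\<integral>\<^sup>+x. ennreal (indicator ?A x * \<bar>det (matrix (?g' x))\<bar>) \<partial>lborel)"
  proof (rule emeasure_differentiable_image[OF A' gA'])
    show "(?g has_derivative ?g' y) (at y)" if "y \<in> ?A" for y
    proof -
      have "(vec_to_wo \<circ> (f \<circ> vec_of_wo) has_derivative
          vec_to_wo \<circ> (f' (vec_of_wo y) \<circ> vec_of_wo)) (at y)"
      proof (intro diff_chain_at)
        show "(vec_of_wo has_derivative vec_of_wo) (at y)" "(vec_to_wo has_derivative vec_to_wo) (at ((f \<circ> vec_of_wo) y))"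
          using bounded_linear_vec_wo bounded_linear_imp_has_derivative by blast+
        show "(f has_derivative f' (vec_of_wo y)) (at (vec_of_wo y))" using that by (auto intro: der)
      qed
      then show ?thesis by (simp add: o_def)
    qed
    show "inj_on ?g ?A"
      using inj by (auto simp: inj_on_def dest!: arg_cong[of "vec_to_wo _" _ vec_of_wo])
    show "(\<lambda>y. det (matrix (?g' y))) \<in> borel_measurable borel" by measurable
  qed
  also have "\<dots> = (\<integral>\<^sup>+x. ennreal (indicator ?A x * \<bar>det (matrix (?g' x))\<bar>) \<partial>distr lborel borel vec_to_wo)"
    by (simp add: distr_vec_to_wo)
  also have "\<dots> = (\<integral>\<^sup>+x. ennreal (indicator ?A (vec_to_wo x) * \<bar>det (matrix (?g' (vec_to_wo x)))\<bar>) \<partial>lborel)"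
  proof (rule nn_integral_distr)
    note A'[measurable]
    have "(\<lambda>y. det (matrix (?g' y))) \<in> borel_measurable borel" by measurable
    then have "(\<lambda>y. ennreal (indicator ?A y * \<bar>det (matrix (?g' y))\<bar>)) \<in> borel_measurable borel"
      using A' by (intro borel_measurable_times measurable_ennreal measurable_compose[OF _ measurable_ennreal]
          borel_measurable_abs borel_measurable_indicator)
    then show "(\<lambda>y. ennreal (indicator ?A y * \<bar>det (matrix (?g' y))\<bar>)) \<in> borel_measurable (distr lborel borel vec_to_wo)"
      by simp
  qed simp
  also have "\<dots> = (\<integral>\<^sup>+x. ennreal (indicator A x * jac (f' x)) \<partial>lborel)"
    by (intro nn_integral_cong) (auto simp: jac_def image_vec_to_wo indicator_def)
  finally show ?thesis .
qed

text \<open>The formula says that \<open>f\<close> sends the measure with density the Jacobian on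
  \<open>S\<close> to Lebesgue measure on the image of \<open>S\<close>; this is checked on a Borel
  set by measuring the part of \<open>S\<close> that is mapped into it. The image of
  \<open>S\<close> is open by invariance of domain, hence measurable.\<close>

lemma nn_integral_change_of_variables:
  fixes f :: "real^'d \<Rightarrow> real^'d" and f' :: "real^'d \<Rightarrow> ((real^'d) \<Rightarrow>\<^sub>L (real^'d))"
  assumes S: "open S" and cont: "continuous_on UNIV f" and inj: "inj_on f S"
    and der: "\<And>x. x \<in> S \<Longrightarrow> (f has_derivative f' x) (at x)"
    and f': "continuous_on UNIV f'" and [measurable]: "g \<in> borel_measurable borel"
  shows "(\<integral>\<^sup>+x. g (f x) * (indicator S x * ennreal (jac (f' x))) \<partial>lborel) = (\<integral>\<^sup>+y. g y * indicator (f ` S) y \<partial>lborel)"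
proof -
  have [measurable]: "f' \<in> borel \<rightarrow>\<^sub>M borel" using f' by (rule borel_measurable_continuous_onI)
  have [measurable]: "f \<in> borel \<rightarrow>\<^sub>M borel" using cont by (rule borel_measurable_continuous_onI)
  have [measurable]: "jac \<in> borel_measurable (borel :: ((real^'d) \<Rightarrow>\<^sub>L (real^'d)) measure)"
    by (rule borel_measurable_continuous_onI[OF continuous_jac])
  have [measurable]: "S \<in> sets borel" using S by simp
  have [measurable]: "f ` S \<in> sets borel"
    using invariance_of_domain[OF continuous_on_subset[OF cont] S inj] by simp
  have "distr (density lborel (\<lambda>x. indicator S x * ennreal (jac (f' x)))) borel f = density lborel (indicator (f ` S))"
  proof (rule measure_eqI)
    fix A assume "A \<in> sets (distr (density lborel (\<lambda>x. indicator S x * ennreal (jac (f' x)))) borel f)"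
    then have A[measurable]: "A \<in> sets borel" by simp
    let ?A = "S \<inter> f -` A"
    have A': "?A \<in> sets borel" using measurable_sets[of f borel borel A] by simp
    have fA: "f ` ?A = f ` S \<inter> A" by auto
    have "emeasure (distr (density lborel (\<lambda>x. indicator S x * ennreal (jac (f' x)))) borel f) A
        = (\<integral>\<^sup>+x. indicator S x * ennreal (jac (f' x)) * indicator (f -` A) x \<partial>lborel)"
      by (simp add: emeasure_distr emeasure_density measurable_sets[of f borel borel A, simplified])
    also have "\<dots> = (\<integral>\<^sup>+x. ennreal (indicator ?A x * jac (f' x)) \<partial>lborel)"
      by (intro nn_integral_cong) (auto simp: indicator_def)
    also have "\<dots> = emeasure lborel (f ` ?A)"
      using A' der inj f' by (intro emeasure_image_jac[symmetric]) (auto simp: fA intro: inj_on_subset)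
    also have "\<dots> = emeasure (density lborel (indicator (f ` S))) A"
      by (simp add: fA emeasure_density indicator_inter_arith[symmetric])
    finally show "emeasure (distr (density lborel (\<lambda>x. indicator S x * ennreal (jac (f' x)))) borel f) A
        = emeasure (density lborel (indicator (f ` S))) A" .
  qed simp
  then have "integral\<^sup>N (distr (density lborel (\<lambda>x. indicator S x * ennreal (jac (f' x)))) borel f) g
      = integral\<^sup>N (density lborel (indicator (f ` S))) g"
    by simp
  then show ?thesis
    by (simp add: nn_integral_distr nn_integral_density mult.commute)
qed

section \<open>Local minorization by Lebesgue measure\<close>

text \<open>A quantitative inverse function theorem: the covered radius depends on \<delta> alone,
  so one ball will serve for all nearby starts and durations. Since \<open>f\<close> minus the
  identity is Lipschitz with constant 1/2, \<open>f\<close> is injective; the covering comes from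
  Brouwer's theorem.\<close>

lemma cball_subset_image_near_identity:
  fixes f :: "'a::euclidean_space \<Rightarrow> 'a"
  assumes der: "\<And>z. z \<in> ball 0 \<delta> \<Longrightarrow> (f has_derivative f' z) (at z)"
    and near: "\<And>z. z \<in> ball 0 \<delta> \<Longrightarrow> onorm (\<lambda>h. f' z h - h) \<le> 1 / 2" and "0 < \<delta>"
  shows "inj_on f (ball 0 \<delta>)" and "cball (f 0) (\<delta> / 4) \<subseteq> f ` ball 0 \<delta>"
proof -
  have lip: "norm ((f y - y) - (f z - z)) \<le> 1 / 2 * norm (y - z)" if "y \<in> ball 0 \<delta>" "z \<in> ball 0 \<delta>" for y z
  proof (rule differentiable_bound[of "ball 0 \<delta>" "\<lambda>y. f y - y" "\<lambda>z h. f' z h - h"])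
    show "((\<lambda>y. f y - y) has_derivative (\<lambda>h. f' z h - h)) (at z within ball 0 \<delta>)" if "z \<in> ball 0 \<delta>" for z
      using has_derivative_diff[OF der[OF that] has_derivative_ident] by (rule has_derivative_at_withinI)
  qed (use that near in auto)
  show "inj_on f (ball 0 \<delta>)"
  proof (rule inj_onI)
    fix y z assume "y \<in> ball 0 \<delta>" "z \<in> ball 0 \<delta>" "f y = f z"
    then have "norm (z - y) \<le> 1 / 2 * norm (y - z)" using lip[of y z] by simp
    then show "y = z" by (simp add: norm_minus_commute)
  qed
  show "cball (f 0) (\<delta> / 4) \<subseteq> f ` ball 0 \<delta>"
  proof
    fix x assume x: "x \<in> cball (f 0) (\<delta> / 4)"
    have sub: "cball 0 (\<delta> / 2) \<subseteq> ball (0::'a) \<delta>" using \<open>0 < \<delta>\<close> by auto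
    have "\<exists>y\<in>cball 0 (\<delta> / 2). f y = x"
    proof (rule brouwer_surjective_cball[where S = "cball (f 0) (\<delta> / 4)"])
      have "continuous_on (ball 0 \<delta>) f"
        using der by (intro continuous_at_imp_continuous_on ballI has_derivative_continuous)
      then show "continuous_on (cball 0 (\<delta> / 2)) f" using sub continuous_on_subset by blast
      \<comment> \<open>The distance from \<open>x\<close> to \<open>f 0\<close> and the variation
        of \<open>f y - y\<close> over the ball of radius \<delta> / 2 are each at most \<delta> /
        4.\<close>
      show "x + (y - f y) \<in> cball 0 (\<delta> / 2)" if "x \<in> cball (f 0) (\<delta> / 4)" "y \<in> cball 0 (\<delta> / 2)" for x y
      proof -
        have "norm ((f y - y) - (f 0 - 0)) \<le> 1 / 2 * norm (y - 0)"
          using that sub \<open>0 < \<delta>\<close> by (intro lip) auto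
        also have "\<dots> \<le> \<delta> / 4" using that by simp
        finally have 1: "norm (f y - y - f 0) \<le> \<delta> / 4" by simp
        have 2: "norm (x - f 0) \<le> \<delta> / 4" using that by (simp add: dist_norm norm_minus_commute)
        have "x + (y - f y) = (x - f 0) - (f y - y - f 0)" by simp
        then have "norm (x + (y - f y)) \<le> norm (x - f 0) + norm (f y - y - f 0)"
          by (metis norm_triangle_ineq4)
        then show ?thesis using 1 2 by simp
      qed
    qed (use x \<open>0 < \<delta>\<close> in auto)
    then show "x \<in> f ` ball 0 \<delta>" using sub by blast
  qed
qed

section \<open>The endpoint as a function of start and durations\<close>

context C1_flows begin

lemma measurable_phi [measurable (raw)]:
  assumes "f \<in> borel_measurable M" "g \<in> borel_measurable M"
  shows "(\<lambda>z. \<phi> i (f z) (g z)) \<in> borel_measurable M"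
  using borel_measurable_continuous_Pair[OF assms, of "\<phi> i"] continuous_phi[of i]
  by (simp add: case_prod_beta')

lemma tendsto_phi [tendsto_intros]:
  assumes "(f \<longlongrightarrow> a) F" "(g \<longlongrightarrow> b) F"
  shows "((\<lambda>z. \<phi> i (f z) (g z)) \<longlongrightarrow> \<phi> i a b) F"
  using continuous_on_tendsto_compose[OF continuous_phi[of i] tendsto_Pair[OF assms]] by simp

lemma tendsto_D [tendsto_intros]:
  assumes "(f \<longlongrightarrow> a) F" "(g \<longlongrightarrow> b) F"
  shows "((\<lambda>z. D i (f z) (g z)) \<longlongrightarrow> D i a b) F"
  using continuous_on_tendsto_compose[OF continuous_D\<phi>[of i] tendsto_Pair[OF assms]] by simp

lemma tendsto_v [tendsto_intros]:
  "(f \<longlongrightarrow> a) F \<Longrightarrow> ((\<lambda>z. v i (f z)) \<longlongrightarrow> v i a) F"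
  using continuous_on_tendsto_compose[OF continuous_v[of i]] by simp

text \<open>The partial derivative in the start is jointly continuous, which suffices for a total
  derivative.\<close>

lemma has_derivative_phi_pair:
  "((\<lambda>(t, x). \<phi> i t x) has_derivative (\<lambda>(s, u). s *\<^sub>R v i (\<phi> i t x) + D i t x u)) (at (t, x))"
proof -
  have "((\<lambda>(t, x). \<phi> i t x) has_derivative (\<lambda>(s, u). s *\<^sub>R v i (\<phi> i t x) + D i t x u)) (at (t, x) within UNIV \<times> UNIV)"
  proof (rule has_derivative_partialsI)
    show "((\<lambda>t. \<phi> i t x) has_derivative (\<lambda>s. s *\<^sub>R v i (\<phi> i t x))) (at t within UNIV)"
      using phi_deriv[of i x t] by (simp add: has_vector_derivative_def)
    show "continuous (at (t, x) within UNIV \<times> UNIV) (\<lambda>(t, x). D i t x)"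
      using continuous_D\<phi>[of i] by (simp add: continuous_on_eq_continuous_at)
  qed (auto intro: has_derivative_phi)
  then show ?thesis by simp
qed

text \<open>The position after the steps \<open>w\<close> (head last), and its derivative with respect to the durations;
  the duration of a step is indexed by the number of earlier steps.\<close>

fun pos :: "'n list \<Rightarrow> 'a \<Rightarrow> (nat \<Rightarrow> real) \<Rightarrow> 'a" where
  "pos [] x t = x"
| "pos (j # w) x t = \<phi> j (t (length w)) (pos w x t)"

fun dpos :: "'n list \<Rightarrow> 'a \<Rightarrow> (nat \<Rightarrow> real) \<Rightarrow> (nat \<Rightarrow> real) \<Rightarrow> 'a" where
  "dpos [] x t \<eta> = 0"
| "dpos (j # w) x t \<eta> = \<eta> (length w) *\<^sub>R v j (pos (j # w) x t) + D j (t (length w)) (pos w x t) (dpos w x t \<eta>)"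

lemma pos_cong: "(\<And>k. k < length w \<Longrightarrow> t k = t' k) \<Longrightarrow> pos w x t = pos w x t'"
  by (induction w) auto

lemma dpos_cong:
  "(\<And>k. k < length w \<Longrightarrow> t k = t' k) \<Longrightarrow> (\<And>k. k < length w \<Longrightarrow> \<eta> k = \<eta>' k) \<Longrightarrow> dpos w x t \<eta> = dpos w x t' \<eta>'"
proof (induction w)
  case (Cons j w)
  have "pos w x t = pos w x t'" using Cons.prems by (intro pos_cong) auto
  moreover have "dpos w x t \<eta> = dpos w x t' \<eta>'" using Cons by auto
  ultimately show ?case using Cons.prems by simp
qed simp

lemma dpos_add: "dpos w x t (\<lambda>k. a k + b k) = dpos w x t a + dpos w x t b"
  by (induction w) (auto simp: blinfun.add_right algebra_simps)

lemma dpos_scale: "dpos w x t (\<lambda>k. c * a k) = c *\<^sub>R dpos w x t a"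
  by (induction w) (auto simp: blinfun.scaleR_right algebra_simps)

lemma dpos_sum: "dpos w x t (\<lambda>k. \<Sum>i\<in>S. a i k) = (\<Sum>i\<in>S. dpos w x t (a i))"
proof (induction S rule: infinite_finite_induct)
  case (insert i S) then show ?case by (simp add: dpos_add)
qed (use dpos_scale[of w x t 0 "\<lambda>_. 0"] in simp_all)

lemma tendsto_pos:
  "(X \<longlongrightarrow> x) F \<Longrightarrow> (\<And>k. k < length w \<Longrightarrow> ((\<lambda>n. T n k) \<longlongrightarrow> t k) F) \<Longrightarrow> ((\<lambda>n. pos w (X n) (T n)) \<longlongrightarrow> pos w x t) F"
  by (induction w) (auto intro!: tendsto_intros)

lemma tendsto_dpos:
  "(X \<longlongrightarrow> x) F \<Longrightarrow> (\<And>k. k < length w \<Longrightarrow> ((\<lambda>n. T n k) \<longlongrightarrow> t k) F) \<Longrightarrow>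
   ((\<lambda>n. dpos w (X n) (T n) \<eta>) \<longlongrightarrow> dpos w x t \<eta>) F"
proof (induction w)
  case (Cons j w)
  have "((\<lambda>n. pos w (X n) (T n)) \<longlongrightarrow> pos w x t) F" using Cons.prems by (intro tendsto_pos) auto
  moreover have "((\<lambda>n. pos (j # w) (X n) (T n)) \<longlongrightarrow> pos (j # w) x t) F" by (rule tendsto_pos[OF Cons.prems])
  ultimately show ?case
    using Cons unfolding dpos.simps by (intro tendsto_intros) auto
qed simp

text \<open>Continuity in start and durations is available as coordinatewise convergence.
  Counterexamples at the radii 1 / (n + 1) turn it into one radius valid for all nearby starts and
  durations; only the first \<open>m\<close> durations are constrained.\<close>

lemma ex_radius:
  fixes x0 :: 'a
  assumes "\<And>X T. X \<longlonglongrightarrow> x0 \<Longrightarrow> (\<And>k. k < m \<Longrightarrow> (\<lambda>n. T n k) \<longlonglongrightarrow> t0 k) \<Longrightarrow> \<forall>\<^sub>F n in sequentially. R (X n) (T n)"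
  shows "\<exists>r>0. \<forall>x t. norm (x - x0) \<le> r \<longrightarrow> (\<forall>k<m. \<bar>t k - t0 k\<bar> \<le> r) \<longrightarrow> R x (t :: nat \<Rightarrow> real)"
proof (rule ccontr)
  let ?r = "\<lambda>n. inverse (real (Suc n))"
  assume neg: "\<not> ?thesis"
  have "\<exists>x t. norm (x - x0) \<le> ?r n \<and> (\<forall>k<m. \<bar>t k - t0 k\<bar> \<le> ?r n) \<and> \<not> R x t" for n
  proof (rule ccontr)
    assume "\<not> (\<exists>x t. norm (x - x0) \<le> ?r n \<and> (\<forall>k<m. \<bar>t k - t0 k\<bar> \<le> ?r n) \<and> \<not> R x t)"
    then have "?r n > 0 \<and> (\<forall>x t. norm (x - x0) \<le> ?r n \<longrightarrow> (\<forall>k<m. \<bar>t k - t0 k\<bar> \<le> ?r n) \<longrightarrow> R x t)" by auto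
    then show False using neg by blast
  qed
  then have "\<exists>X. \<forall>n. \<exists>t. norm (X n - x0) \<le> ?r n \<and> (\<forall>k<m. \<bar>t k - t0 k\<bar> \<le> ?r n) \<and> \<not> R (X n) t"
    by (intro choice allI)
  then obtain X where "\<forall>n. \<exists>t. norm (X n - x0) \<le> ?r n \<and> (\<forall>k<m. \<bar>t k - t0 k\<bar> \<le> ?r n) \<and> \<not> R (X n) t" ..
  then have "\<exists>T. \<forall>n. norm (X n - x0) \<le> ?r n \<and> (\<forall>k<m. \<bar>T n k - t0 k\<bar> \<le> ?r n) \<and> \<not> R (X n) (T n)"
    by (rule choice)
  then obtain T where XT: "\<And>n. norm (X n - x0) \<le> ?r n" "\<And>n k. k < m \<Longrightarrow> \<bar>T n k - t0 k\<bar> \<le> ?r n" "\<And>n. \<not> R (X n) (T n)"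
    by blast
  have "X \<longlonglongrightarrow> x0"
    by (subst Lim_null, rule Lim_null_comparison[OF always_eventually LIMSEQ_inverse_real_of_nat]) (use XT in auto)
  moreover have "(\<lambda>n. T n k) \<longlonglongrightarrow> t0 k" if "k < m" for k
    by (subst Lim_null, rule Lim_null_comparison[OF always_eventually LIMSEQ_inverse_real_of_nat]) (use XT(2)[OF that] in auto)
  ultimately have "\<forall>\<^sub>F n in sequentially. R (X n) (T n)" by (rule assms)
  then show False using XT(3) by (simp add: eventually_sequentially)
qed

text \<open>Separates the word of indices from the durations, so that these can vary while the word
  stays fixed. The new step has the index \<open>length p\<close>, which the earlier steps do not
  read.\<close>

lemma ex_durations_reach:
  assumes "\<forall>(i, t)\<in>set p. 0 \<le> t"
  shows "\<exists>t. (\<forall>k. 0 \<le> t k) \<and> pos (map fst p) x t = endpoint x p \<and>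
    (\<forall>u\<in>reach x p. \<exists>\<eta>. dpos (map fst p) x t \<eta> = u)"
  using assms
proof (induction p)
  case (Cons it p)
  obtain j s where it: "it = (j, s)" by force
  obtain t where t: "\<forall>k. 0 \<le> t k" "pos (map fst p) x t = endpoint x p"
    "\<forall>u\<in>reach x p. \<exists>\<eta>. dpos (map fst p) x t \<eta> = u"
    using Cons by auto
  let ?w = "map fst p" and ?t = "t(length p := s)"
  have pos_t: "pos ?w x ?t = endpoint x p" using t(2) pos_cong[of ?w ?t t x] by simp
  have "\<exists>\<eta>. dpos (map fst (it # p)) x ?t \<eta> = u" if u': "u \<in> reach x (it # p)" for u
  proof -
    obtain z c where z: "z \<in> reach x p" and u: "u = D j s (endpoint x p) z + c *\<^sub>R v j (\<phi> j s (endpoint x p))"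
      using u' by (auto simp: it)
    obtain \<eta> where \<eta>: "dpos ?w x t \<eta> = z" using t(3) z by blast
    have "dpos ?w x ?t (\<eta>(length p := c)) = z" using \<eta> dpos_cong[of ?w ?t t "\<eta>(length p := c)" \<eta> x] by simp
    then have "dpos (map fst (it # p)) x ?t (\<eta>(length p := c)) = u"
      by (simp add: it u pos_t)
    then show ?thesis by blast
  qed
  moreover have "\<forall>k. 0 \<le> ?t k" using t(1) Cons.prems by (auto simp: it)
  moreover have "pos (map fst (it # p)) x ?t = endpoint x (it # p)" by (simp add: it pos_t)
  ultimately show ?case by blast
qed auto

text \<open>A linear right inverse of a surjective derivative, written in coordinates: each
  coordinate is the inner product with a vector \<open>b k\<close>. Along the durations
  \<open>b k \<bullet> \<sigma>\<close> there are as many parameters as dimensions, and the endpoint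
  has the identity as derivative.\<close>

lemma dpos_right_inverse:
  assumes "\<And>u. \<exists>\<eta>. dpos w x t \<eta> = u"
  shows "\<exists>b. \<forall>\<sigma>. dpos w x t (\<lambda>k. b k \<bullet> \<sigma>) = (\<sigma> :: 'a)"
proof -
  have "\<exists>\<eta>. \<forall>u. dpos w x t (\<eta> u) = u" using assms by (intro choice allI)
  then obtain \<eta> where \<eta>: "\<And>u. dpos w x t (\<eta> u) = u" by blast
  define b where "b k = (\<Sum>e\<in>Basis. \<eta> e k *\<^sub>R e)" for k
  have "dpos w x t (\<lambda>k. b k \<bullet> \<sigma>) = \<sigma>" for \<sigma>
  proof -
    have "(\<lambda>k. b k \<bullet> \<sigma>) = (\<lambda>k. \<Sum>e\<in>Basis. (\<sigma> \<bullet> e) * \<eta> e k)"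
      by (simp add: b_def inner_sum_left inner_sum_right fun_eq_iff inner_commute[of _ \<sigma>] mult.commute)
    then have "dpos w x t (\<lambda>k. b k \<bullet> \<sigma>) = (\<Sum>e\<in>Basis. (\<sigma> \<bullet> e) *\<^sub>R e)"
      by (simp only: dpos_sum dpos_scale \<eta>)
    then show ?thesis by (simp add: euclidean_representation)
  qed
  then show ?thesis by blast
qed

lemma linear_dpos_inner: "linear (\<lambda>\<sigma>. dpos w x t (\<lambda>k. b k \<bullet> (\<sigma> :: 'a)))"
  by (rule linearI) (simp_all add: inner_add_right dpos_add dpos_scale)

lemma eventually_dpos_near_identity:
  assumes "\<forall>\<sigma>. dpos w x t (\<lambda>k. b k \<bullet> \<sigma>) = (\<sigma> :: 'a)" and "0 < \<epsilon>"
    and "X \<longlonglongrightarrow> x" "\<And>k. k < length w \<Longrightarrow> (\<lambda>n. T n k) \<longlonglongrightarrow> t k"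
  shows "\<forall>\<^sub>F n in sequentially. \<forall>e\<in>Basis. norm (dpos w (X n) (T n) (\<lambda>k. b k \<bullet> e) - e) < \<epsilon>"
proof (rule eventually_ball_finite, simp, rule ballI)
  fix e :: 'a
  have "(\<lambda>n. dpos w (X n) (T n) (\<lambda>k. b k \<bullet> e)) \<longlonglongrightarrow> dpos w x t (\<lambda>k. b k \<bullet> e)"
    using assms(3,4) by (rule tendsto_dpos)
  then have "(\<lambda>n. norm (dpos w (X n) (T n) (\<lambda>k. b k \<bullet> e) - e)) \<longlonglongrightarrow> norm (dpos w x t (\<lambda>k. b k \<bullet> e) - e)"
    by (intro tendsto_intros)
  then show "\<forall>\<^sub>F n in sequentially. norm (dpos w (X n) (T n) (\<lambda>k. b k \<bullet> e) - e) < \<epsilon>"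
    by (rule order_tendstoD) (simp add: assms(1) assms(2))
qed

text \<open>Full rank survives small changes of the durations, so they can be made strictly
  positive. This leaves room to vary them in both directions within nonnegative times. The right
  inverse is chosen anew at the shifted durations.\<close>

lemma ex_positive_full_rank:
  assumes smooth: "\<And>i. smooth (v i)" and wH: "weak_Hormander v x"
  shows "\<exists>w t b. w \<noteq> [] \<and> (\<forall>k. 0 < t k) \<and> (\<forall>\<sigma>. dpos w x t (\<lambda>k. b k \<bullet> \<sigma>) = (\<sigma> :: 'a))"
proof -
  obtain p where p: "\<forall>(i, t)\<in>set p. 0 \<le> t" "reach x p = UNIV"
    using ex_full_reach[OF smooth wH] by blast
  define w where "w = map fst p"
  have "p \<noteq> []"
  proof
    assume "p = []"
    then have "(UNIV :: 'a set) = {0}" using p by simp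
    moreover obtain e :: 'a where "e \<in> Basis" by fastforce
    ultimately show False using nonzero_Basis[of e] by blast
  qed
  obtain t0 where t0: "\<forall>k. 0 \<le> t0 k" "\<And>u. \<exists>\<eta>. dpos w x t0 \<eta> = u"
    using ex_durations_reach[OF p(1), of x] p(2) unfolding w_def by auto
  obtain b where b: "\<forall>\<sigma>. dpos w x t0 (\<lambda>k. b k \<bullet> \<sigma>) = \<sigma>"
    using dpos_right_inverse[OF t0(2)] by blast
  have "\<exists>r>0. \<forall>y t. norm (y - x) \<le> r \<longrightarrow> (\<forall>k<length w. \<bar>t k - t0 k\<bar> \<le> r) \<longrightarrow>
      (\<forall>e\<in>Basis. norm (dpos w y t (\<lambda>k. b k \<bullet> e) - e) < (1 / 2) / DIM('a))"
    by (rule ex_radius) (rule eventually_dpos_near_identity[OF b], auto)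
  then obtain r where r: "r > 0" "\<And>y t. norm (y - x) \<le> r \<Longrightarrow> (\<And>k. k < length w \<Longrightarrow> \<bar>t k - t0 k\<bar> \<le> r) \<Longrightarrow>
      (\<forall>e\<in>Basis. norm (dpos w y t (\<lambda>k. b k \<bullet> e) - e) < (1 / 2) / DIM('a))"
    by blast
  define t where "t k = t0 k + r" for k
  have "surj (\<lambda>\<sigma>. dpos w x t (\<lambda>k. b k \<bullet> \<sigma>))"
    using r(2)[of x t] r(1) by (intro surj_near_identity linear_dpos_inner) (auto simp: t_def intro: less_imp_le)
  then have "\<exists>\<eta>. dpos w x t \<eta> = u" for u by (metis surjD)
  from dpos_right_inverse[OF this] obtain b' where "\<forall>\<sigma>. dpos w x t (\<lambda>k. b' k \<bullet> \<sigma>) = \<sigma>" by blast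
  moreover have "\<forall>k. 0 < t k" using t0(1) r(1) by (simp add: t_def add_nonneg_pos)
  moreover have "w \<noteq> []" using \<open>p \<noteq> []\<close> by (simp add: w_def)
  ultimately show ?thesis by blast
qed

lemma has_derivative_pos:
  "((\<lambda>\<sigma>. pos w x (\<lambda>k. \<theta> k + b k \<bullet> \<sigma>)) has_derivative
    (\<lambda>h. dpos w x (\<lambda>k. \<theta> k + b k \<bullet> \<sigma>) (\<lambda>k. b k \<bullet> h))) (at (\<sigma> :: 'a))"
proof (induction w)
  case (Cons j w)
  let ?t = "\<lambda>\<sigma>. \<theta> (length w) + b (length w) \<bullet> \<sigma>" and ?y = "\<lambda>\<sigma>. pos w x (\<lambda>k. \<theta> k + b k \<bullet> \<sigma>)"
  have "((\<lambda>\<sigma>. (?t \<sigma>, ?y \<sigma>)) has_derivative (\<lambda>h. (b (length w) \<bullet> h, dpos w x (\<lambda>k. \<theta> k + b k \<bullet> \<sigma>) (\<lambda>k. b k \<bullet> h)))) (at \<sigma>)"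
    by (intro has_derivative_Pair Cons.IH) (auto intro!: derivative_eq_intros)
  from diff_chain_at[OF this has_derivative_phi_pair[of j "?t \<sigma>" "?y \<sigma>"]]
  show ?case by (simp add: o_def)
qed simp

definition Dpos :: "'n list \<Rightarrow> 'a \<Rightarrow> (nat \<Rightarrow> real) \<Rightarrow> (nat \<Rightarrow> 'a) \<Rightarrow> 'a \<Rightarrow>\<^sub>L 'a" where
  "Dpos w x t b = Blinfun (\<lambda>\<sigma>. dpos w x t (\<lambda>k. b k \<bullet> \<sigma>))"

lemma Dpos_apply: "blinfun_apply (Dpos w x t b) \<sigma> = dpos w x t (\<lambda>k. b k \<bullet> \<sigma>)"
  unfolding Dpos_def
  by (subst bounded_linear_Blinfun_apply) (use linear_dpos_inner in \<open>simp_all add: linear_conv_bounded_linear\<close>)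

lemma continuous_Dpos: "continuous_on UNIV (\<lambda>\<sigma> :: 'a. Dpos w x (\<lambda>k. \<theta> k + b k \<bullet> \<sigma>) b)"
proof (rule continuous_on_blinfun_componentwise)
  show "continuous_on UNIV (\<lambda>\<sigma>. blinfun_apply (Dpos w x (\<lambda>k. \<theta> k + b k \<bullet> \<sigma>) b) e)" for e
    unfolding Dpos_apply continuous_on_def
    by (intro ballI tendsto_dpos tendsto_intros)
qed

lemma measurable_pos:
  "g \<in> borel_measurable M \<Longrightarrow> (\<And>k. k < length w \<Longrightarrow> (\<lambda>z. f z k) \<in> borel_measurable M) \<Longrightarrow>
   (\<lambda>z. pos w (g z) (f z)) \<in> borel_measurable M"
  by (induction w) (auto intro!: measurable_phi)

end

section \<open>The kernel K and lower bounds for its powers\<close>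

lemma exponential_density_ge:
  assumes "0 < l" "0 \<le> t" "t \<le> Tm"
  shows "l * exp (- (l * Tm)) \<le> exponential_density l t"
  using assms by (auto simp: exponential_density_def mult.commute[of t] intro!: mult_left_mono)

locale switching = C1_flows v v' \<phi> B
  for v :: "'n::finite \<Rightarrow> real^'d \<Rightarrow> real^'d" and v' and \<phi> and B +
  fixes \<Lambda> :: real and P :: "'n \<Rightarrow> 'n \<Rightarrow> real"
  assumes Lambda_pos: "0 < \<Lambda>" and P_pos: "0 < P i j" and P_sum: "(\<Sum>j\<in>UNIV. P i j) = 1"
begin

text \<open>\<Lambda> times the resolvent of the flow of \<open>v j\<close>. Values in
  \<open>ennreal\<close> free the later interchanges of integrals from integrability
  conditions.\<close>

definition T :: "'n \<Rightarrow> (real^'d \<Rightarrow> ennreal) \<Rightarrow> real^'d \<Rightarrow> ennreal" where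
  "T j h x = (\<integral>\<^sup>+t. ennreal (exponential_density \<Lambda> t) * h (\<phi> j t x) \<partial>lborel)"

definition K :: "('n \<Rightarrow> real^'d \<Rightarrow> ennreal) \<Rightarrow> 'n \<Rightarrow> real^'d \<Rightarrow> ennreal" where
  "K h i x = (\<Sum>j\<in>UNIV. ennreal (P i j) * T j (h j) x)"

lemma measurable_T [measurable (raw)]:
  assumes "h \<in> borel_measurable borel"
  shows "T j h \<in> borel_measurable borel"
proof -
  note assms[measurable]
  have "(\<lambda>x. \<integral>\<^sup>+t. ennreal (exponential_density \<Lambda> t) * h (\<phi> j t x) \<partial>lborel) \<in> borel_measurable borel"
    by measurable
  then show ?thesis by (simp add: T_def[abs_def])
qed

lemma measurable_K:
  assumes "\<And>j. h j \<in> borel_measurable borel"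
  shows "K h i \<in> borel_measurable borel"
  unfolding K_def[abs_def] using assms by measurable

lemma measurable_K_pow:
  "(\<And>j. h j \<in> borel_measurable borel) \<Longrightarrow> (K ^^ m) h i \<in> borel_measurable borel"
  by (induction m arbitrary: i) (auto intro: measurable_K)

lemma T_mono: "(\<And>x. h x \<le> h' x) \<Longrightarrow> T j h x \<le> T j h' x"
  unfolding T_def by (intro nn_integral_mono mult_left_mono) auto

lemma T_cmult: "h \<in> borel_measurable borel \<Longrightarrow> T j (\<lambda>x. c * h x) x = c * T j h x"
  unfolding T_def by (subst nn_integral_cmult[symmetric]) (auto simp: ac_simps)

lemma T_1: "T j (\<lambda>_. 1) x = 1"
proof -
  have "emeasure (density lborel (exponential_density \<Lambda>)) UNIV = 1"
    using prob_space.emeasure_space_1[OF prob_space_exponential_density[OF Lambda_pos]] by simp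
  then show ?thesis by (simp add: T_def emeasure_density)
qed

lemma K_1: "K (\<lambda>_ _. 1) = (\<lambda>_ _. 1)"
  using P_sum P_pos by (simp add: K_def fun_eq_iff T_1 sum_ennreal less_imp_le)

lemma K_pow_1: "(K ^^ m) (\<lambda>_ _. 1) = (\<lambda>_ _. 1)"
  by (induction m) (simp_all add: K_1)

text \<open>The head of the word is the last step in time, so its operator meets the function
  first.\<close>

fun word_op :: "'n list \<Rightarrow> (real^'d \<Rightarrow> ennreal) \<Rightarrow> real^'d \<Rightarrow> ennreal" where
  "word_op [] h = h"
| "word_op (j # w) h = word_op w (T j h)"

definition pmin :: real where "pmin = Min (range (\<lambda>(i, j). P i j))"

lemma pmin_pos: "0 < pmin" and pmin_le: "pmin \<le> P i j"
proof -
  show "0 < pmin" unfolding pmin_def using P_pos by (subst Min_gr_iff) auto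
  show "pmin \<le> P i j" unfolding pmin_def by (intro Min_le) force+
qed

lemma K_ge_T: "ennreal pmin * T j (h j) x \<le> K h i x"
proof -
  have "ennreal pmin * T j (h j) x \<le> ennreal (P i j) * T j (h j) x"
    using pmin_le by (intro mult_right_mono ennreal_leI) auto
  also have "\<dots> \<le> K h i x"
    unfolding K_def by (rule member_le_sum) auto
  finally show ?thesis .
qed

text \<open>The bound on \<open>g\<close> is uniform in the index, so every step may choose its
  index at the price of a factor \<open>pmin\<close> and the bound remains uniform.\<close>

lemma K_pow_ge_word_op:
  assumes "\<And>i x. ennreal c * h' x \<le> g i x" "0 \<le> c" "h' \<in> borel_measurable borel"
  shows "ennreal (c * pmin ^ length w) * word_op w h' x \<le> (K ^^ length w) g i x"
  using assms
proof (induction w arbitrary: c g h')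
  case (Cons j w)
  have "ennreal (c * pmin) * T j h' x \<le> K g i x" for i x
  proof -
    have "ennreal (c * pmin) * T j h' x = ennreal pmin * T j (\<lambda>x. ennreal c * h' x) x"
      using Cons.prems pmin_pos by (simp add: T_cmult ennreal_mult less_imp_le mult_ac)
    also have "\<dots> \<le> ennreal pmin * T j (g j) x"
      using Cons.prems(1) by (intro mult_left_mono T_mono) auto
    also have "\<dots> \<le> K g i x" by (rule K_ge_T)
    finally show ?thesis .
  qed
  from Cons.IH[of "c * pmin" "T j h'" "K g", OF this]
  have "ennreal (c * pmin * pmin ^ length w) * word_op w (T j h') x \<le> (K ^^ length w) (K g) i x"
    using Cons.prems pmin_pos by (simp add: measurable_T)
  then show ?case by (simp add: funpow_swap1 mult_ac)
qed auto

text \<open>The last step in time sees the component \<open>h j\<close> alone; once it is taken, the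
  bound is uniform in the index, as \<open>K_pow_ge_word_op\<close> demands.\<close>

lemma K_pow_ge:
  assumes "\<And>j. h j \<in> borel_measurable borel"
  shows "ennreal (pmin ^ Suc (length w)) * word_op (j # w) (h j) x \<le> (K ^^ Suc (length w)) h i x"
proof -
  have "ennreal (pmin * pmin ^ length w) * word_op w (T j (h j)) x \<le> (K ^^ length w) (K h) i x"
    by (rule K_pow_ge_word_op) (use K_ge_T pmin_pos assms in \<open>auto intro: measurable_T\<close>)
  then show ?thesis by (simp add: funpow_swap1)
qed

abbreviation Leb :: "nat \<Rightarrow> (nat \<Rightarrow> real) measure" where
  "Leb m \<equiv> Pi\<^sub>M {..<m} (\<lambda>_. lborel)"

sublocale Leb: product_sigma_finite "\<lambda>_ :: nat. lborel :: real measure" ..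

definition box_ind :: "nat \<Rightarrow> (nat \<Rightarrow> real) \<Rightarrow> (nat \<Rightarrow> real) \<Rightarrow> (nat \<Rightarrow> real) \<Rightarrow> ennreal" where
  "box_ind m l u \<theta> = (\<Prod>k<m. indicator {l k..u k} (\<theta> k))"

lemma measurable_box_ind: "box_ind m l u \<in> borel_measurable (Leb m)"
  unfolding box_ind_def[abs_def] by measurable

lemma measurable_Leb_component: "k < m \<Longrightarrow> (\<lambda>\<theta>. \<theta> k) \<in> borel_measurable (Leb m)"
  using measurable_component_singleton[of k "{..<m}" "\<lambda>_. lborel :: real measure"] by simp

lemma T_ge_interval:
  assumes [measurable]: "h \<in> borel_measurable borel"
    and "\<And>\<tau>. l \<le> \<tau> \<Longrightarrow> \<tau> \<le> u \<Longrightarrow> 0 \<le> \<tau> + s \<and> \<tau> + s \<le> Tm"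
  shows "ennreal (\<Lambda> * exp (- (\<Lambda> * Tm))) * (\<integral>\<^sup>+\<tau>. indicator {l..u} \<tau> * h (\<phi> j (\<tau> + s) x) \<partial>lborel) \<le> T j h x"
proof -
  have "T j h x = (\<integral>\<^sup>+\<tau>. ennreal (exponential_density \<Lambda> (s + 1 * \<tau>)) * h (\<phi> j (s + 1 * \<tau>) x) \<partial>lborel)"
    unfolding T_def by (subst nn_integral_real_affine[where c = 1 and t = s]) auto
  also have "\<dots> \<ge> (\<integral>\<^sup>+\<tau>. ennreal (\<Lambda> * exp (- (\<Lambda> * Tm))) * (indicator {l..u} \<tau> * h (\<phi> j (\<tau> + s) x)) \<partial>lborel)"
    using assms(2) Lambda_pos
    by (intro nn_integral_mono)
      (auto simp: indicator_def add.commute intro!: mult_right_mono ennreal_leI exponential_density_ge)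
  also have "(\<integral>\<^sup>+\<tau>. ennreal (\<Lambda> * exp (- (\<Lambda> * Tm))) * (indicator {l..u} \<tau> * h (\<phi> j (\<tau> + s) x)) \<partial>lborel)
     = ennreal (\<Lambda> * exp (- (\<Lambda> * Tm))) * (\<integral>\<^sup>+\<tau>. indicator {l..u} \<tau> * h (\<phi> j (\<tau> + s) x) \<partial>lborel)"
    by (rule nn_integral_cmult) measurable
  finally show ?thesis .
qed

text \<open>The exponential density is bounded below on the times in question, so integration over a
  box of durations is dominated with a constant that does not depend on the shift; later
  \<open>s k\<close> is \<open>b k \<bullet> \<sigma>\<close>. The last step has the largest
  duration index and is split off by Fubini's theorem.\<close>

lemma word_op_ge_box:
  assumes "h \<in> borel_measurable borel"
    and "\<And>k \<tau>. k < length w \<Longrightarrow> l k \<le> \<tau> \<Longrightarrow> \<tau> \<le> u k \<Longrightarrow> 0 \<le> \<tau> + s k \<and> \<tau> + s k \<le> Tm"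
  shows "ennreal ((\<Lambda> * exp (- (\<Lambda> * Tm))) ^ length w) *
     (\<integral>\<^sup>+\<theta>. box_ind (length w) l u \<theta> * h (pos w x (\<lambda>k. \<theta> k + s k)) \<partial>Leb (length w)) \<le> word_op w h x"
  using assms
proof (induction w arbitrary: h)
  case Nil
  then show ?case by (simp add: box_ind_def Leb.nn_integral_empty space_PiM_empty)
next
  case (Cons j w)
  let ?m = "length w" and ?c = "\<Lambda> * exp (- (\<Lambda> * Tm))"
  note [measurable] = Cons.prems(1) measurable_box_ind
  have inner: "(\<lambda>\<tau>. indicator {a..b} \<tau> * h (\<phi> j (\<tau> + c) y)) \<in> borel_measurable lborel" for a b c y
    by measurable
  let ?F = "\<lambda>\<theta>. box_ind (Suc ?m) l u \<theta> * h (pos (j # w) x (\<lambda>k. \<theta> k + s k))"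
  let ?y = "\<lambda>\<theta>. pos w x (\<lambda>k. \<theta> k + s k)"
  have pos_m: "(\<lambda>\<theta>. pos w x (\<lambda>k. \<theta> k + s k)) \<in> borel_measurable (Leb n)" if "?m \<le> n" for n
    using that by (intro measurable_pos borel_measurable_add measurable_Leb_component) auto
  have "(\<lambda>\<theta>. pos (j # w) x (\<lambda>k. \<theta> k + s k)) \<in> borel_measurable (Leb (Suc ?m))"
    by (intro measurable_pos borel_measurable_add measurable_Leb_component) auto
  then have F: "?F \<in> borel_measurable (Leb (Suc ?m))" by measurable
  have upd: "?F (\<theta>(?m := \<tau>)) = box_ind ?m l u \<theta> * (indicator {l ?m..u ?m} \<tau> * h (\<phi> j (\<tau> + s ?m) (?y \<theta>)))" for \<theta> \<tau>
  proof -
    have "pos w x (\<lambda>k. (\<theta>(?m := \<tau>)) k + s k) = ?y \<theta>" by (rule pos_cong) auto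
    moreover have "box_ind (Suc ?m) l u (\<theta>(?m := \<tau>)) = box_ind ?m l u \<theta> * indicator {l ?m..u ?m} \<tau>"
      by (simp add: box_ind_def)
    ultimately show ?thesis by (simp add: mult.assoc)
  qed
  have "integral\<^sup>N (Leb (Suc ?m)) ?F = (\<integral>\<^sup>+\<theta>. (\<integral>\<^sup>+\<tau>. ?F (\<theta>(?m := \<tau>)) \<partial>lborel) \<partial>Leb ?m)"
    using Leb.product_nn_integral_insert[of "{..<?m}" ?m ?F] F by (simp add: lessThan_Suc)
  also have "\<dots> = (\<integral>\<^sup>+\<theta>. box_ind ?m l u \<theta> *
      (\<integral>\<^sup>+\<tau>. indicator {l ?m..u ?m} \<tau> * h (\<phi> j (\<tau> + s ?m) (?y \<theta>)) \<partial>lborel) \<partial>Leb ?m)"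
    unfolding upd by (intro nn_integral_cong nn_integral_cmult inner)
  finally have eq: "integral\<^sup>N (Leb (Suc ?m)) ?F = \<dots>" .
  let ?G = "\<lambda>\<theta>. \<integral>\<^sup>+\<tau>. indicator {l ?m..u ?m} \<tau> * h (\<phi> j (\<tau> + s ?m) (?y \<theta>)) \<partial>lborel"
  have G: "?G \<in> borel_measurable (Leb ?m)"
  proof -
    have [measurable]: "?y \<in> borel_measurable (Leb ?m)" by (rule pos_m) simp
    show ?thesis by measurable
  qed
  have "ennreal ?c * (\<integral>\<^sup>+\<theta>. box_ind ?m l u \<theta> * ?G \<theta> \<partial>Leb ?m) = (\<integral>\<^sup>+\<theta>. ennreal ?c * (box_ind ?m l u \<theta> * ?G \<theta>) \<partial>Leb ?m)"
    using G by (intro nn_integral_cmult[symmetric] borel_measurable_times_ennreal measurable_box_ind)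
  also have "\<dots> \<le> (\<integral>\<^sup>+\<theta>. box_ind ?m l u \<theta> * T j h (?y \<theta>) \<partial>Leb ?m)"
  proof (intro nn_integral_mono)
    fix \<theta>
    have "ennreal ?c * ?G \<theta> \<le> T j h (?y \<theta>)"
      using Cons.prems(2)[of ?m] by (intro T_ge_interval Cons.prems(1)) auto
    then have "box_ind ?m l u \<theta> * (ennreal ?c * ?G \<theta>) \<le> box_ind ?m l u \<theta> * T j h (?y \<theta>)"
      by (rule mult_left_mono) simp
    then show "ennreal ?c * (box_ind ?m l u \<theta> * ?G \<theta>) \<le> box_ind ?m l u \<theta> * T j h (?y \<theta>)"
      by (simp only: mult.left_commute)
  qed
  finally have le: "ennreal ?c * (\<integral>\<^sup>+\<theta>. box_ind ?m l u \<theta> * ?G \<theta> \<partial>Leb ?m)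
      \<le> (\<integral>\<^sup>+\<theta>. box_ind ?m l u \<theta> * T j h (?y \<theta>) \<partial>Leb ?m)" .
  have "ennreal (?c ^ Suc ?m) * integral\<^sup>N (Leb (Suc ?m)) ?F
      = ennreal (?c ^ ?m) * (ennreal ?c * (\<integral>\<^sup>+\<theta>. box_ind ?m l u \<theta> * ?G \<theta> \<partial>Leb ?m))"
    unfolding eq using Lambda_pos by (simp add: ennreal_mult mult_ac)
  also have "\<dots> \<le> ennreal (?c ^ ?m) * (\<integral>\<^sup>+\<theta>. box_ind ?m l u \<theta> * T j h (?y \<theta>) \<partial>Leb ?m)"
    by (rule mult_left_mono[OF le]) simp
  also have "\<dots> \<le> word_op w (T j h) x"
    by (rule Cons.IH) (use Cons.prems in \<open>auto intro: measurable_T\<close>)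
  finally show ?case by simp
qed

lemma nn_integral_box_ind:
  "(\<integral>\<^sup>+\<theta>. box_ind m l u \<theta> \<partial>Leb m) = (\<Prod>k<m. ennreal (u k - l k))" if "\<And>k. l k \<le> u k"
  unfolding box_ind_def using that by (subst Leb.product_nn_integral_prod) auto

end

section \<open>Powers of K dominate Lebesgue measure on an open set\<close>

context switching begin

text \<open>Linear maps within 1/2 of the identity form a compact ball, on which the continuous
  Jacobian is bounded.\<close>

lemma ex_jac_bound: "\<exists>J>0. \<forall>A :: (real^'d) \<Rightarrow>\<^sub>L (real^'d). (\<forall>z. norm (blinfun_apply A z - z) \<le> 1 / 2 * norm z) \<longrightarrow> jac A \<le> J"
proof -
  have "compact (jac ` cball (id_blinfun :: (real^'d) \<Rightarrow>\<^sub>L (real^'d)) (1 / 2))"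
    by (intro compact_continuous_image continuous_on_subset[OF continuous_jac]) auto
  then obtain J where J: "\<And>A :: (real^'d) \<Rightarrow>\<^sub>L (real^'d). A \<in> cball id_blinfun (1 / 2) \<Longrightarrow> norm (jac A) \<le> J"
    by (meson compact_imp_bounded bounded_iff image_eqI)
  have "jac A \<le> max J 1" if "\<forall>z. norm (blinfun_apply A z - z) \<le> 1 / 2 * norm z" for A :: "(real^'d) \<Rightarrow>\<^sub>L (real^'d)"
  proof -
    have "norm (A - id_blinfun) \<le> 1 / 2"
      using that by (intro norm_blinfun_bound) (auto simp: blinfun.diff_left)
    then have "A \<in> cball id_blinfun (1 / 2)" by (simp add: dist_norm norm_minus_commute)
    from J[OF this] show ?thesis by auto
  qed
  then show ?thesis by (intro exI[of _ "max J 1"]) auto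
qed

text \<open>Instead of completing the endpoint map to a diffeomorphism of all durations, the bound
  \<open>word_op_ge_box\<close> is averaged over the shifts \<open>b k \<bullet> \<sigma>\<close>
  with \<sigma> in a small ball. For fixed base durations the endpoint is injective in \<sigma>, has
  derivative close to the identity and covers \<open>V\<close>. Exchanging the integrals and
  changing variables, with a bounded Jacobian, leaves Lebesgue measure on \<open>V\<close>.\<close>

lemma doeblin:
  assumes smooth: "\<And>i. smooth (v i)" and wH: "weak_Hormander v x0"
  shows "\<exists>m \<rho> V c j. 0 < \<rho> \<and> open V \<and> V \<noteq> {} \<and> 0 < c \<and>
    (\<forall>h x i. (\<forall>j. h j \<in> borel_measurable borel) \<longrightarrow> norm (x - x0) < \<rho> \<longrightarrow>
      ennreal c * (\<integral>\<^sup>+y. h j y * indicator V y \<partial>lborel) \<le> (K ^^ m) h i x)"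
proof -
  obtain w t0 b where w: "w \<noteq> []" and t0: "\<And>k. 0 < t0 k"
    and b: "\<forall>\<sigma>. dpos w x0 t0 (\<lambda>k. b k \<bullet> \<sigma>) = (\<sigma> :: real^'d)"
    using ex_positive_full_rank[OF smooth wH] by blast
  obtain j w' where jw: "w = j # w'" using w by (cases w) auto
  define m where "m = length w"
  obtain J where J: "J > 0" "\<And>A :: (real^'d) \<Rightarrow>\<^sub>L (real^'d). (\<And>z. norm (blinfun_apply A z - z) \<le> 1 / 2 * norm z) \<Longrightarrow> jac A \<le> J"
    using ex_jac_bound by blast
  have "\<exists>r>0. \<forall>x t. norm (x - x0) \<le> r \<longrightarrow> (\<forall>k<m. \<bar>t k - t0 k\<bar> \<le> r) \<longrightarrow>
      (\<forall>e\<in>Basis. norm (dpos w x t (\<lambda>k. b k \<bullet> e) - e) < (1 / 2) / DIM(real^'d))"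
    unfolding m_def by (rule ex_radius) (rule eventually_dpos_near_identity[OF b], auto)
  then obtain r1 where r1: "r1 > 0" "\<And>x t e. norm (x - x0) \<le> r1 \<Longrightarrow> (\<And>k. k < m \<Longrightarrow> \<bar>t k - t0 k\<bar> \<le> r1) \<Longrightarrow>
      e \<in> Basis \<Longrightarrow> norm (dpos w x t (\<lambda>k. b k \<bullet> e) - e) < (1 / 2) / DIM(real^'d)"
    by blast
  \<comment> \<open>Besides keeping the derivative close to the identity, r is at most each
    \<open>t0 k\<close>, so that durations within r of \<open>t0\<close> are nonnegative.\<close>
  define r where "r = min r1 (Min (insert 1 (t0 ` {..<m})))"
  have r: "r > 0" "r \<le> r1" and r_le: "\<And>k. k < m \<Longrightarrow> r \<le> t0 k"
  proof -
    have "Min (insert 1 (t0 ` {..<m})) > 0" using t0 by (subst Min_gr_iff) auto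
    then show "r > 0" using r1 by (simp add: r_def)
    show "r \<le> r1" by (simp add: r_def)
    show "r \<le> t0 k" if "k < m" for k
    proof -
      have "Min (insert 1 (t0 ` {..<m})) \<le> t0 k" using that by (intro Min_le) auto
      then show ?thesis by (simp add: r_def min.coboundedI2)
    qed
  qed
  define \<beta> where "\<beta> = (\<Sum>k<m. norm (b k)) + 1"
  have \<beta>: "\<beta> > 0" unfolding \<beta>_def by (intro add_nonneg_pos sum_nonneg) auto
  have b_le: "norm (b k) \<le> \<beta>" if "k < m" for k
  proof -
    have "norm (b k) \<le> (\<Sum>k<m. norm (b k))" using that by (intro member_le_sum) auto
    then show ?thesis by (simp add: \<beta>_def)
  qed
  \<comment> \<open>One half of r is spent on the shifts \<open>b k \<bullet> \<sigma>\<close>, the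
    other half is left for the base durations.\<close>
  define \<delta> where "\<delta> = r / (2 * \<beta>)"
  have \<delta>: "\<delta> > 0" using r \<beta> by (simp add: \<delta>_def)
  have b\<sigma>: "\<bar>b k \<bullet> \<sigma>\<bar> \<le> r / 2" if "k < m" "norm \<sigma> < \<delta>" for k \<sigma>
  proof -
    have "\<bar>b k \<bullet> \<sigma>\<bar> \<le> norm (b k) * norm \<sigma>" by (rule Cauchy_Schwarz_ineq2)
    also have "\<dots> \<le> \<beta> * \<delta>" using b_le[OF that(1)] that(2) \<beta> by (intro mult_mono) auto
    also have "\<dots> = r / 2" using \<beta> by (simp add: \<delta>_def)
    finally show ?thesis .
  qed
  define y0 where "y0 = pos w x0 t0"
  have "\<exists>r>0. \<forall>x t. norm (x - x0) \<le> r \<longrightarrow> (\<forall>k<m. \<bar>t k - t0 k\<bar> \<le> r) \<longrightarrow> dist (pos w x t) y0 < \<delta> / 8"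
  proof (rule ex_radius)
    fix X T assume "X \<longlonglongrightarrow> x0" "\<And>k. k < m \<Longrightarrow> (\<lambda>n. T n k) \<longlonglongrightarrow> t0 k"
    then have "(\<lambda>n. pos w (X n) (T n)) \<longlonglongrightarrow> y0" unfolding y0_def m_def by (rule tendsto_pos)
    then show "\<forall>\<^sub>F n in sequentially. dist (pos w (X n) (T n)) y0 < \<delta> / 8"
      by (rule tendstoD) (use \<delta> in simp)
  qed
  then obtain r2 where r2: "r2 > 0" "\<And>x t. norm (x - x0) \<le> r2 \<Longrightarrow> (\<And>k. k < m \<Longrightarrow> \<bar>t k - t0 k\<bar> \<le> r2) \<Longrightarrow> dist (pos w x t) y0 < \<delta> / 8"
    by blast
  define \<rho> where "\<rho> = min (r / 2) r2"
  have \<rho>: "\<rho> > 0" "\<rho> \<le> r / 2" "\<rho> \<le> r2" using r r2 by (auto simp: \<rho>_def)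
  \<comment> \<open>The image of \<open>S\<close> will contain the ball of radius \<delta> / 4 about
    the value at \<sigma> = 0, and that value stays within \<delta> / 8 of \<open>y0\<close>; hence
    the image contains \<open>V\<close>.\<close>
  define V where "V = ball y0 (\<delta> / 8)"
  define S where "S = ball (0 :: real^'d) \<delta>"
  define l where "l k = t0 k - \<rho>" for k
  define u where "u k = t0 k + \<rho>" for k
  define Tm where "Tm = (\<Sum>k<m. t0 k) + r"
  have time_range: "\<bar>\<tau> + b k \<bullet> \<sigma> - t0 k\<bar> \<le> r" if "k < m" "l k \<le> \<tau>" "\<tau> \<le> u k" "norm \<sigma> < \<delta>" for k \<tau> \<sigma>
    using b\<sigma>[OF that(1,4)] that(2,3) \<rho> by (auto simp: l_def u_def)
  have S_meas[measurable]: "S \<in> sets borel" by (simp add: S_def)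
  have cover: "(\<integral>\<^sup>+y. h y * indicator V y \<partial>lborel) \<le>
      ennreal J * (\<integral>\<^sup>+\<sigma>. indicator S \<sigma> * h (pos w x (\<lambda>k. \<theta> k + b k \<bullet> \<sigma>)) \<partial>lborel)"
    if x: "norm (x - x0) < \<rho>" and \<theta>: "\<And>k. k < m \<Longrightarrow> l k \<le> \<theta> k \<and> \<theta> k \<le> u k"
      and h[measurable]: "h \<in> borel_measurable borel" for x \<theta> h
  proof -
    let ?f = "\<lambda>\<sigma>. pos w x (\<lambda>k. \<theta> k + b k \<bullet> \<sigma>)" and ?f' = "\<lambda>\<sigma>. Dpos w x (\<lambda>k. \<theta> k + b k \<bullet> \<sigma>) b"
    have near: "norm (?f' \<sigma> z - z) \<le> 1 / 2 * norm z" if "\<sigma> \<in> ball 0 \<delta>" for \<sigma> z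
      unfolding Dpos_apply
    proof (rule norm_linear_minus_identity_le[OF linear_dpos_inner])
      fix e :: "real^'d" assume "e \<in> Basis"
      moreover have "\<bar>\<theta> k + b k \<bullet> \<sigma> - t0 k\<bar> \<le> r1" if "k < m" for k
        using time_range[OF that, of "\<theta> k" \<sigma>] \<theta>[OF that] \<open>\<sigma> \<in> ball 0 \<delta>\<close> r(2) by auto
      ultimately show "norm (dpos w x (\<lambda>k. \<theta> k + b k \<bullet> \<sigma>) (\<lambda>k. b k \<bullet> e) - e) \<le> (1 / 2) / DIM(real^'d)"
        using x \<rho> r by (intro less_imp_le[OF r1(2)]) auto
    qed simp
    have der: "(?f has_derivative ?f' \<sigma>) (at \<sigma>)" for \<sigma>
      unfolding Dpos_apply[abs_def] by (rule has_derivative_pos)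
    have onorm: "onorm (\<lambda>z. ?f' \<sigma> z - z) \<le> 1 / 2" if "\<sigma> \<in> ball 0 \<delta>" for \<sigma>
      using near[OF that] by (intro onorm_bound) auto
    have inj: "inj_on ?f S"
      unfolding S_def by (rule cball_subset_image_near_identity(1)[OF der onorm \<delta>])
    have "cball (?f 0) (\<delta> / 4) \<subseteq> ?f ` S"
      unfolding S_def by (rule cball_subset_image_near_identity(2)[OF der onorm \<delta>])
    moreover have "dist (?f 0) y0 < \<delta> / 8"
    proof (rule r2(2))
      show "\<bar>\<theta> k + b k \<bullet> 0 - t0 k\<bar> \<le> r2" if "k < m" for k
        using \<theta>[OF that] \<rho> by (auto simp: l_def u_def)
    qed (use x \<rho> in auto)
    moreover have "dist (?f 0) y \<le> \<delta> / 4" if "dist (?f 0) y0 < \<delta> / 8" "dist y0 y < \<delta> / 8" for y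
      using that dist_triangle[of "?f 0" y y0] by linarith
    ultimately have V: "V \<subseteq> ?f ` S"
      by (auto simp: V_def subset_iff)
    have contf: "continuous_on UNIV ?f"
      using der by (meson continuous_at_imp_continuous_on has_derivative_continuous)
    have [measurable]: "?f \<in> borel_measurable borel"
      by (rule borel_measurable_continuous_onI[OF contf])
    have "(\<integral>\<^sup>+y. h y * indicator V y \<partial>lborel) \<le> (\<integral>\<^sup>+y. h y * indicator (?f ` S) y \<partial>lborel)"
      using V by (intro nn_integral_mono mult_left_mono) (auto simp: indicator_def)
    also have "\<dots> = (\<integral>\<^sup>+\<sigma>. h (?f \<sigma>) * (indicator S \<sigma> * ennreal (jac (?f' \<sigma>))) \<partial>lborel)"
      by (rule nn_integral_change_of_variables[symmetric, OF _ contf inj der continuous_Dpos h]) (simp add: S_def)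
    also have "\<dots> \<le> (\<integral>\<^sup>+\<sigma>. ennreal J * (indicator S \<sigma> * h (?f \<sigma>)) \<partial>lborel)"
    proof (intro nn_integral_mono)
      fix \<sigma>
      show "h (?f \<sigma>) * (indicator S \<sigma> * ennreal (jac (?f' \<sigma>))) \<le> ennreal J * (indicator S \<sigma> * h (?f \<sigma>))"
      proof (cases "\<sigma> \<in> S")
        case True
        then have "jac (?f' \<sigma>) \<le> J" using near by (intro J(2)) (auto simp: S_def)
        then have "ennreal (jac (?f' \<sigma>)) * h (?f \<sigma>) \<le> ennreal J * h (?f \<sigma>)"
          by (intro mult_right_mono ennreal_leI) auto
        then show ?thesis using True by (simp add: mult.commute)
      qed simp
    qed
    also have "\<dots> = ennreal J * (\<integral>\<^sup>+\<sigma>. indicator S \<sigma> * h (?f \<sigma>) \<partial>lborel)"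
      by (rule nn_integral_cmult) measurable
    finally show ?thesis .
  qed
  define c1 where "c1 = (\<Lambda> * exp (- (\<Lambda> * Tm))) ^ m"
  define vol where "vol = measure lborel S"
  define Box where "Box = (\<Prod>k<m. u k - l k)"
  have pos: "c1 > 0" "vol > 0" "Box > 0"
    using Lambda_pos \<delta> \<rho> by (auto simp: c1_def vol_def Box_def l_def u_def S_def content_ball_pos intro!: prod_pos)
  have volS: "emeasure lborel S = ennreal vol"
    unfolding vol_def S_def by (intro emeasure_eq_ennreal_measure) (use emeasure_lborel_ball_finite[of "0 :: real^'d" \<delta>] in auto)
  \<comment> \<open>Read off from c1 * Box * I \<le> J * vol * W, with I the integral over
    \<open>V\<close> and W the value of \<open>word_op\<close>.\<close>
  define c where "c = c1 * Box / (J * vol)"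
  have word: "ennreal c * (\<integral>\<^sup>+y. h y * indicator V y \<partial>lborel) \<le> word_op w h x"
    if x: "norm (x - x0) < \<rho>" and h[measurable]: "h \<in> borel_measurable borel" for x h
  proof -
    let ?W = "word_op w h x" and ?I = "\<integral>\<^sup>+y. h y * indicator V y \<partial>lborel"
    let ?F = "\<lambda>\<sigma> \<theta>. indicator S \<sigma> * (box_ind m l u \<theta> * h (pos w x (\<lambda>k. \<theta> k + b k \<bullet> \<sigma>)))"
    note [measurable] = measurable_box_ind
    have meas_pos: "(\<lambda>(\<sigma>, \<theta>). pos w x (\<lambda>k. \<theta> k + b k \<bullet> \<sigma>)) \<in> borel_measurable (lborel \<Otimes>\<^sub>M Leb m)"
      unfolding case_prod_beta
      by (intro measurable_pos borel_measurable_add borel_measurable_inner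
            measurable_compose[OF measurable_snd measurable_Leb_component])
        (auto simp: m_def intro!: measurable_compose[OF measurable_fst])
    have meas_F: "case_prod ?F \<in> borel_measurable (lborel \<Otimes>\<^sub>M Leb m)"
      using measurable_compose[OF meas_pos h] unfolding case_prod_beta
      by (intro borel_measurable_times_ennreal measurable_compose[OF measurable_fst borel_measurable_indicator]
            measurable_compose[OF measurable_snd measurable_box_ind]) auto
    interpret pair_sigma_finite lborel "Leb m"
      by (intro pair_sigma_finite.intro Leb.sigma_finite lborel.sigma_finite_measure_axioms) simp
    have bound: "ennreal c1 * (\<integral>\<^sup>+\<theta>. ?F \<sigma> \<theta> \<partial>Leb m) \<le> ?W * indicator S \<sigma>" for \<sigma>
    proof (cases "\<sigma> \<in> S")
      case True
      have "ennreal ((\<Lambda> * exp (- (\<Lambda> * Tm))) ^ length w) *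
         (\<integral>\<^sup>+\<theta>. box_ind (length w) l u \<theta> * h (pos w x (\<lambda>k. \<theta> k + b k \<bullet> \<sigma>)) \<partial>Leb (length w)) \<le> word_op w h x"
      proof (rule word_op_ge_box[OF h])
        fix k \<tau> assume k: "k < length w" "l k \<le> \<tau>" "\<tau> \<le> u k"
        have "t0 k \<le> (\<Sum>k<m. t0 k)" using k t0 by (intro member_le_sum) (auto simp: m_def less_imp_le)
        then show "0 \<le> \<tau> + b k \<bullet> \<sigma> \<and> \<tau> + b k \<bullet> \<sigma> \<le> Tm"
          using time_range[of k \<tau> \<sigma>] r_le[of k] k True by (auto simp: m_def Tm_def S_def abs_le_iff)
      qed
      then show ?thesis using True by (simp add: c1_def m_def)
    qed simp
    have "?I * box_ind m l u \<theta> \<le> ennreal J * (\<integral>\<^sup>+\<sigma>. ?F \<sigma> \<theta> \<partial>lborel)" for \<theta>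
    proof (cases "\<forall>k<m. l k \<le> \<theta> k \<and> \<theta> k \<le> u k")
      case True
      then have "box_ind m l u \<theta> = 1" by (auto simp: box_ind_def)
      then show ?thesis using cover[OF x _ h, of \<theta>] True by simp
    next
      case False
      then have "box_ind m l u \<theta> = 0" by (force simp: box_ind_def indicator_def)
      then show ?thesis by simp
    qed
    then have "(\<integral>\<^sup>+\<theta>. ?I * box_ind m l u \<theta> \<partial>Leb m) \<le> (\<integral>\<^sup>+\<theta>. ennreal J * (\<integral>\<^sup>+\<sigma>. ?F \<sigma> \<theta> \<partial>lborel) \<partial>Leb m)"
      by (intro nn_integral_mono)
    moreover have "(\<integral>\<^sup>+\<theta>. ?I * box_ind m l u \<theta> \<partial>Leb m) = ?I * ennreal Box"
    proof -
      have "(\<integral>\<^sup>+\<theta>. box_ind m l u \<theta> \<partial>Leb m) = ennreal Box"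
      proof -
        have le: "l k \<le> u k" for k using \<rho> by (simp add: l_def u_def)
        show ?thesis
          unfolding Box_def by (subst nn_integral_box_ind[OF le], rule prod_ennreal) (use le in simp)
      qed
      then show ?thesis by (simp add: nn_integral_cmult)
    qed
    moreover have "(\<integral>\<^sup>+\<theta>. ennreal J * (\<integral>\<^sup>+\<sigma>. ?F \<sigma> \<theta> \<partial>lborel) \<partial>Leb m) = ennreal J * (\<integral>\<^sup>+\<sigma>. (\<integral>\<^sup>+\<theta>. ?F \<sigma> \<theta> \<partial>Leb m) \<partial>lborel)"
    proof -
      have "(\<lambda>\<theta>. \<integral>\<^sup>+\<sigma>. ?F \<sigma> \<theta> \<partial>lborel) \<in> borel_measurable (Leb m)"
        using lborel.borel_measurable_nn_integral_fst[OF measurable_pair_swap[OF meas_F]]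
        by (simp add: case_prod_beta')
      then show ?thesis using Fubini'[OF meas_F] by (simp add: nn_integral_cmult)
    qed
    ultimately have 1: "?I * ennreal Box \<le> ennreal J * (\<integral>\<^sup>+\<sigma>. (\<integral>\<^sup>+\<theta>. ?F \<sigma> \<theta> \<partial>Leb m) \<partial>lborel)" by simp
    have "ennreal c1 * (\<integral>\<^sup>+\<sigma>. (\<integral>\<^sup>+\<theta>. ?F \<sigma> \<theta> \<partial>Leb m) \<partial>lborel) = (\<integral>\<^sup>+\<sigma>. ennreal c1 * (\<integral>\<^sup>+\<theta>. ?F \<sigma> \<theta> \<partial>Leb m) \<partial>lborel)"
      using M2.borel_measurable_nn_integral_fst[OF meas_F] by (intro nn_integral_cmult[symmetric]) simp
    also have "\<dots> \<le> (\<integral>\<^sup>+\<sigma>. ?W * indicator S \<sigma> \<partial>lborel)" by (intro nn_integral_mono bound)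
    also have "\<dots> = ?W * ennreal vol" by (simp add: nn_integral_cmult volS)
    finally have 2: "ennreal c1 * (\<integral>\<^sup>+\<sigma>. (\<integral>\<^sup>+\<theta>. ?F \<sigma> \<theta> \<partial>Leb m) \<partial>lborel) \<le> ?W * ennreal vol" .
    have "ennreal c1 * (?I * ennreal Box) \<le> ennreal J * (?W * ennreal vol)"
      using mult_left_mono[OF 1, of "ennreal c1"] mult_left_mono[OF 2, of "ennreal J"]
      by (simp add: mult.left_commute)
    from mult_left_mono[OF this, of "ennreal (1 / (J * vol))"]
    have "ennreal (1 / (J * vol)) * (ennreal c1 * (?I * ennreal Box)) \<le> ennreal (1 / (J * vol)) * (ennreal J * (?W * ennreal vol))"
      by simp
    also have "ennreal (1 / (J * vol)) * (ennreal J * (?W * ennreal vol)) = (ennreal (1 / (J * vol)) * ennreal J * ennreal vol) * ?W"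
      by (simp add: mult_ac)
    also have "ennreal (1 / (J * vol)) * ennreal J * ennreal vol = 1"
      using J pos by (simp add: ennreal_mult[symmetric])
    also have "ennreal (1 / (J * vol)) * (ennreal c1 * (?I * ennreal Box)) = (ennreal (1 / (J * vol)) * ennreal c1 * ennreal Box) * ?I"
      by (simp add: mult_ac)
    also have "ennreal (1 / (J * vol)) * ennreal c1 * ennreal Box = ennreal c"
      using J pos by (simp add: ennreal_mult[symmetric] c_def)
    finally show ?thesis by simp
  qed
  have c: "c > 0" using pos J by (simp add: c_def)
  have "ennreal (pmin ^ m * c) * (\<integral>\<^sup>+y. h j y * indicator V y \<partial>lborel) \<le> (K ^^ m) h i x"
    if "\<forall>j. h j \<in> borel_measurable borel" "norm (x - x0) < \<rho>" for h x i
  proof -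
    have "ennreal (pmin ^ m * c) * (\<integral>\<^sup>+y. h j y * indicator V y \<partial>lborel) \<le> ennreal (pmin ^ m) * word_op w (h j) x"
      using mult_left_mono[OF word[OF that(2), of "h j"], of "ennreal (pmin ^ m)"] that(1) c pmin_pos
      by (simp add: ennreal_mult less_imp_le mult.assoc)
    also have "\<dots> \<le> (K ^^ m) h i x" using K_pow_ge[of h w' j x i] that(1) by (simp add: jw m_def)
    finally show ?thesis .
  qed
  moreover have "open V" "V \<noteq> {}" using \<delta> by (auto simp: V_def)
  moreover have "0 < pmin ^ m * c" using c pmin_pos by simp
  ultimately show ?thesis using \<rho>(1) by blast
qed

end

section \<open>Lower semicontinuous densities\<close>

definition lsc :: "('a::topological_space \<Rightarrow> ennreal) \<Rightarrow> bool" where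
  "lsc f \<longleftrightarrow> (\<forall>a. open {x. a < f x})"

lemma lsc_borel_measurable: "lsc f \<Longrightarrow> f \<in> borel_measurable borel"
  by (rule borel_measurableI_greater) (simp add: lsc_def)

text \<open>The form in which Fatou's lemma gives semicontinuity of integrals depending on a
  parameter.\<close>

lemma lsc_iff_liminf:
  fixes f :: "'a::first_countable_topology \<Rightarrow> ennreal"
  shows "lsc f \<longleftrightarrow> (\<forall>x X. X \<longlonglongrightarrow> x \<longrightarrow> f x \<le> liminf (\<lambda>n. f (X n)))"
proof safe
  fix x and X :: "nat \<Rightarrow> 'a" assume f: "lsc f" and X: "X \<longlonglongrightarrow> x"
  show "f x \<le> liminf (\<lambda>n. f (X n))"
    unfolding le_Liminf_iff
  proof safe
    fix y assume "y < f x"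
    then show "\<forall>\<^sub>F n in sequentially. y < f (X n)"
      using topological_tendstoD[OF X, of "{x. y < f x}"] f by (simp add: lsc_def)
  qed
next
  assume *: "\<forall>x X. X \<longlonglongrightarrow> x \<longrightarrow> f x \<le> liminf (\<lambda>n. f (X n))"
  have "closed {x. f x \<le> a}" for a
    unfolding closed_sequential_limits
  proof safe
    fix X l assume X: "\<forall>n. X n \<in> {x. f x \<le> a}" "X \<longlonglongrightarrow> l"
    show "f l \<le> a"
    proof (rule ccontr)
      assume "\<not> f l \<le> a"
      then have "\<forall>\<^sub>F n in sequentially. a < f (X n)"
        using *[rule_format, OF X(2)] unfolding le_Liminf_iff by auto
      then show False using X(1) by (auto simp: eventually_sequentially not_less[symmetric])
    qed
  qed
  then have "open (- {x. f x \<le> a})" for a by (simp add: open_Compl)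
  moreover have "- {x. f x \<le> a} = {x. a < f x}" for a by auto
  ultimately show "lsc f" by (simp add: lsc_def)
qed

lemma lsc_nn_integral:
  fixes F :: "'b \<Rightarrow> 'a::first_countable_topology \<Rightarrow> ennreal"
  assumes lsc: "\<And>s. lsc (F s)" and meas: "\<And>x. (\<lambda>s. F s x) \<in> borel_measurable N"
  shows "lsc (\<lambda>x. \<integral>\<^sup>+s. F s x \<partial>N)"
  unfolding lsc_iff_liminf
proof safe
  fix x and X :: "nat \<Rightarrow> 'a" assume X: "X \<longlonglongrightarrow> x"
  have "(\<integral>\<^sup>+s. F s x \<partial>N) \<le> (\<integral>\<^sup>+s. liminf (\<lambda>n. F s (X n)) \<partial>N)"
    using lsc X by (intro nn_integral_mono) (simp add: lsc_iff_liminf)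
  also have "\<dots> \<le> liminf (\<lambda>n. \<integral>\<^sup>+s. F s (X n) \<partial>N)"
    by (rule nn_integral_liminf[OF meas])
  finally show "(\<integral>\<^sup>+s. F s x \<partial>N) \<le> liminf (\<lambda>n. \<integral>\<^sup>+s. F s (X n) \<partial>N)" .
qed

lemma lsc_sum:
  fixes F :: "'b \<Rightarrow> 'a::first_countable_topology \<Rightarrow> ennreal"
  assumes "finite A" "\<And>i. lsc (F i)"
  shows "lsc (\<lambda>x. \<Sum>i\<in>A. F i x)"
  using lsc_nn_integral[of F "count_space A"] assms by (simp add: nn_integral_count_space_finite)

lemma lsc_add:
  fixes f g :: "'a::first_countable_topology \<Rightarrow> ennreal"
  assumes "lsc f" "lsc g"
  shows "lsc (\<lambda>x. f x + g x)"
  using lsc_sum[of "UNIV :: bool set" "\<lambda>b. if b then f else g"] assms by (simp add: UNIV_bool add.commute)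

lemma lsc_compose: "lsc f \<Longrightarrow> continuous_on UNIV g \<Longrightarrow> lsc (\<lambda>x. f (g x))"
  unfolding lsc_def using open_vimage[of "{x. a < f x}" g for a] by (auto simp: vimage_def)

lemma lsc_indicator: "open V \<Longrightarrow> lsc (indicator V :: 'a::topological_space \<Rightarrow> ennreal)"
  unfolding lsc_def
proof
  fix a :: ennreal assume "open V"
  have "{x. a < indicator V x} = (if a < 1 then V else {})"
    by (auto simp: indicator_def split: if_splits)
  then show "open {x. a < indicator V x}" using \<open>open V\<close> by simp
qed

lemma lsc_0: "lsc (\<lambda>_. 0)"
  by (simp add: lsc_def)

lemma lsc_SUP: "(\<And>i. lsc (F i)) \<Longrightarrow> lsc (\<lambda>x. SUP i. F i x)"
proof -
  assume F: "\<And>i. lsc (F i)"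
  have "{x. a < (SUP i. F i x)} = (\<Union>i. {x. a < F i x})" for a by (auto simp: less_SUP_iff)
  with F show "lsc (\<lambda>x. SUP i. F i x)" by (auto simp: lsc_def)
qed

lemma lsc_max: "lsc f \<Longrightarrow> lsc g \<Longrightarrow> lsc (\<lambda>x. max (f x) (g x))"
proof -
  assume fg: "lsc f" "lsc g"
  have "{x. a < max (f x) (g x)} = {x. a < f x} \<union> {x. a < g x}" for a by (auto simp: less_max_iff_disj)
  with fg show "lsc (\<lambda>x. max (f x) (g x))" by (auto simp: lsc_def)
qed

text \<open>The factor \<open>c x\<close> is the length of the interval from 0 to
  \<open>c x\<close>, so the product is an integral over s of functions that are semicontinuous for
  each s. This avoids products of lower limits in the presence of 0 and infinity.\<close>

lemma lsc_cmult_continuous: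
  fixes c :: "'a::first_countable_topology \<Rightarrow> real"
  assumes f: "lsc f" and c: "continuous_on UNIV c" "\<And>x. 0 \<le> c x"
  shows "lsc (\<lambda>x. ennreal (c x) * f x)"
proof -
  let ?F = "\<lambda>s x. indicator {0..<c x} s * f x"
  have "lsc (?F s)" for s
    unfolding lsc_def
  proof
    fix a
    have "{x. a < ?F s x} = (if 0 \<le> s then {x. s < c x} \<inter> {x. a < f x} else {})"
      by (auto simp: indicator_def)
    moreover have "open {x. s < c x}" using c(1) by (intro open_Collect_less continuous_on_const)
    ultimately show "open {x. a < ?F s x}" using f by (auto simp: lsc_def)
  qed
  then have "lsc (\<lambda>x. \<integral>\<^sup>+s. ?F s x \<partial>lborel)" by (intro lsc_nn_integral) auto
  then show ?thesis using c(2) by (simp add: nn_integral_multc)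
qed

lemma lsc_cmult:
  "lsc f \<Longrightarrow> lsc (\<lambda>x :: 'a::first_countable_topology. ennreal c * f x)"
proof (cases "0 \<le> c")
  case True
  then show "lsc f \<Longrightarrow> lsc (\<lambda>x. ennreal c * f x)" using lsc_cmult_continuous[of f "\<lambda>_. c"] by simp
qed (simp add: ennreal_neg lsc_0)

section \<open>The transposed kernel on densities\<close>

context switching begin

lemma K_mono: "(\<And>j x. h j x \<le> h' j x) \<Longrightarrow> K h i x \<le> K h' i x"
  unfolding K_def by (intro sum_mono mult_left_mono T_mono) auto

lemma K_pow_mono: "(\<And>j x. h j x \<le> h' j x) \<Longrightarrow> (K ^^ m) h i x \<le> (K ^^ m) h' i x"
  by (induction m arbitrary: i x) (auto intro: K_mono)

lemma K_cmult: "(\<And>j. h j \<in> borel_measurable borel) \<Longrightarrow> K (\<lambda>j x. c * h j x) i x = c * K h i x"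
  unfolding K_def by (simp add: T_cmult sum_distrib_left mult_ac)

lemma K_pow_cmult:
  "(\<And>j. h j \<in> borel_measurable borel) \<Longrightarrow> (K ^^ m) (\<lambda>j x. c * h j x) i x = c * (K ^^ m) h i x"
proof (induction m arbitrary: i x)
  case (Suc m)
  then have "(K ^^ m) (\<lambda>j x. c * h j x) = (\<lambda>i x. c * (K ^^ m) h i x)" by (simp add: fun_eq_iff)
  then show ?case using Suc.prems by (simp add: K_cmult measurable_K_pow)
qed simp

text \<open>The transpose of \<open>K\<close> with respect to Lebesgue measure: what arrives at
  \<open>y\<close> in copy \<open>j\<close> is traced back along the flow of \<open>v j\<close> and
  weighted by the Jacobian of the backward flow.\<close>

definition dual :: "('n \<Rightarrow> real^'d \<Rightarrow> ennreal) \<Rightarrow> 'n \<Rightarrow> real^'d \<Rightarrow> ennreal" where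
  "dual g j y = (\<Sum>i\<in>UNIV. ennreal (P i j) *
     (\<integral>\<^sup>+t. ennreal (exponential_density \<Lambda> t) * (ennreal (jac (D j (- t) y)) * g i (\<phi> j (- t) y)) \<partial>lborel))"

lemma measurable_jac_D:
  assumes "f \<in> borel_measurable N" "g \<in> borel_measurable N"
  shows "(\<lambda>z. jac (D j (f z) (g z))) \<in> borel_measurable N"
proof -
  have "(\<lambda>p. jac (D j (fst p) (snd p))) \<in> borel_measurable borel"
    by (intro borel_measurable_continuous_onI continuous_intros)
  from measurable_compose[OF borel_measurable_Pair[OF assms] this] show ?thesis by simp
qed

lemma lsc_dual: "(\<And>i. lsc (g i)) \<Longrightarrow> lsc (dual g j)"
  unfolding dual_def
proof (intro lsc_sum lsc_cmult lsc_nn_integral finite_UNIV)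
  assume g: "\<And>i. lsc (g i)"
  note [measurable] = lsc_borel_measurable[OF g] measurable_jac_D
  show "lsc (\<lambda>y. ennreal (jac (D j (- t) y)) * g i (\<phi> j (- t) y))" for t i
    by (intro lsc_cmult_continuous lsc_compose[OF g] jac_nonneg continuous_intros)
  show "(\<lambda>t. ennreal (exponential_density \<Lambda> t) * (ennreal (jac (D j (- t) y)) * g i (\<phi> j (- t) y))) \<in> borel_measurable lborel" for y i
    by measurable
qed simp

text \<open>For each fixed t the flow is undone by a change of variables; Fubini's theorem moves the
  time integral outside and back.\<close>

lemma nn_integral_T_duality:
  assumes [measurable]: "g \<in> borel_measurable borel" "h \<in> borel_measurable borel"
  shows "(\<integral>\<^sup>+x. g x * T j h x \<partial>lborel) = (\<integral>\<^sup>+y.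
    (\<integral>\<^sup>+t. ennreal (exponential_density \<Lambda> t) * (ennreal (jac (D j (- t) y)) * g (\<phi> j (- t) y)) \<partial>lborel) * h y \<partial>lborel)"
proof -
  note [measurable] = measurable_jac_D
  have cov: "(\<integral>\<^sup>+x. g x * h (\<phi> j t x) \<partial>lborel) = (\<integral>\<^sup>+y. ennreal (jac (D j (- t) y)) * g (\<phi> j (- t) y) * h y \<partial>lborel)" for t
  proof -
    have range: "range (\<phi> j (- t)) = UNIV"
    proof (rule surjI)
      show "\<phi> j (- t) (\<phi> j t x) = x" for x by simp
    qed
    have "(\<integral>\<^sup>+y. (\<lambda>x. g x * h (\<phi> j t x)) (\<phi> j (- t) y) * (indicator UNIV y * ennreal (jac (D j (- t) y))) \<partial>lborel)
      = (\<integral>\<^sup>+x. (\<lambda>x. g x * h (\<phi> j t x)) x * indicator (range (\<phi> j (- t))) x \<partial>lborel)"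
    proof (rule nn_integral_change_of_variables)
      show "inj (\<phi> j (- t))" by (rule inj_on_inverseI[of _ "\<phi> j t"]) simp
    qed (auto intro!: continuous_intros has_derivative_phi)
    then show ?thesis unfolding range by (simp add: mult_ac)
  qed
  have "(\<integral>\<^sup>+x. g x * T j h x \<partial>lborel) = (\<integral>\<^sup>+x. (\<integral>\<^sup>+t. ennreal (exponential_density \<Lambda> t) * (g x * h (\<phi> j t x)) \<partial>lborel) \<partial>lborel)"
    unfolding T_def by (intro nn_integral_cong, subst nn_integral_cmult[symmetric]) (auto simp: mult_ac)
  also have "\<dots> = (\<integral>\<^sup>+t. (\<integral>\<^sup>+x. ennreal (exponential_density \<Lambda> t) * (g x * h (\<phi> j t x)) \<partial>lborel) \<partial>lborel)"
    by (rule lborel_pair.Fubini') measurable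
  also have "\<dots> = (\<integral>\<^sup>+t. (\<integral>\<^sup>+y. ennreal (exponential_density \<Lambda> t) * (ennreal (jac (D j (- t) y)) * g (\<phi> j (- t) y) * h y) \<partial>lborel) \<partial>lborel)"
    by (simp add: nn_integral_cmult cov)
  also have "\<dots> = (\<integral>\<^sup>+y. (\<integral>\<^sup>+t. ennreal (exponential_density \<Lambda> t) * (ennreal (jac (D j (- t) y)) * g (\<phi> j (- t) y) * h y) \<partial>lborel) \<partial>lborel)"
    by (rule lborel_pair.Fubini') measurable
  also have "\<dots> = (\<integral>\<^sup>+y. (\<integral>\<^sup>+t. ennreal (exponential_density \<Lambda> t) * (ennreal (jac (D j (- t) y)) * g (\<phi> j (- t) y)) \<partial>lborel) * h y \<partial>lborel)"
    by (intro nn_integral_cong, subst nn_integral_multc[symmetric]) (auto simp: mult_ac)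
  finally show ?thesis .
qed

lemma nn_integral_K_duality:
  assumes "\<And>i. g i \<in> borel_measurable borel" "\<And>i. h i \<in> borel_measurable borel"
  shows "(\<Sum>i\<in>UNIV. \<integral>\<^sup>+x. g i x * K h i x \<partial>lborel) = (\<Sum>j\<in>UNIV. \<integral>\<^sup>+y. dual g j y * h j y \<partial>lborel)"
proof -
  note [measurable] = assms measurable_jac_D
  let ?I = "\<lambda>i j y. \<integral>\<^sup>+t. ennreal (exponential_density \<Lambda> t) * (ennreal (jac (D j (- t) y)) * g i (\<phi> j (- t) y)) \<partial>lborel"
  have I[measurable]: "?I i j \<in> borel_measurable borel" for i j by measurable
  have "(\<Sum>i\<in>UNIV. \<integral>\<^sup>+x. g i x * K h i x \<partial>lborel) = (\<Sum>i\<in>UNIV. \<Sum>j\<in>UNIV. ennreal (P i j) * (\<integral>\<^sup>+x. g i x * T j (h j) x \<partial>lborel))"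
    unfolding K_def sum_distrib_left
    by (intro sum.cong refl, subst nn_integral_sum)
      (auto simp: nn_integral_cmult[symmetric] mult_ac intro!: sum.cong)
  also have "\<dots> = (\<Sum>i\<in>UNIV. \<Sum>j\<in>UNIV. ennreal (P i j) * (\<integral>\<^sup>+y. ?I i j y * h j y \<partial>lborel))"
    using assms by (simp add: nn_integral_T_duality)
  also have "\<dots> = (\<Sum>j\<in>UNIV. \<Sum>i\<in>UNIV. ennreal (P i j) * (\<integral>\<^sup>+y. ?I i j y * h j y \<partial>lborel))"
    by (rule sum.swap)
  also have "\<dots> = (\<Sum>j\<in>UNIV. \<integral>\<^sup>+y. dual g j y * h j y \<partial>lborel)"
    unfolding dual_def sum_distrib_right
    by (intro sum.cong refl, subst nn_integral_sum)
      (auto simp: nn_integral_cmult[symmetric] mult_ac intro!: sum.cong)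
  finally show ?thesis .
qed

lemma nn_integral_K_pow_duality:
  assumes "\<And>i. lsc (g i)" "\<And>i. h i \<in> borel_measurable borel"
  shows "(\<Sum>i\<in>UNIV. \<integral>\<^sup>+x. g i x * (K ^^ m) h i x \<partial>lborel) = (\<Sum>j\<in>UNIV. \<integral>\<^sup>+y. (dual ^^ m) g j y * h j y \<partial>lborel)"
  using assms(1)
proof (induction m arbitrary: g)
  case (Suc m)
  have "(\<Sum>i\<in>UNIV. \<integral>\<^sup>+x. g i x * (K ^^ Suc m) h i x \<partial>lborel) = (\<Sum>i\<in>UNIV. \<integral>\<^sup>+x. dual g i x * (K ^^ m) h i x \<partial>lborel)"
    using Suc.prems assms(2) by (simp add: nn_integral_K_duality lsc_borel_measurable measurable_K_pow)
  also have "\<dots> = (\<Sum>j\<in>UNIV. \<integral>\<^sup>+y. (dual ^^ m) (dual g) j y * h j y \<partial>lborel)"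
    using Suc.prems by (intro Suc.IH lsc_dual)
  finally show ?case by (simp add: funpow_swap1)
qed simp

lemma lsc_dual_pow: "(\<And>i. lsc (g i)) \<Longrightarrow> lsc ((dual ^^ m) g j)"
  by (induction m arbitrary: j) (auto intro: lsc_dual)

section \<open>Positivity along accessible paths\<close>

lemma lsc_T: "lsc h \<Longrightarrow> lsc (T j h)"
proof -
  assume h: "lsc h"
  note [measurable] = lsc_borel_measurable[OF h]
  show ?thesis
    unfolding T_def
    by (intro lsc_nn_integral lsc_cmult lsc_compose[OF h] continuous_intros) measurable
qed

lemma T_indicator_pos:
  assumes "open U" "\<phi> j t y \<in> U" "0 \<le> t"
  shows "0 < T j (indicator U) y"
proof -
  have "isCont (\<lambda>s. \<phi> j s y) t"
    using phi_deriv has_vector_derivative_continuous by blast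
  then obtain \<epsilon> where \<epsilon>: "\<epsilon> > 0" "\<And>s. dist s t < \<epsilon> \<Longrightarrow> \<phi> j s y \<in> U"
    using assms(1,2) unfolding continuous_at_open
    by (metis (no_types, lifting) open_dist)
  \<comment> \<open>Only times from t on are used, so that t = 0 is covered; the trajectory stays in
    \<open>U\<close> up to time t + \<epsilon> / 2.\<close>
  let ?c = "\<Lambda> * exp (- (\<Lambda> * (t + \<epsilon> / 2)))"
  have "ennreal ?c * (\<integral>\<^sup>+\<tau>. indicator {t..t + \<epsilon> / 2} \<tau> * indicator U (\<phi> j (\<tau> + 0) y) \<partial>lborel) \<le> T j (indicator U) y"
    using assms by (intro T_ge_interval) auto
  moreover have "(\<integral>\<^sup>+\<tau>. indicator {t..t + \<epsilon> / 2} \<tau> * indicator U (\<phi> j (\<tau> + 0) y) \<partial>lborel) = (\<integral>\<^sup>+\<tau>. indicator {t..t + \<epsilon> / 2} \<tau> \<partial>lborel)"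
    using \<epsilon> by (intro nn_integral_cong) (auto simp: indicator_def dist_real_def)
  ultimately have "ennreal ?c * ennreal (\<epsilon> / 2) \<le> T j (indicator U) y"
    using \<epsilon>(1) by simp
  moreover have "0 < ennreal ?c * ennreal (\<epsilon> / 2)"
    using Lambda_pos \<epsilon>(1) by (simp add: ennreal_zero_less_mult_iff)
  ultimately show ?thesis by (rule order.strict_trans2[rotated])
qed

lemma K_pow_indicator_pos:
  assumes "\<forall>(j, t)\<in>set p. 0 \<le> t" "open U" "endpoint x p \<in> U"
  shows "0 < (K ^^ length p) (\<lambda>_. indicator U) i x"
  using assms
proof (induction p arbitrary: U)
  case (Cons jt p)
  obtain j t where jt: "jt = (j, t)" by force
  have [measurable]: "U \<in> sets borel" using Cons.prems by simp
  have pos: "0 < T j (indicator U) (endpoint x p)"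
    using Cons.prems by (intro T_indicator_pos) (auto simp: jt)
  then obtain a where a: "0 < a" "a < T j (indicator U) (endpoint x p)" using dense by blast
  \<comment> \<open>Semicontinuity makes this superlevel set open, so it can replace
    \<open>U\<close> as the target of the shorter path.\<close>
  define U' where "U' = {z. a < T j (indicator U) z}"
  have "open U'" using lsc_T[OF lsc_indicator[OF Cons.prems(2)]] by (simp add: lsc_def U'_def)
  then have [measurable]: "U' \<in> sets borel" by simp
  have "0 < (K ^^ length p) (\<lambda>_. indicator U') i x"
    using Cons.prems \<open>open U'\<close> a by (intro Cons.IH) (auto simp: U'_def)
  then have "0 < ennreal pmin * a * (K ^^ length p) (\<lambda>_. indicator U') i x"
    using pmin_pos a by (simp add: ennreal_zero_less_mult_iff)
  also have "\<dots> = (K ^^ length p) (\<lambda>_ z. ennreal pmin * a * indicator U' z) i x"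
    by (subst K_pow_cmult) auto
  also have "\<dots> \<le> (K ^^ length p) (K (\<lambda>_. indicator U)) i x"
  proof (rule K_pow_mono)
    fix k z
    have "ennreal pmin * a * indicator U' z \<le> ennreal pmin * T j (indicator U) z"
      by (auto simp: U'_def indicator_def mult.assoc intro!: mult_left_mono)
    also have "\<dots> \<le> K (\<lambda>_. indicator U) k z" by (rule K_ge_T)
    finally show "ennreal pmin * a * indicator U' z \<le> K (\<lambda>_. indicator U) k z" .
  qed
  finally show ?case by (simp add: funpow_swap1)
qed simp

lemma composite_flow_eq_endpoint: "composite_flow \<phi> x its = endpoint x (rev its)"
proof -
  have "foldr (\<lambda>(i, t) y. \<phi> i t y) p x = endpoint x p" for p
    by (induction p) auto
  from this[of "rev its"] show ?thesis by (simp add: composite_flow_def foldr_conv_fold)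
qed

lemma accessible_K_pow_pos:
  assumes "accessible \<phi> M z" "x \<in> M" "open U" "z \<in> U"
  shows "\<exists>k. 0 < (K ^^ k) (\<lambda>_. indicator U) i x"
proof -
  obtain its where "\<forall>(i, t)\<in>set its. 0 \<le> t" "composite_flow \<phi> x its \<in> U"
    using assms unfolding accessible_def by metis
  then show ?thesis
    using K_pow_indicator_pos[of "rev its" U x i] assms(3) by (auto simp: composite_flow_eq_endpoint)
qed

end

section \<open>Maximal lower semicontinuous minorants\<close>

lemma nn_integral_measure_add:
  assumes f: "f \<in> borel_measurable M"
    and sets: "sets N1 = sets M" "sets N2 = sets M"
    and add: "\<And>A. A \<in> sets M \<Longrightarrow> emeasure M A = emeasure N1 A + emeasure N2 A"
  shows "(\<integral>\<^sup>+x. f x \<partial>M) = (\<integral>\<^sup>+x. f x \<partial>N1) + (\<integral>\<^sup>+x. f x \<partial>N2)"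
  using f
proof (induction rule: borel_measurable_induct)
  case (cong f g)
  have sp: "space N1 = space M" "space N2 = space M" using sets by (auto dest: sets_eq_imp_space_eq)
  have "integral\<^sup>N L f = integral\<^sup>N L g" if "space L = space M" for L
    using cong(3) that by (intro nn_integral_cong) auto
  with cong(4) sp show ?case by simp
next
  case (set A)
  then show ?case using sets add by simp
next
  case (mult u c)
  then have "u \<in> borel_measurable N1" "u \<in> borel_measurable N2"
    using sets measurable_cong_sets by blast+
  with mult show ?case by (simp add: nn_integral_cmult distrib_left)
next
  case (add u v)
  then have "u \<in> borel_measurable N1" "u \<in> borel_measurable N2" "v \<in> borel_measurable N1" "v \<in> borel_measurable N2"
    using sets measurable_cong_sets by blast+
  with add show ?case by (simp add: nn_integral_add ac_simps)
next
  case (seq U)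
  then have m: "\<And>i. U i \<in> borel_measurable N1" "\<And>i. U i \<in> borel_measurable N2"
    using sets measurable_cong_sets by blast+
  have "(\<integral>\<^sup>+x. (SUP i. U i x) \<partial>M) = (SUP i. \<integral>\<^sup>+x. U i x \<partial>M)"
    using seq by (intro nn_integral_monotone_convergence_SUP) auto
  also have "\<dots> = (SUP i. (\<integral>\<^sup>+x. U i x \<partial>N1) + (\<integral>\<^sup>+x. U i x \<partial>N2))"
    using seq by simp
  also have "\<dots> = (SUP i. \<integral>\<^sup>+x. U i x \<partial>N1) + (SUP i. \<integral>\<^sup>+x. U i x \<partial>N2)"
    using seq(3) by (intro ennreal_SUP_add) (auto simp: incseq_def le_fun_def intro!: nn_integral_mono)
  also have "\<dots> = (\<integral>\<^sup>+x. (SUP i. U i x) \<partial>N1) + (\<integral>\<^sup>+x. (SUP i. U i x) \<partial>N2)"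
    using seq m by (subst (1 2) nn_integral_monotone_convergence_SUP) auto
  finally show ?case by (simp add: SUP_apply[abs_def])
qed

text \<open>Domination is tested on Borel sets, so that it makes sense for measures without a choice
  of densities.\<close>

definition lsc_minorants :: "('n::finite \<Rightarrow> 'a::euclidean_space measure) \<Rightarrow> ('n \<Rightarrow> 'a \<Rightarrow> ennreal) set" where
  "lsc_minorants \<mu> = {g. (\<forall>i. lsc (g i)) \<and>
     (\<forall>i. \<forall>A\<in>sets borel. (\<integral>\<^sup>+x. g i x * indicator A x \<partial>lborel) \<le> emeasure (\<mu> i) A)}"

text \<open>A Borel set is split according to which of the two functions is larger. Closure under
  maxima is what makes a maximizing sequence monotone.\<close>

lemma lsc_minorants_max:
  assumes sets: "\<And>i. sets (\<mu> i) = sets borel" and "f \<in> lsc_minorants \<mu>" "g \<in> lsc_minorants \<mu>"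
  shows "(\<lambda>i x. max (f i x) (g i x)) \<in> lsc_minorants \<mu>"
proof -
  have fg: "\<And>i. lsc (f i)" "\<And>i. lsc (g i)"
    "\<And>i A. A \<in> sets borel \<Longrightarrow> (\<integral>\<^sup>+x. f i x * indicator A x \<partial>lborel) \<le> emeasure (\<mu> i) A"
    "\<And>i A. A \<in> sets borel \<Longrightarrow> (\<integral>\<^sup>+x. g i x * indicator A x \<partial>lborel) \<le> emeasure (\<mu> i) A"
    using assms by (auto simp: lsc_minorants_def)
  note [measurable] = lsc_borel_measurable[OF fg(1)] lsc_borel_measurable[OF fg(2)]
  have "(\<integral>\<^sup>+x. max (f i x) (g i x) * indicator A x \<partial>lborel) \<le> emeasure (\<mu> i) A" if [measurable]: "A \<in> sets borel" for i A
  proof -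
    let ?A = "A \<inter> {x. g i x \<le> f i x}" and ?B = "A \<inter> {x. f i x < g i x}"
    have AB[measurable]: "?A \<in> sets borel" "?B \<in> sets borel" by measurable
    have "(\<integral>\<^sup>+x. max (f i x) (g i x) * indicator A x \<partial>lborel)
      = (\<integral>\<^sup>+x. f i x * indicator ?A x + g i x * indicator ?B x \<partial>lborel)"
      by (intro nn_integral_cong) (auto simp: indicator_def max_def)
    also have "\<dots> = (\<integral>\<^sup>+x. f i x * indicator ?A x \<partial>lborel) + (\<integral>\<^sup>+x. g i x * indicator ?B x \<partial>lborel)"
      by (rule nn_integral_add) measurable
    also have "\<dots> \<le> emeasure (\<mu> i) ?A + emeasure (\<mu> i) ?B"
      by (intro add_mono fg AB)
    also have "\<dots> = emeasure (\<mu> i) (?A \<union> ?B)"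
      using AB sets by (intro plus_emeasure) auto
    also have "?A \<union> ?B = A" by auto
    finally show ?thesis .
  qed
  then show ?thesis using fg by (auto simp: lsc_minorants_def intro: lsc_max)
qed

lemma ex_maximal_lsc_minorant:
  fixes \<mu> :: "'n::finite \<Rightarrow> 'a::euclidean_space measure"
  assumes sets: "\<And>i. sets (\<mu> i) = sets borel"
  shows "\<exists>G\<in>lsc_minorants \<mu>. \<forall>g\<in>lsc_minorants \<mu>. (\<Sum>i\<in>UNIV. \<integral>\<^sup>+x. g i x \<partial>lborel) \<le> (\<Sum>i\<in>UNIV. \<integral>\<^sup>+x. G i x \<partial>lborel)"
proof -
  let ?mass = "\<lambda>g. \<Sum>i\<in>UNIV. \<integral>\<^sup>+x. g i x \<partial>lborel"
  have "(\<lambda>_ _. 0) \<in> lsc_minorants \<mu>" by (auto simp: lsc_minorants_def lsc_0)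
  then have "?mass ` lsc_minorants \<mu> \<noteq> {}" by blast
  from ennreal_Sup_countable_SUP[OF this] obtain f where f: "incseq f" "range f \<subseteq> ?mass ` lsc_minorants \<mu>"
    "Sup (?mass ` lsc_minorants \<mu>) = (SUP n. f n)" by auto
  then have "\<forall>n. \<exists>g. g \<in> lsc_minorants \<mu> \<and> f n = ?mass g" by blast
  from choice[OF this] obtain gs where gs: "\<And>n. gs n \<in> lsc_minorants \<mu>" "\<And>n. f n = ?mass (gs n)" by blast
  \<comment> \<open>Running maxima of a maximizing sequence: they increase, so monotone convergence
    passes the domination on to their supremum, which is again lower semicontinuous.\<close>
  define H where "H = rec_nat (gs 0) (\<lambda>n h i x. max (h i x) (gs (Suc n) i x))"
  have H_0: "H 0 = gs 0" and H_Suc: "H (Suc n) = (\<lambda>i x. max (H n i x) (gs (Suc n) i x))" for n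
    by (simp_all add: H_def)
  have H: "H n \<in> lsc_minorants \<mu>" for n
    by (induction n) (simp_all add: H_0 H_Suc gs lsc_minorants_max[of \<mu>, OF sets])
  have H_ge: "gs n i x \<le> H n i x" for n i x
    by (cases n) (auto simp: H_0 H_Suc)
  have H_mono: "incseq (\<lambda>n. H n i x)" for i x
    by (rule incseq_SucI) (simp add: H_Suc)
  have H_lsc: "lsc (H n i)" for n i using H[of n] by (simp add: lsc_minorants_def)
  note [measurable] = lsc_borel_measurable[OF H_lsc]
  define G where "G i x = (SUP n. H n i x)" for i x
  have G_ge: "H n i x \<le> G i x" for n i x unfolding G_def by (rule SUP_upper) simp
  have "(\<integral>\<^sup>+x. G i x * indicator A x \<partial>lborel) \<le> emeasure (\<mu> i) A" if [measurable]: "A \<in> sets borel" for i A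
  proof -
    have "(\<integral>\<^sup>+x. G i x * indicator A x \<partial>lborel) = (\<integral>\<^sup>+x. (SUP n. H n i x * indicator A x) \<partial>lborel)"
      by (intro nn_integral_cong) (simp add: G_def SUP_mult_right_ennreal)
    also have "\<dots> = (SUP n. \<integral>\<^sup>+x. H n i x * indicator A x \<partial>lborel)"
    proof (rule nn_integral_monotone_convergence_SUP)
      show "incseq (\<lambda>n x. H n i x * indicator A x)"
        using H_mono by (auto simp: incseq_def le_fun_def intro!: mult_right_mono)
    qed measurable
    also have "\<dots> \<le> emeasure (\<mu> i) A"
      using H that by (intro SUP_least) (auto simp: lsc_minorants_def)
    finally show ?thesis .
  qed
  then have G: "G \<in> lsc_minorants \<mu>"
    unfolding lsc_minorants_def G_def[abs_def] using H_lsc by (auto intro: lsc_SUP)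
  have "?mass g \<le> ?mass G" if "g \<in> lsc_minorants \<mu>" for g
  proof -
    have "?mass g \<le> (SUP n. f n)" unfolding f(3)[symmetric] using that by (intro Sup_upper) auto
    also have "\<dots> \<le> ?mass G"
      unfolding gs(2) using H_ge G_ge
      by (intro SUP_least sum_mono nn_integral_mono) (meson order_trans)
    finally show ?thesis .
  qed
  with G show ?thesis by blast
qed

section \<open>The excess over the maximal minorant vanishes\<close>

context switching begin

lemma invariant_imp_lsc_density:
  fixes \<pi> :: "'n \<Rightarrow> (real^'d) measure"
  assumes smooth: "\<And>i. smooth (v i)" and acc: "accessible \<phi> M z" and wH: "weak_Hormander v z"
    and sets: "\<And>i. sets (\<pi> i) = sets borel" and fin: "\<And>i. emeasure (\<pi> i) UNIV \<noteq> \<infinity>"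
    and supp: "\<And>i. AE x in \<pi> i. x \<in> M"
    and inv: "\<And>h. (\<And>i. h i \<in> borel_measurable borel) \<Longrightarrow>
      (\<Sum>i\<in>UNIV. \<integral>\<^sup>+x. K h i x \<partial>\<pi> i) = (\<Sum>i\<in>UNIV. \<integral>\<^sup>+x. h i x \<partial>\<pi> i)"
  shows "\<exists>g. (\<forall>i. lsc (g i)) \<and> (\<forall>i. \<pi> i = density lborel (g i))"
proof -
  let ?mass = "\<lambda>g. \<Sum>i\<in>UNIV. \<integral>\<^sup>+x. g i x \<partial>lborel"
  have sp: "space (\<pi> i) = UNIV" for i using sets_eq_imp_space_eq[OF sets] by simp
  obtain G where G: "G \<in> lsc_minorants \<pi>" and G_max: "\<And>g. g \<in> lsc_minorants \<pi> \<Longrightarrow> ?mass g \<le> ?mass G"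
    using ex_maximal_lsc_minorant[of \<pi>, OF sets] by blast
  have G_lsc: "lsc (G i)" for i using G by (simp add: lsc_minorants_def)
  note G_meas[measurable] = lsc_borel_measurable[OF G_lsc]
  have G_le: "(\<integral>\<^sup>+x. G i x * indicator A x \<partial>lborel) \<le> emeasure (\<pi> i) A" if "A \<in> sets borel" for i A
    using G that by (simp add: lsc_minorants_def)
  define \<mu> where "\<mu> i = density lborel (G i)" for i
  have \<mu>_le: "emeasure (\<mu> i) A \<le> emeasure (\<pi> i) A" if "A \<in> sets (\<pi> i)" for i A
    using G_le[of A i] that by (simp add: \<mu>_def emeasure_density sets)
  have fin_\<pi>: "finite_measure (\<pi> i)" for i using fin sp by (intro finite_measureI) simp
  have fin_\<mu>: "finite_measure (\<mu> i)" for i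
    using \<mu>_le[of UNIV i] fin[of i] sets by (intro finite_measureI) (auto simp: \<mu>_def top_unique)
  \<comment> \<open>The excess; finiteness of both measures makes setwise subtraction a
    measure.\<close>
  define r where "r i = diff_measure (\<pi> i) (\<mu> i)" for i
  have r_sets: "sets (r i) = sets borel" for i by (simp add: r_def sets)
  have \<pi>_split: "emeasure (\<pi> i) A = emeasure (\<mu> i) A + emeasure (r i) A" if "A \<in> sets borel" for i A
  proof -
    have "emeasure (r i) A = emeasure (\<pi> i) A - emeasure (\<mu> i) A"
      unfolding r_def using that sets \<mu>_le fin_\<pi> fin_\<mu>
      by (intro emeasure_diff_measure) (auto simp: \<mu>_def)
    then show ?thesis using \<mu>_le[of A i] that sets by (simp add: add_diff_inverse_ennreal)
  qed
  have int_split: "(\<integral>\<^sup>+x. h x \<partial>\<pi> i) = (\<integral>\<^sup>+x. G i x * h x \<partial>lborel) + (\<integral>\<^sup>+x. h x \<partial>r i)"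
    if h: "h \<in> borel_measurable borel" for h i
  proof -
    have "(\<integral>\<^sup>+x. h x \<partial>\<pi> i) = (\<integral>\<^sup>+x. h x \<partial>\<mu> i) + (\<integral>\<^sup>+x. h x \<partial>r i)"
      using h \<pi>_split sets r_sets by (intro nn_integral_measure_add) (auto simp: \<mu>_def measurable_cong_sets[OF sets refl])
    then show ?thesis using h by (simp add: \<mu>_def nn_integral_density)
  qed
  have inv_pow: "(\<Sum>i\<in>UNIV. \<integral>\<^sup>+x. (K ^^ m) h i x \<partial>\<pi> i) = (\<Sum>i\<in>UNIV. \<integral>\<^sup>+x. h i x \<partial>\<pi> i)"
    if "\<And>i. h i \<in> borel_measurable borel" for m h
    using that by (induction m) (simp_all add: inv measurable_K_pow)
  have mass_fin: "?mass G \<noteq> \<infinity>"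
  proof -
    have "(\<integral>\<^sup>+x. G i x \<partial>lborel) \<noteq> \<infinity>" for i
      using G_le[of UNIV i] fin[of i] by (auto simp: top_unique)
    then show ?thesis by simp
  qed
  obtain m \<rho> V c j0 where "0 < \<rho>" "open V" "V \<noteq> {}" "0 < c" and doeb:
    "\<And>h x i. (\<And>j. h j \<in> borel_measurable borel) \<Longrightarrow> norm (x - z) < \<rho> \<Longrightarrow>
      ennreal c * (\<integral>\<^sup>+y. h j0 y * indicator V y \<partial>lborel) \<le> (K ^^ m) h i x"
    using doeblin[OF smooth wH] by blast
  define U where "U = ball z \<rho>"
  have U: "open U" "z \<in> U" using \<open>0 < \<rho>\<close> by (auto simp: U_def)
  have [measurable]: "U \<in> sets borel" "V \<in> sets borel" using U \<open>open V\<close> by auto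
  have K_U_meas: "(K ^^ k) (\<lambda>_. indicator U) i \<in> borel_measurable borel" for k i
    by (intro measurable_K_pow) simp
  \<comment> \<open>The mass that the excess sends into \<open>U\<close> in k steps. A positive
    value would produce a minorant with more mass than \<open>G\<close>.\<close>
  define \<eta> where "\<eta> k = (\<Sum>i\<in>UNIV. \<integral>\<^sup>+x. (K ^^ k) (\<lambda>_. indicator U) i x \<partial>r i)" for k
  have \<eta>_0: "\<eta> k = 0" for k
  proof (rule ccontr)
    assume "\<eta> k \<noteq> 0"
    have "\<eta> k \<le> (\<Sum>i\<in>UNIV. \<integral>\<^sup>+x. (K ^^ k) (\<lambda>_. indicator U) i x \<partial>\<pi> i)"
      unfolding \<eta>_def using int_split[OF K_U_meas] by (intro sum_mono) simp
    also have "\<dots> = (\<Sum>i\<in>UNIV. emeasure (\<pi> i) U)"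
      using sets by (subst inv_pow) simp_all
    also have "\<dots> < \<infinity>"
      using fin_\<pi> by (simp add: finite_measure.emeasure_finite less_top[symmetric])
    finally obtain R where R: "\<eta> k = ennreal R" "0 \<le> R" by (cases "\<eta> k") auto
    with \<open>\<eta> k \<noteq> 0\<close> have "R > 0" by (simp add: less_le)
    define N where "N = k + m"
    \<comment> \<open>After N steps \<open>G\<close> has become its transposed image, while the
      excess contributes c * R times Lebesgue measure on \<open>V\<close> in copy \<open>j0\<close>:
      k steps lead to \<open>U\<close>, and from there m steps give the bound of
      \<open>doeblin\<close>.\<close>
    define g where "g j y = (dual ^^ N) G j y + ennreal (c * R) * (if j = j0 then indicator V y else 0)" for j y
    have dual_meas[measurable]: "(dual ^^ N) G j \<in> borel_measurable borel" for j
      by (intro lsc_borel_measurable lsc_dual_pow G_lsc)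
    have key: "(\<Sum>j\<in>UNIV. \<integral>\<^sup>+y. (dual ^^ N) G j y * h j y \<partial>lborel) + ennreal (c * R) * (\<integral>\<^sup>+y. h j0 y * indicator V y \<partial>lborel)
        \<le> (\<Sum>i\<in>UNIV. \<integral>\<^sup>+x. h i x \<partial>\<pi> i)" if h: "\<And>j. h j \<in> borel_measurable borel" for h
    proof -
      let ?I = "\<integral>\<^sup>+y. h j0 y * indicator V y \<partial>lborel"
      have "ennreal c * ?I * (K ^^ k) (\<lambda>_. indicator U) i x \<le> (K ^^ N) h i x" for i x
      proof -
        have "ennreal c * ?I * (K ^^ k) (\<lambda>_. indicator U) i x = (K ^^ k) (\<lambda>_ x. ennreal c * ?I * indicator U x) i x"
          by (subst K_pow_cmult) auto
        also have "\<dots> \<le> (K ^^ k) ((K ^^ m) h) i x"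
          using doeb[OF h] by (intro K_pow_mono) (auto simp: indicator_def U_def dist_norm norm_minus_commute)
        finally show ?thesis by (simp add: N_def funpow_add)
      qed
      then have "(\<Sum>i\<in>UNIV. \<integral>\<^sup>+x. ennreal c * ?I * (K ^^ k) (\<lambda>_. indicator U) i x \<partial>r i) \<le> (\<Sum>i\<in>UNIV. \<integral>\<^sup>+x. (K ^^ N) h i x \<partial>r i)"
        by (intro sum_mono nn_integral_mono)
      moreover have "(\<Sum>i\<in>UNIV. \<integral>\<^sup>+x. ennreal c * ?I * (K ^^ k) (\<lambda>_. indicator U) i x \<partial>r i) = ennreal c * ?I * \<eta> k"
        unfolding \<eta>_def sum_distrib_left using K_U_meas
        by (intro sum.cong refl nn_integral_cmult) (simp add: measurable_cong_sets[OF r_sets refl])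
      moreover have "ennreal c * ?I * \<eta> k = ennreal (c * R) * ?I"
        using R \<open>0 < c\<close> by (simp add: ennreal_mult mult_ac)
      ultimately have 1: "ennreal (c * R) * ?I \<le> (\<Sum>i\<in>UNIV. \<integral>\<^sup>+x. (K ^^ N) h i x \<partial>r i)" by simp
      have "(\<Sum>i\<in>UNIV. \<integral>\<^sup>+x. h i x \<partial>\<pi> i) = (\<Sum>i\<in>UNIV. \<integral>\<^sup>+x. (K ^^ N) h i x \<partial>\<pi> i)"
        using inv_pow[OF h] by simp
      also have "\<dots> = (\<Sum>i\<in>UNIV. \<integral>\<^sup>+x. G i x * (K ^^ N) h i x \<partial>lborel) + (\<Sum>i\<in>UNIV. \<integral>\<^sup>+x. (K ^^ N) h i x \<partial>r i)"
        using h by (simp add: int_split measurable_K_pow sum.distrib)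
      also have "(\<Sum>i\<in>UNIV. \<integral>\<^sup>+x. G i x * (K ^^ N) h i x \<partial>lborel) = (\<Sum>j\<in>UNIV. \<integral>\<^sup>+y. (dual ^^ N) G j y * h j y \<partial>lborel)"
        by (intro nn_integral_K_pow_duality G_lsc h)
      finally show ?thesis using 1 by (simp add: add_left_mono)
    qed
    have g_int: "(\<integral>\<^sup>+y. g j y * h y \<partial>lborel) = (\<integral>\<^sup>+y. (dual ^^ N) G j y * h y \<partial>lborel)
        + (if j = j0 then ennreal (c * R) * (\<integral>\<^sup>+y. h y * indicator V y \<partial>lborel) else 0)"
      if [measurable]: "h \<in> borel_measurable borel" for h j
      unfolding g_def distrib_right
      by (subst nn_integral_add) (auto simp: nn_integral_cmult[symmetric] mult_ac)
    have "g \<in> lsc_minorants \<pi>"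
      unfolding lsc_minorants_def
    proof (intro CollectI conjI allI ballI)
      show "lsc (g j)" for j
        unfolding g_def using \<open>open V\<close>
        by (intro lsc_add lsc_dual_pow G_lsc lsc_cmult) (cases "j = j0", auto intro: lsc_indicator lsc_0)
      fix j A assume A[measurable]: "A \<in> sets (borel :: (real^'d) measure)"
      let ?h = "\<lambda>(i :: 'n) (x :: real^'d). if i = j then indicator A x else (0 :: ennreal)"
      have *: "(\<Sum>i\<in>UNIV. \<integral>\<^sup>+y. (dual ^^ N) G i y * ?h i y \<partial>lborel) = (\<integral>\<^sup>+y. (dual ^^ N) G j y * indicator A y \<partial>lborel)"
        by (subst sum.remove[of _ j]) (auto intro!: sum.neutral)
      have **: "(\<Sum>i\<in>UNIV. \<integral>\<^sup>+y. ?h i y \<partial>\<pi> i) = emeasure (\<pi> j) A"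
        using sets by (subst sum.remove[of _ j]) (auto intro!: sum.neutral)
      show "(\<integral>\<^sup>+y. g j y * indicator A y \<partial>lborel) \<le> emeasure (\<pi> j) A"
        using key[of ?h] unfolding * ** by (cases "j = j0") (auto simp: g_int)
    qed
    then have "?mass g \<le> ?mass G" by (rule G_max)
    \<comment> \<open>Duality against the constant 1, which \<open>K\<close> fixes, shows that the
      transposed image of \<open>G\<close> has the mass of \<open>G\<close>; the whole gain comes
      from \<open>V\<close>.\<close>
    moreover have "?mass g = ?mass G + ennreal (c * R) * emeasure lborel V"
    proof -
      have "?mass g = (\<Sum>j\<in>UNIV. \<integral>\<^sup>+y. g j y * 1 \<partial>lborel)" by simp
      also have "\<dots> = (\<Sum>j\<in>UNIV. \<integral>\<^sup>+y. (dual ^^ N) G j y * (\<lambda>_ _. 1) j y \<partial>lborel) + ennreal (c * R) * emeasure lborel V"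
        by (subst g_int) (simp_all add: sum.distrib)
      also have "(\<Sum>j\<in>UNIV. \<integral>\<^sup>+y. (dual ^^ N) G j y * (\<lambda>_ _. 1) j y \<partial>lborel) = (\<Sum>i\<in>UNIV. \<integral>\<^sup>+x. G i x * (K ^^ N) (\<lambda>_ _. 1) i x \<partial>lborel)"
        by (intro nn_integral_K_pow_duality[symmetric] G_lsc) simp
      finally show ?thesis by (simp add: K_pow_1)
    qed
    ultimately have "?mass G + ennreal (c * R) * emeasure lborel V \<le> ?mass G + 0" by simp
    then have "ennreal (c * R) * emeasure lborel V = 0"
      using mass_fin by (simp only: ennreal_add_left_cancel_le) auto
    moreover have "emeasure lborel V \<noteq> 0"
      using \<open>open V\<close> \<open>V \<noteq> {}\<close> open_not_negligible[of V]
      by (auto simp: negligible_iff_null_sets null_sets_def)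
    ultimately show False using \<open>R > 0\<close> \<open>0 < c\<close> by (simp add: ennreal_eq_0_iff mult_le_0_iff)
  qed
  have "emeasure (r i) UNIV = 0" for i
  proof -
    have sp_r: "space (r i) = UNIV" using sets_eq_imp_space_eq[OF r_sets] by simp
    have "AE x in r i. (K ^^ k) (\<lambda>_. indicator U) i x = 0" for k
    proof -
      have "(\<integral>\<^sup>+x. (K ^^ k) (\<lambda>_. indicator U) i x \<partial>r i) = 0"
        using \<eta>_0[of k] by (simp add: \<eta>_def)
      then show ?thesis
        using K_U_meas[of k i] by (simp add: nn_integral_0_iff_AE measurable_cong_sets[OF r_sets refl])
    qed
    then have 1: "AE x in r i. \<forall>k. (K ^^ k) (\<lambda>_. indicator U) i x = 0" by (simp add: AE_all_countable)
    have 2: "AE x in r i. x \<in> M"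
    proof -
      from supp[of i] obtain A where A: "{x \<in> space (\<pi> i). x \<notin> M} \<subseteq> A" "emeasure (\<pi> i) A = 0" "A \<in> sets (\<pi> i)"
        by (rule AE_E)
      then have "emeasure (r i) A = 0" using \<pi>_split[of A i] sets by simp
      then show ?thesis using A sp sets r_sets by (intro AE_I[of _ _ A]) (auto simp: sp_r)
    qed
    \<comment> \<open>For the excess, almost every point lies in \<open>M\<close> and hence reaches
      \<open>U\<close> with positive weight in some number of steps, whereas all these weights
      vanish almost everywhere.\<close>
    have "AE x in r i. False"
      using 1 2
    proof eventually_elim
      case (elim x)
      obtain k where "0 < (K ^^ k) (\<lambda>_. indicator U) i x"
        using accessible_K_pow_pos[OF acc elim(2) U] by blast
      with elim(1) show ?case by simp
    qed
    then show ?thesis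
      using AE_iff_measurable[of UNIV "r i" "\<lambda>_. False"] by (simp add: sp_r r_sets)
  qed
  then have r0: "emeasure (r i) A = 0" if "A \<in> sets borel" for i A
    using emeasure_mono[of A UNIV "r i"] that r_sets by simp
  have "\<pi> i = density lborel (G i)" for i
  proof (rule measure_eqI)
    fix A assume "A \<in> sets (\<pi> i)"
    then show "emeasure (\<pi> i) A = emeasure (density lborel (G i)) A"
      using \<pi>_split[of A i] r0[of A i] sets by (simp add: \<mu>_def)
  qed (simp add: sets)
  then show ?thesis using G_lsc by blast
qed

end

section \<open>The first-order expansion of the process\<close>

lemma lipschitz_constant_nonneg:
  fixes h :: "'a::euclidean_space \<Rightarrow> real"
  assumes lip: "\<And>x y. \<bar>h x - h y\<bar> \<le> C * norm (x - y)"
  shows "0 \<le> C"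
proof -
  obtain e :: 'a where "e \<in> Basis" by fastforce
  then have "\<bar>h e - h 0\<bar> \<le> C" using lip[of e 0] by simp
  then show ?thesis using abs_ge_zero order_trans by blast
qed

context C1_flows begin

text \<open>Uniqueness of solutions is only needed up to a uniform small time, where it follows from a
  contraction estimate.\<close>

lemma ex_small_time_flow_unique:
  assumes "compact M"
  shows "\<exists>t0>0. \<forall>t i x Y. 0 \<le> t \<longrightarrow> t \<le> t0 \<longrightarrow> (\<forall>s\<in>{0..t}. Y s \<in> M \<and> \<phi> i s x \<in> M) \<longrightarrow>
    (\<forall>u\<in>{0..t}. ((\<lambda>s. v i (Y s)) has_integral (Y u - x)) {0..u}) \<longrightarrow> Y t = \<phi> i t x"
proof -
  obtain R where R: "\<And>x. x \<in> M \<Longrightarrow> norm x \<le> R"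
    using compact_imp_bounded[OF assms] unfolding bounded_iff by blast
  have "\<forall>i. \<exists>L\<ge>0. \<forall>x. norm x \<le> R \<longrightarrow> norm (v' i x) \<le> L" using norm_v'_bounded_on_cball by blast
  then have "\<exists>L. \<forall>i. L i \<ge> 0 \<and> (\<forall>x. norm x \<le> R \<longrightarrow> norm (v' i x) \<le> L i)" by (intro choice)
  then obtain Li where Li: "\<And>i. Li i \<ge> 0" "\<And>i x. norm x \<le> R \<Longrightarrow> norm (v' i x) \<le> Li i" by blast
  define L where "L = (\<Sum>i\<in>UNIV. Li i)"
  have Li_le: "Li i \<le> L" for i unfolding L_def using Li(1) by (intro member_le_sum) auto
  have v'_le: "norm (v' i x) \<le> L" if "norm x \<le> R" for i x
    using Li(2)[OF that, of i] Li_le[of i] by linarith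
  have L: "L \<ge> 0" using Li_le Li(1) order_trans by blast
  \<comment> \<open>L bounds the derivatives of all fields on a ball containing \<open>M\<close>, so
    up to this time L * t is at most 1/2, independently of the index and of the solution.\<close>
  define t0 where "t0 = 1 / (2 * (L + 1))"
  have "Y t = \<phi> i t x"
    if t: "0 \<le> t" "t \<le> t0" and M: "\<forall>s\<in>{0..t}. Y s \<in> M \<and> \<phi> i s x \<in> M"
      and Y: "\<forall>u\<in>{0..t}. ((\<lambda>s. v i (Y s)) has_integral (Y u - x)) {0..u}" for t i x Y
  proof -
    define d where "d u = norm (Y u - \<phi> i u x)" for u
    have bdd: "d u \<le> 2 * R" if "u \<in> {0..t}" for u
      using R[of "Y u"] R[of "\<phi> i u x"] M that norm_triangle_ineq4[of "Y u" "\<phi> i u x"]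
      unfolding d_def by fastforce
    \<comment> \<open>The supremal distance between the two curves turns out to be at most half of
      itself, hence 0.\<close>
    define m where "m = (SUP u\<in>{0..t}. d u)"
    have d_le: "d u \<le> m" if "u \<in> {0..t}" for u
      unfolding m_def using that bdd by (intro cSUP_upper bdd_aboveI2[of _ _ "2 * R"]) auto
    have m0: "0 \<le> m" using d_le[of 0] t by (auto simp: d_def intro: order_trans[OF norm_ge_zero])
    have "d u \<le> 1 / 2 * m" if u: "u \<in> {0..t}" for u
    proof -
      have "((\<lambda>s. v i (\<phi> i s x)) has_integral (\<phi> i u x - \<phi> i 0 x)) {0..u}"
        using u by (intro fundamental_theorem_of_calculus)
          (auto intro: has_vector_derivative_at_within phi_deriv)
      then have int: "((\<lambda>s. v i (Y s) - v i (\<phi> i s x)) has_integral ((Y u - x) - (\<phi> i u x - x))) {0..u}"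
        using Y u by (intro has_integral_diff) auto
      have "norm ((Y u - x) - (\<phi> i u x - x)) \<le> (L * m) * measure lborel (cbox 0 u)"
      proof (rule has_integral_bound)
        show "((\<lambda>s. v i (Y s) - v i (\<phi> i s x)) has_integral ((Y u - x) - (\<phi> i u x - x))) (cbox 0 u)"
          using int by simp
        fix s assume "s \<in> cbox 0 u"
        then have s: "s \<in> {0..t}" using u by auto
        have "norm (v i (Y s) - v i (\<phi> i s x)) \<le> L * norm (Y s - \<phi> i s x)"
          using R M s v'_le by (intro v_lipschitz_on_cball[of R i L]) auto
        also have "\<dots> \<le> L * m" using d_le[OF s] L by (simp add: d_def mult_left_mono)
        finally show "norm (v i (Y s) - v i (\<phi> i s x)) \<le> L * m" .
      qed (use L m0 in simp)
      also have "\<dots> = (L * u) * m" using u by simp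
      also have "\<dots> \<le> 1 / 2 * m"
      proof (rule mult_right_mono[OF _ m0])
        have "L * u \<le> (L + 1) * t0" using L u t by (intro mult_mono) auto
        also have "\<dots> = 1 / 2" using L by (simp add: t0_def)
        finally show "L * u \<le> 1 / 2" .
      qed
      finally show ?thesis by (simp add: d_def)
    qed
    then have "m \<le> 1 / 2 * m" unfolding m_def using t by (intro cSUP_least) auto
    then have "m = 0" using m0 by simp
    then show ?thesis using d_le[of t] t by (simp add: d_def)
  qed
  moreover have "t0 > 0" using L by (simp add: t0_def)
  ultimately show ?thesis by blast
qed

text \<open>Normalized so that constants are fixed. It supplies test functions: for continuous
  bounded \<open>h\<close> it is differentiable along the flow of \<open>v j\<close>, with
  derivative l times the difference of the resolvent and \<open>h\<close>.\<close>

definition resolvent :: "real \<Rightarrow> 'n \<Rightarrow> ('a \<Rightarrow> real) \<Rightarrow> 'a \<Rightarrow> real" where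
  "resolvent l j h x = (\<integral>t. exponential_density l t * h (\<phi> j t x) \<partial>lborel)"

lemma integrable_exponential_density:
  assumes "0 < l"
  shows "integrable lborel (exponential_density l)" "integral\<^sup>L lborel (exponential_density l) = 1"
proof -
  have nn: "(\<integral>\<^sup>+t. ennreal (exponential_density l t) \<partial>lborel) = 1"
    using prob_space.emeasure_space_1[OF prob_space_exponential_density[OF assms]]
    by (simp add: emeasure_density)
  have nonneg: "0 \<le> exponential_density l t" for t
    using assms by (simp add: exponential_density_def)
  show "integrable lborel (exponential_density l)"
    using nn nonneg by (intro integrableI_nonneg) auto
  show "integral\<^sup>L lborel (exponential_density l) = 1"
    using nn nonneg by (simp add: integral_eq_nn_integral)
qed

lemma exponential_density_ge_0: "0 < l \<Longrightarrow> 0 \<le> exponential_density l t"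
  by (simp add: exponential_density_def)

lemma integrable_exponential_mult:
  assumes "0 < l" "g \<in> borel_measurable lborel" "\<And>t. \<bar>g t\<bar> \<le> C"
  shows "integrable lborel (\<lambda>t. exponential_density l t * g t)"
proof (rule Bochner_Integration.integrable_bound)
  show "integrable lborel (\<lambda>t. exponential_density l t * C)"
    using integrable_exponential_density[OF assms(1)] by simp
  have "\<bar>exponential_density l t * g t\<bar> \<le> \<bar>exponential_density l t * C\<bar>" for t
    using exponential_density_ge_0[OF assms(1), of t] assms(3)[of t]
    by (simp add: abs_mult mult_left_mono)
  then show "AE t in lborel. norm (exponential_density l t * g t) \<le> norm (exponential_density l t * C)"
    by simp
qed (use assms(2) in measurable)

context
  fixes l :: real and j :: 'n and h :: "'a \<Rightarrow> real"
  assumes l: "0 < l" and h_cont: "continuous_on UNIV h" and h_bounds: "\<And>x. 0 \<le> h x" "\<And>x. h x \<le> 1"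
begin

lemma measurable_h_phi [measurable]: "(\<lambda>t. h (\<phi> j t x)) \<in> borel_measurable lborel"
  using borel_measurable_continuous_onI[OF h_cont] by measurable

lemma resolvent_integrable: "integrable lborel (\<lambda>t. exponential_density l t * h (\<phi> j t x))"
  using h_bounds by (intro integrable_exponential_mult[OF l, of _ 1]) auto

lemma resolvent_bounds: "0 \<le> resolvent l j h x" "resolvent l j h x \<le> 1"
proof -
  show "0 \<le> resolvent l j h x"
    unfolding resolvent_def using h_bounds exponential_density_ge_0[OF l] by (intro integral_nonneg_AE) auto
  have "resolvent l j h x \<le> integral\<^sup>L lborel (exponential_density l)"
    unfolding resolvent_def using h_bounds exponential_density_ge_0[OF l]
    by (intro integral_mono resolvent_integrable integrable_exponential_density l) (simp add: mult_left_le)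
  then show "resolvent l j h x \<le> 1" using integrable_exponential_density(2)[OF l] by simp
qed

lemma nn_integral_resolvent:
  "(\<integral>\<^sup>+t. ennreal (exponential_density l t) * ennreal (h (\<phi> j t x)) \<partial>lborel) = ennreal (resolvent l j h x)"
  unfolding resolvent_def
  using nn_integral_eq_integral[OF resolvent_integrable] h_bounds exponential_density_ge_0[OF l]
  by (simp add: ennreal_mult)

lemma continuous_resolvent: "continuous_on UNIV (resolvent l j h)"
  unfolding continuous_on_sequentially o_def
proof (intro allI ballI impI)
  fix X :: "nat \<Rightarrow> 'a" and a assume X: "(\<forall>n. X n \<in> UNIV) \<and> X \<longlonglongrightarrow> a"
  show "(\<lambda>n. resolvent l j h (X n)) \<longlonglongrightarrow> resolvent l j h a"
    unfolding resolvent_def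
  proof (rule integral_dominated_convergence)
    show "integrable lborel (exponential_density l)" by (rule integrable_exponential_density[OF l])
    have "(\<lambda>n. h (\<phi> j t (X n))) \<longlonglongrightarrow> h (\<phi> j t a)" for t
      using X by (intro continuous_on_tendsto_compose[OF h_cont] tendsto_intros) auto
    then show "AE t in lborel. (\<lambda>n. exponential_density l t * h (\<phi> j t (X n))) \<longlonglongrightarrow> exponential_density l t * h (\<phi> j t a)"
      by (intro always_eventually allI tendsto_intros)
    show "AE t in lborel. norm (exponential_density l t * h (\<phi> j t (X n))) \<le> exponential_density l t" for n
      using h_bounds exponential_density_ge_0[OF l] by (simp add: mult_left_le)
  qed measurable
qed

text \<open>Lack of memory of the exponential law: shifting time by t removes the part of the
  integral before t and rescales the rest.\<close>

lemma resolvent_flow: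
  assumes "0 \<le> t"
  shows "exp (- (l * t)) * resolvent l j h (\<phi> j t x) =
    resolvent l j h x - (\<integral>u. exponential_density l u * (indicator {0..<t} u * h (\<phi> j u x)) \<partial>lborel)"
proof -
  have int1: "integrable lborel (\<lambda>u. exponential_density l u * (indicator {0..<t} u * h (\<phi> j u x)))"
    using h_bounds by (intro integrable_exponential_mult[OF l, of _ 1]) (auto simp: indicator_def)
  have "exp (- (l * t)) * resolvent l j h (\<phi> j t x) = (\<integral>s. exp (- (l * t)) * (exponential_density l s * h (\<phi> j s (\<phi> j t x))) \<partial>lborel)"
    unfolding resolvent_def by simp
  also have "\<dots> = (\<integral>s. (\<lambda>u. exponential_density l u * h (\<phi> j u x) - exponential_density l u * (indicator {0..<t} u * h (\<phi> j u x))) (t + 1 * s) \<partial>lborel)"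
  proof (intro Bochner_Integration.integral_cong refl)
    fix s
    show "exp (- (l * t)) * (exponential_density l s * h (\<phi> j s (\<phi> j t x))) =
      exponential_density l (t + 1 * s) * h (\<phi> j (t + 1 * s) x) -
      exponential_density l (t + 1 * s) * (indicator {0..<t} (t + 1 * s) * h (\<phi> j (t + 1 * s) x))"
      using assms phi_add[of j s t x]
      by (auto simp: exponential_density_def indicator_def exp_add[symmetric] algebra_simps)
  qed
  also have "\<dots> = (\<integral>u. exponential_density l u * h (\<phi> j u x) - exponential_density l u * (indicator {0..<t} u * h (\<phi> j u x)) \<partial>lborel)"
    using lborel_integral_real_affine[of 1 "\<lambda>u. exponential_density l u * h (\<phi> j u x) - exponential_density l u * (indicator {0..<t} u * h (\<phi> j u x))" t]
    by simp
  also have "\<dots> = resolvent l j h x - (\<integral>u. exponential_density l u * (indicator {0..<t} u * h (\<phi> j u x)) \<partial>lborel)"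
    unfolding resolvent_def by (rule Bochner_Integration.integral_diff[OF resolvent_integrable int1])
  finally show ?thesis .
qed

end

text \<open>Replacing \<open>h\<close> along the trajectory by \<open>h x\<close> costs at most C *
  B * t, on a time interval whose exponential mass is at most l * t.\<close>

lemma resolvent_expansion:
  assumes l: "0 < l" and h: "continuous_on UNIV h" "\<And>x. 0 \<le> h x" "\<And>x. h x \<le> 1"
    and lip: "\<And>x y. \<bar>h x - h y\<bar> \<le> C * norm (x - y)" and t: "0 \<le> t"
  shows "\<bar>exp (- (l * t)) * resolvent l j h (\<phi> j t x) - (resolvent l j h x - (1 - exp (- (l * t))) * h x)\<bar> \<le> C * B * l * t\<^sup>2"
proof -
  let ?e = "exponential_density l"
  have [measurable]: "h \<in> borel_measurable borel" using h(1) by (rule borel_measurable_continuous_onI)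
  have one: "resolvent l j (\<lambda>_. 1) x = 1" for x
    using integrable_exponential_density(2)[OF l] by (simp add: resolvent_def)
  \<comment> \<open>The exponential mass of the interval is \<open>resolvent_flow\<close> for the
    constant function 1.\<close>
  have e1: "(\<integral>u. ?e u * indicator {0..<t} u \<partial>lborel) = 1 - exp (- (l * t))"
    using resolvent_flow[OF l, of "\<lambda>_. 1" t j x] t by (simp add: one)
  have C: "0 \<le> C" by (rule lipschitz_constant_nonneg[OF lip])
  have int1: "integrable lborel (\<lambda>u. ?e u * (indicator {0..<t} u * h (\<phi> j u x)))"
    using h by (intro integrable_exponential_mult[OF l, of _ 1]) (auto simp: indicator_def)
  have int2: "integrable lborel (\<lambda>u. ?e u * indicator {0..<t} u)"
    by (intro integrable_exponential_mult[OF l, of _ 1]) (auto simp: indicator_def)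
  have "exp (- (l * t)) * resolvent l j h (\<phi> j t x) - (resolvent l j h x - (1 - exp (- (l * t))) * h x)
     = (\<integral>u. ?e u * indicator {0..<t} u \<partial>lborel) * h x - (\<integral>u. ?e u * (indicator {0..<t} u * h (\<phi> j u x)) \<partial>lborel)"
    unfolding resolvent_flow[OF l h t] e1 by simp
  also have "\<dots> = (\<integral>u. (?e u * indicator {0..<t} u) * h x - ?e u * (indicator {0..<t} u * h (\<phi> j u x)) \<partial>lborel)"
    using int1 int2 by simp
  finally have eq: "exp (- (l * t)) * resolvent l j h (\<phi> j t x) - (resolvent l j h x - (1 - exp (- (l * t))) * h x) = \<dots>" .
  have "\<bar>\<integral>u. (?e u * indicator {0..<t} u) * h x - ?e u * (indicator {0..<t} u * h (\<phi> j u x)) \<partial>lborel\<bar> \<le> (\<integral>u. (?e u * indicator {0..<t} u) * (C * (B * t)) \<partial>lborel)"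
  proof (rule integral_abs_bound_integral)
    fix u
    have "\<bar>h x - h (\<phi> j u x)\<bar> \<le> C * (B * t)" if "u \<in> {0..<t}"
    proof -
      have "\<bar>h x - h (\<phi> j u x)\<bar> \<le> C * norm (x - \<phi> j u x)" by (rule lip)
      also have "norm (x - \<phi> j u x) \<le> B * u"
        using norm_phi_diff_le[of j 0 x u] that by simp
      also have "B * u \<le> B * t" using that B_nonneg by (intro mult_left_mono) auto
      finally show ?thesis using C by (simp add: mult_left_mono)
    qed
    then show "\<bar>(?e u * indicator {0..<t} u) * h x - ?e u * (indicator {0..<t} u * h (\<phi> j u x))\<bar>
        \<le> (?e u * indicator {0..<t} u) * (C * (B * t))"
    proof (cases "u \<in> {0..<t}")
      case True
      assume "u \<in> {0..<t} \<Longrightarrow> \<bar>h x - h (\<phi> j u x)\<bar> \<le> C * (B * t)"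
      then have "?e u * \<bar>h x - h (\<phi> j u x)\<bar> \<le> ?e u * (C * (B * t))"
        using True exponential_density_ge_0[OF l, of u] by (intro mult_left_mono) auto
      moreover have "\<bar>?e u * h x - ?e u * h (\<phi> j u x)\<bar> = ?e u * \<bar>h x - h (\<phi> j u x)\<bar>"
        using exponential_density_ge_0[OF l, of u] by (simp only: right_diff_distrib[symmetric] abs_mult abs_of_nonneg)
      ultimately show ?thesis using True by simp
    qed simp
  qed (use int1 int2 in auto)
  also have "\<dots> = (1 - exp (- (l * t))) * (C * (B * t))"
    by (simp only: e1 integral_mult_left_zero)
  also have "\<dots> \<le> (l * t) * (C * (B * t))"
    using C B_nonneg t exp_ge_add_one_self[of "- (l * t)"] by (intro mult_right_mono) auto
  also have "\<dots> = C * B * l * t\<^sup>2" by (simp add: power2_eq_square)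
  finally show ?thesis unfolding eq .
qed

end

section \<open>The jump chain over a short time\<close>

locale stationary_jumps = C1_flows v v' \<phi> B + prob_space \<Omega>
  for v :: "'n::finite \<Rightarrow> 'a::euclidean_space \<Rightarrow> 'a" and v' and \<phi> and B and \<Omega> :: "'w measure" +
  fixes M :: "'a set" and Q :: "real^'n^'n" and X :: "real \<Rightarrow> 'w \<Rightarrow> 'a" and I :: "real \<Rightarrow> 'w \<Rightarrow> 'n"
    and Y :: "nat \<Rightarrow> 'w \<Rightarrow> 'n" and S :: "nat \<Rightarrow> 'w \<Rightarrow> ennreal"
  assumes compact_M: "compact M" and fwd: "forward_invariant \<phi> M" and rates: "Q \<in> positive_rate_matrices"
    and X_meas: "0 \<le> t \<Longrightarrow> X t \<in> \<Omega> \<rightarrow>\<^sub>M restrict_space borel M"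
    and I_meas: "0 \<le> t \<Longrightarrow> I t \<in> \<Omega> \<rightarrow>\<^sub>M count_space UNIV"
    and jumps: "jump_hold_law \<Omega> Q (X 0) Y S"
    and cover: "AE \<omega> in \<Omega>. \<forall>k. \<forall>t\<ge>0.
      (\<Sum>m<k. S m \<omega>) \<le> ennreal t \<and> ennreal t < (\<Sum>m<Suc k. S m \<omega>) \<longrightarrow> I t \<omega> = Y k \<omega>"
    and ode: "AE \<omega> in \<Omega>. \<forall>t\<ge>0. ((\<lambda>s. v (I s \<omega>) (X s \<omega>)) has_integral (X t \<omega> - X 0 \<omega>)) {0..t}"
    and stat: "0 \<le> t \<Longrightarrow> PDMP_law M \<Omega> X I t = PDMP_law M \<Omega> X I 0"
begin

definition q :: "'n \<Rightarrow> real" where "q i = - Q $ i $ i"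

lemma Q_pos: "i \<noteq> j \<Longrightarrow> 0 < Q $ i $ j"
  using rates by (simp add: positive_rate_matrices_def)

lemma Q_sum: "(\<Sum>j\<in>UNIV - {i}. Q $ i $ j) = q i"
  using rates by (simp add: positive_rate_matrices_def rate_matrix_def q_def)

lemma q_nonneg: "0 \<le> q i"
  unfolding Q_sum[symmetric] by (intro sum_nonneg) (use Q_pos in \<open>auto simp: less_imp_le\<close>)

text \<open>A chain with a single state has exit rate 0, so a second state must be
  exhibited.\<close>

lemma q_pos: "i \<noteq> j \<Longrightarrow> 0 < q i"
  unfolding Q_sum[symmetric] by (rule sum_pos2[of _ j]) (use Q_pos in \<open>auto simp: less_imp_le\<close>)

lemma measurable_X: "0 \<le> t \<Longrightarrow> X t \<in> borel_measurable \<Omega>"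
  using X_meas measurable_restrict_space2_iff by blast

lemma X_in_M: "0 \<le> t \<Longrightarrow> \<omega> \<in> space \<Omega> \<Longrightarrow> X t \<omega> \<in> M"
  using measurable_space[OF X_meas] by (simp add: space_restrict_space)

lemma phi_in_M: "0 \<le> t \<Longrightarrow> x \<in> M \<Longrightarrow> \<phi> i t x \<in> M"
  using fwd by (simp add: forward_invariant_def)

lemma measurable_Y [measurable]: "Y k \<in> \<Omega> \<rightarrow>\<^sub>M count_space UNIV"
  and measurable_S [measurable]: "S k \<in> borel_measurable \<Omega>"
  using jumps by (simp_all add: jump_hold_law_def)

lemma measurable_X0 [measurable]: "X 0 \<in> borel_measurable \<Omega>" by (rule measurable_X) simp

lemma measurable_I0 [measurable]: "I 0 \<in> \<Omega> \<rightarrow>\<^sub>M count_space UNIV" by (rule I_meas) simp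

definition Start :: "'n \<Rightarrow> 'w set" where
  "Start i = {\<omega> \<in> space \<Omega>. Y 0 \<omega> = i}"

definition NoJump :: "real \<Rightarrow> 'n \<Rightarrow> 'w set" where
  "NoJump t i = {\<omega> \<in> space \<Omega>. Y 0 \<omega> = i \<and> ennreal t < S 0 \<omega>}"

text \<open>The jump law prescribes probabilities of strict lower bounds on holding times, so the
  other events are formed as differences of such sets. \<open>Jump\<close> means a first jump from i
  to j by time t; \<open>TwoJumps\<close> requires in addition that the second holding time be at
  most t, which covers every second jump by time t.\<close>

definition Hold :: "real \<Rightarrow> real \<Rightarrow> 'n \<Rightarrow> 'n \<Rightarrow> 'w set" where
  "Hold s t i j = {\<omega> \<in> space \<Omega>. Y 0 \<omega> = i \<and> Y 1 \<omega> = j \<and> ennreal s < S 0 \<omega> \<and> ennreal t < S 1 \<omega>}"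

definition Jump :: "real \<Rightarrow> 'n \<Rightarrow> 'n \<Rightarrow> 'w set" where
  "Jump t i j = Hold 0 0 i j - Hold t 0 i j"

definition TwoJumps :: "real \<Rightarrow> 'n \<Rightarrow> 'n \<Rightarrow> 'w set" where
  "TwoJumps t i j = Jump t i j - (Hold 0 t i j - Hold t t i j)"

lemma sets_events [measurable]:
  "Start i \<in> sets \<Omega>" "NoJump t i \<in> sets \<Omega>" "Hold s t i j \<in> sets \<Omega>" "Jump t i j \<in> sets \<Omega>" "TwoJumps t i j \<in> sets \<Omega>"
  unfolding Start_def NoJump_def Hold_def Jump_def TwoJumps_def by measurable

definition X0_in :: "'a set \<Rightarrow> 'w set" where "X0_in A = {\<omega> \<in> space \<Omega>. X 0 \<omega> \<in> A}"

lemma sets_X0_in [measurable]: "A \<in> sets borel \<Longrightarrow> X0_in A \<in> sets \<Omega>"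
  using measurable_sets[OF measurable_X0, of A] by (simp add: X0_in_def vimage_def Int_def conj_commute)

lemma X0_in_UNIV: "X0_in UNIV = space \<Omega>"
  by (auto simp: X0_in_def)

lemma prob_NoJump:
  assumes A: "A \<in> sets borel" and t: "0 \<le> t"
  shows "prob (X0_in A \<inter> NoJump t i) = exp (- (q i * t)) * prob (X0_in A \<inter> Start i)"
proof -
  have "prob {\<omega> \<in> space \<Omega>. X 0 \<omega> \<in> A \<and> (\<forall>m\<le>(0::nat). Y m \<omega> = i \<and> ennreal t < S m \<omega>)} =
        prob {\<omega> \<in> space \<Omega>. X 0 \<omega> \<in> A \<and> Y 0 \<omega> = i} * (\<Prod>m\<le>(0::nat). exp (Q $ i $ i * t))
        * (\<Prod>m<(0::nat). Q $ i $ i / (- Q $ i $ i))"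
    using jumps A t unfolding jump_hold_law_def
    by (elim conjE allE[of _ A] allE[of _ "0::nat"] allE[of _ "\<lambda>_. i"] allE[of _ "\<lambda>_. t"]) auto
  moreover have "{\<omega> \<in> space \<Omega>. X 0 \<omega> \<in> A \<and> (\<forall>m\<le>(0::nat). Y m \<omega> = i \<and> ennreal t < S m \<omega>)} = X0_in A \<inter> NoJump t i"
    by (auto simp: X0_in_def NoJump_def)
  moreover have "{\<omega> \<in> space \<Omega>. X 0 \<omega> \<in> A \<and> Y 0 \<omega> = i} = X0_in A \<inter> Start i"
    by (auto simp: X0_in_def Start_def)
  ultimately show ?thesis by (simp add: q_def)
qed

lemma prob_Hold:
  assumes A: "A \<in> sets borel" and s: "0 \<le> s" "0 \<le> t" and ij: "i \<noteq> j"
  shows "prob (X0_in A \<inter> Hold s t i j) = exp (- (q i * s)) * exp (- (q j * t)) * (Q $ i $ j / q i) * prob (X0_in A \<inter> Start i)"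
proof -
  let ?i = "\<lambda>m::nat. if m = 0 then i else j" and ?s = "\<lambda>m::nat. if m = 0 then s else t"
  have "prob {\<omega> \<in> space \<Omega>. X 0 \<omega> \<in> A \<and> (\<forall>m\<le>1. Y m \<omega> = ?i m \<and> ennreal (?s m) < S m \<omega>)} =
        prob {\<omega> \<in> space \<Omega>. X 0 \<omega> \<in> A \<and> Y 0 \<omega> = ?i 0} * (\<Prod>m\<le>1. exp (Q $ ?i m $ ?i m * ?s m))
        * (\<Prod>m<1. Q $ ?i m $ ?i (Suc m) / (- Q $ ?i m $ ?i m))"
    using jumps A s ij unfolding jump_hold_law_def
    by (elim conjE allE[of _ A] allE[of _ "1::nat"] allE[of _ ?i] allE[of _ ?s]) auto
  moreover have "{\<omega> \<in> space \<Omega>. X 0 \<omega> \<in> A \<and> (\<forall>m\<le>1. Y m \<omega> = ?i m \<and> ennreal (?s m) < S m \<omega>)} = X0_in A \<inter> Hold s t i j"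
    by (auto simp: X0_in_def Hold_def le_Suc_eq)
  moreover have "{\<omega> \<in> space \<Omega>. X 0 \<omega> \<in> A \<and> Y 0 \<omega> = ?i 0} = X0_in A \<inter> Start i"
    by (auto simp: X0_in_def Start_def)
  ultimately show ?thesis by (simp add: q_def)
qed

lemma prob_Diff_Int:
  assumes "A \<in> sets \<Omega>" "E \<in> sets \<Omega>" "E' \<in> sets \<Omega>" "E' \<subseteq> E"
  shows "prob (A \<inter> (E - E')) = prob (A \<inter> E) - prob (A \<inter> E')"
proof -
  have "A \<inter> (E - E') = (A \<inter> E) - (A \<inter> E')" by auto
  moreover have "A \<inter> E' \<subseteq> A \<inter> E" using assms(4) by auto
  ultimately show ?thesis using assms(1-3) by (simp add: finite_measure_Diff sets.Int)
qed

lemma Hold_mono: "0 \<le> s' \<Longrightarrow> s' \<le> s \<Longrightarrow> 0 \<le> t' \<Longrightarrow> t' \<le> t \<Longrightarrow> Hold s t i j \<subseteq> Hold s' t' i j"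
  by (auto simp: Hold_def intro: order.strict_trans1[OF ennreal_leI])

lemma prob_Jump:
  assumes A: "A \<in> sets borel" and t: "0 \<le> t" and ij: "i \<noteq> j"
  shows "prob (X0_in A \<inter> Jump t i j) = (1 - exp (- (q i * t))) * (Q $ i $ j / q i) * prob (X0_in A \<inter> Start i)"
  unfolding Jump_def using A t ij
  by (subst prob_Diff_Int) (auto simp: prob_Hold Hold_mono algebra_simps diff_divide_distrib)

lemma prob_TwoJumps:
  assumes t: "0 \<le> t" and ij: "i \<noteq> j"
  shows "prob (TwoJumps t i j) = (1 - exp (- (q i * t))) * (1 - exp (- (q j * t))) * (Q $ i $ j / q i) * prob (Start i)"
proof -
  have sub: "Hold 0 t i j - Hold t t i j \<subseteq> Jump t i j"
    using t Hold_mono[of 0 0 0 t i j] by (auto simp: Jump_def Hold_def)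
  have "prob (space \<Omega> \<inter> TwoJumps t i j) = prob (space \<Omega> \<inter> Jump t i j) - (prob (space \<Omega> \<inter> Hold 0 t i j) - prob (space \<Omega> \<inter> Hold t t i j))"
    unfolding TwoJumps_def
    using prob_Diff_Int[OF sets.top sets_events(4) _ sub] prob_Diff_Int[OF sets.top sets_events(3,3) Hold_mono[of 0 t t t i j]] t
    by (simp add: sets.Diff)
  also have "\<dots> = (1 - exp (- (q i * t))) * (1 - exp (- (q j * t))) * (Q $ i $ j / q i) * prob (space \<Omega> \<inter> Start i)"
    using prob_Jump[of UNIV t i j] prob_Hold[of UNIV 0 t i j] prob_Hold[of UNIV t t i j] t ij
    by (simp add: X0_in_UNIV algebra_simps diff_divide_distrib)
  finally show ?thesis using sets.sets_into_space[OF sets_events(5)] sets.sets_into_space[OF sets_events(1)]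
    by (simp add: Int_absorb1)
qed

lemma prob_Start_sum: "(\<Sum>i\<in>UNIV. prob (Start i)) = 1"
proof -
  have "prob (\<Union>i\<in>UNIV. Start i) = (\<Sum>i\<in>UNIV. prob (Start i))"
    by (rule finite_measure_finite_Union) (auto simp: disjoint_family_on_def Start_def)
  moreover have "(\<Union>i\<in>UNIV. Start i) = space \<Omega>" by (auto simp: Start_def)
  ultimately show ?thesis by (simp add: prob_space)
qed

abbreviation offdiag :: "('n \<times> 'n) set" where "offdiag \<equiv> {(i, j). i \<noteq> j}"

lemma sum_offdiag: "(\<Sum>(i, j)\<in>offdiag. g i j) = (\<Sum>i\<in>UNIV. \<Sum>j\<in>UNIV - {i}. g i j)"
proof -
  have "offdiag = (SIGMA i:UNIV. UNIV - {i})" by auto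
  then show ?thesis by (simp add: sum.Sigma)
qed

text \<open>That the first two holding times are positive and that \<open>Y 1\<close> differs from
  \<open>Y 0\<close> is not postulated by the jump law. It holds almost surely because the
  probabilities of the listed disjoint events add up to 1.\<close>

lemma AE_NoJump_or_Jump:
  assumes t: "0 \<le> t"
  shows "AE \<omega> in \<Omega>. (\<exists>i. \<omega> \<in> NoJump t i) \<or> (\<exists>i j. i \<noteq> j \<and> \<omega> \<in> Jump t i j)"
proof -
  let ?U1 = "\<Union>i\<in>UNIV. NoJump t i" and ?U2 = "\<Union>p\<in>offdiag. Jump t (fst p) (snd p)"
  have ind: "prob (NoJump t i) = exp (- (q i * t)) * prob (Start i)" for i
    using prob_NoJump[of UNIV t i] t sets.sets_into_space[OF sets_events(2)] sets.sets_into_space[OF sets_events(1)]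
    by (simp add: X0_in_UNIV Int_absorb1)
  have ind': "prob (Jump t i j) = (1 - exp (- (q i * t))) * (Q $ i $ j / q i) * prob (Start i)" if "i \<noteq> j" for i j
    using prob_Jump[of UNIV t i j] t that sets.sets_into_space[OF sets_events(4)] sets.sets_into_space[OF sets_events(1)]
    by (simp add: X0_in_UNIV Int_absorb1)
  have "prob ?U1 = (\<Sum>i\<in>UNIV. exp (- (q i * t)) * prob (Start i))"
    unfolding ind[symmetric] by (rule finite_measure_finite_Union) (auto simp: disjoint_family_on_def NoJump_def)
  moreover have "prob ?U2 = (\<Sum>i\<in>UNIV. (1 - exp (- (q i * t))) * prob (Start i))"
  proof -
    have "prob ?U2 = (\<Sum>p\<in>offdiag. prob (Jump t (fst p) (snd p)))"
      by (rule finite_measure_finite_Union) (auto simp: disjoint_family_on_def Jump_def Hold_def)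
    also have "\<dots> = (\<Sum>(i, j)\<in>offdiag. (1 - exp (- (q i * t))) * (Q $ i $ j / q i) * prob (Start i))"
      by (intro sum.cong) (auto simp: ind')
    also have "\<dots> = (\<Sum>i\<in>UNIV. (1 - exp (- (q i * t))) * prob (Start i))"
      unfolding sum_offdiag
    proof (rule sum.cong)
      fix i
      have "(\<Sum>j\<in>UNIV - {i}. (1 - exp (- (q i * t))) * (Q $ i $ j / q i) * prob (Start i))
        = (1 - exp (- (q i * t))) * prob (Start i) * ((\<Sum>j\<in>UNIV - {i}. Q $ i $ j) / q i)"
        by (simp add: sum_distrib_left sum_divide_distrib mult_ac)
      \<comment> \<open>If q i = 0, the quotient is 0 rather than 1, but then the first factor
        vanishes.\<close>
      also have "\<dots> = (1 - exp (- (q i * t))) * prob (Start i)" by (simp add: Q_sum)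
      finally show "(\<Sum>j\<in>UNIV - {i}. (1 - exp (- (q i * t))) * (Q $ i $ j / q i) * prob (Start i)) = (1 - exp (- (q i * t))) * prob (Start i)" .
    qed simp
    finally show ?thesis .
  qed
  moreover have "prob (?U1 \<union> ?U2) = prob ?U1 + prob ?U2"
  proof (rule finite_measure_Union)
    show "?U1 \<inter> ?U2 = {}" by (auto simp: NoJump_def Jump_def Hold_def)
    show "?U2 \<in> sets \<Omega>" by (rule sets.finite_UN) auto
  qed auto
  ultimately have one: "prob (?U1 \<union> ?U2) = 1"
    by (simp add: sum.distrib[symmetric] algebra_simps prob_Start_sum)
  have "?U1 \<union> ?U2 \<in> sets \<Omega>"
    by (intro sets.Un sets.finite_UN) auto
  from AE_in_set_eq_1[OF this] one have "AE \<omega> in \<Omega>. \<omega> \<in> ?U1 \<union> ?U2" by (rule iffD2)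
  then show ?thesis by eventually_elim auto
qed

text \<open>For t = 0 the preceding alternative says that \<open>S 0\<close> is positive, so time 0
  belongs to the first holding interval.\<close>

lemma AE_I0_eq_Y0: "AE \<omega> in \<Omega>. I 0 \<omega> = Y 0 \<omega>"
  using AE_NoJump_or_Jump[OF order_refl] cover
proof eventually_elim
  case (elim \<omega>)
  then have "0 < S 0 \<omega>" by (auto simp: NoJump_def Jump_def Hold_def)
  then show ?case using elim(2)[rule_format, of 0 0] by simp
qed

text \<open>Expresses that a jump event is independent of the initial position given
  \<open>Y 0\<close>: proportional probabilities on all Borel sets identify two measures on
  positions, and hence their integrals.\<close>

lemma nn_integral_event_scale:
  assumes E[measurable]: "E \<in> sets \<Omega>" "E' \<in> sets \<Omega>" and c: "0 \<le> c"
    and eq: "\<And>A. A \<in> sets borel \<Longrightarrow> prob (X0_in A \<inter> E) = c * prob (X0_in A \<inter> E')"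
    and g[measurable]: "g \<in> borel_measurable borel"
  shows "(\<integral>\<^sup>+\<omega>. indicator E \<omega> * g (X 0 \<omega>) \<partial>\<Omega>) = ennreal c * (\<integral>\<^sup>+\<omega>. indicator E' \<omega> * g (X 0 \<omega>) \<partial>\<Omega>)"
proof -
  let ?m = "\<lambda>E. distr (density \<Omega> (indicator E)) borel (X 0)"
  have em: "emeasure (?m E) A = ennreal (prob (X0_in A \<inter> E))" if [measurable]: "E \<in> sets \<Omega>" and A[measurable]: "A \<in> sets borel" for E A
  proof -
    have pre: "X 0 -` A \<inter> space \<Omega> = X0_in A" by (auto simp: X0_in_def)
    have "emeasure (?m E) A = emeasure (density \<Omega> (indicator E)) (X0_in A)"
      using A by (simp add: emeasure_distr pre)
    also have "\<dots> = (\<integral>\<^sup>+\<omega>. indicator (X0_in A \<inter> E) \<omega> \<partial>\<Omega>)"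
      by (simp add: emeasure_density indicator_inter_arith mult.commute)
    also have "\<dots> = ennreal (prob (X0_in A \<inter> E))" by (simp add: emeasure_eq_measure)
    finally show ?thesis .
  qed
  have "?m E = density (?m E') (\<lambda>_. ennreal c)"
  proof (rule measure_eqI)
    fix A assume "A \<in> sets (?m E)"
    then have A: "A \<in> sets borel" by simp
    then show "emeasure (?m E) A = emeasure (density (?m E') (\<lambda>_. ennreal c)) A"
      using c by (simp add: em eq emeasure_density nn_integral_cmult ennreal_mult)
  qed simp
  then have "integral\<^sup>N (?m E) g = integral\<^sup>N (density (?m E') (\<lambda>_. ennreal c)) g" by simp
  then show ?thesis by (simp add: nn_integral_distr nn_integral_density nn_integral_cmult)
qed

lemma expectation_event_scale:
  fixes g :: "'a \<Rightarrow> real"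
  assumes "E \<in> sets \<Omega>" "E' \<in> sets \<Omega>" "0 \<le> c"
    and "\<And>A. A \<in> sets borel \<Longrightarrow> prob (X0_in A \<inter> E) = c * prob (X0_in A \<inter> E')"
    and g[measurable]: "g \<in> borel_measurable borel" and "\<And>x. 0 \<le> g x"
  shows "expectation (\<lambda>\<omega>. indicator E \<omega> * g (X 0 \<omega>)) = c * expectation (\<lambda>\<omega>. indicator E' \<omega> * g (X 0 \<omega>))"
proof -
  have *: "expectation (\<lambda>\<omega>. indicator E \<omega> * g (X 0 \<omega>)) = enn2real (\<integral>\<^sup>+\<omega>. indicator E \<omega> * ennreal (g (X 0 \<omega>)) \<partial>\<Omega>)"
    if [measurable]: "E \<in> sets \<Omega>" for E
    using assms(6) by (subst integral_eq_nn_integral)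
      (auto simp: ennreal_mult'' ennreal_indicator intro!: arg_cong[where f=enn2real] nn_integral_cong)
  have "(\<integral>\<^sup>+\<omega>. indicator E \<omega> * ennreal (g (X 0 \<omega>)) \<partial>\<Omega>) = ennreal c * (\<integral>\<^sup>+\<omega>. indicator E' \<omega> * ennreal (g (X 0 \<omega>)) \<partial>\<Omega>)"
    by (rule nn_integral_event_scale) (use assms in auto)
  then show ?thesis using assms(1-3) by (simp add: * enn2real_mult)
qed

lemma integrable_bounded:
  fixes g :: "'w \<Rightarrow> real"
  assumes "g \<in> borel_measurable \<Omega>" "\<And>\<omega>. \<omega> \<in> space \<Omega> \<Longrightarrow> \<bar>g \<omega>\<bar> \<le> C"
  shows "integrable \<Omega> g"
  by (rule integrable_const_bound[of _ C]) (use assms in auto)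

text \<open>Over the time interval \<open>{0..t}\<close> the process follows one flow if there is no jump; one
  jump leaves the position where it was up to \<open>B * t\<close>; two jumps are negligible.\<close>

lemma AE_short_time:
  fixes f :: "'a \<Rightarrow> real"
  assumes t0: "\<forall>t i x Z. 0 \<le> t \<longrightarrow> t \<le> t0 \<longrightarrow> (\<forall>s\<in>{0..t}. Z s \<in> M \<and> \<phi> i s x \<in> M) \<longrightarrow>
      (\<forall>u\<in>{0..t}. ((\<lambda>s. v i (Z s)) has_integral (Z u - x)) {0..u}) \<longrightarrow> Z t = \<phi> i t x"
    and t: "0 \<le> t" "t \<le> t0"
    and f01: "\<And>x. 0 \<le> f x" "\<And>x. f x \<le> 1"
    and \<epsilon>: "0 \<le> \<epsilon>" "\<And>x y. x \<in> M \<Longrightarrow> y \<in> M \<Longrightarrow> norm (x - y) \<le> B * t \<Longrightarrow> \<bar>f x - f y\<bar> \<le> \<epsilon>"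
  shows "AE \<omega> in \<Omega>. \<bar>indicator {\<omega>. I t \<omega> = j} \<omega> * f (X t \<omega>) -
      (indicator (NoJump t j) \<omega> * f (\<phi> j t (X 0 \<omega>)) + (\<Sum>i\<in>UNIV - {j}. indicator (Jump t i j) \<omega> * f (X 0 \<omega>)))\<bar>
    \<le> (\<Sum>(i, k)\<in>offdiag. \<epsilon> * indicator (Jump t i k) \<omega> + indicator (TwoJumps t i k) \<omega>)"
  using AE_NoJump_or_Jump[OF t(1)] cover ode AE_space
proof eventually_elim
  case (elim \<omega>)
  let ?L = "indicator {\<omega>. I t \<omega> = j} \<omega> * f (X t \<omega>) -
      (indicator (NoJump t j) \<omega> * f (\<phi> j t (X 0 \<omega>)) + (\<Sum>i\<in>UNIV - {j}. indicator (Jump t i j) \<omega> * f (X 0 \<omega>)))"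
  let ?R = "\<Sum>(i, k)\<in>offdiag. \<epsilon> * indicator (Jump t i k) \<omega> + indicator (TwoJumps t i k) \<omega>"
  have R0: "0 \<le> ?R" using \<epsilon>(1) by (intro sum_nonneg) auto
  show ?case
  proof (cases "\<exists>i. \<omega> \<in> NoJump t i")
    case True
    then obtain i where i: "\<omega> \<in> NoJump t i" by blast
    then have Y0: "Y 0 \<omega> = i" and S0: "ennreal t < S 0 \<omega>" by (auto simp: NoJump_def)
    \<comment> \<open>Without a jump the index is constant on the whole interval, so the position
      solves the equation of a single field.\<close>
    have I: "I s \<omega> = i" if "s \<in> {0..t}" for s
      using elim(2)[rule_format, of s 0] that S0 Y0 by (auto intro: order.strict_trans1[OF ennreal_leI])
    have noJ: "\<omega> \<notin> Jump t k l" for k l using S0 by (auto simp: Jump_def Hold_def)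
    have "?L = 0"
    proof (cases "i = j")
      case True
      have "X t \<omega> = \<phi> j t (X 0 \<omega>)"
      proof (rule t0[rule_format, OF t])
        show "X s \<omega> \<in> M \<and> \<phi> j s (X 0 \<omega>) \<in> M" if "s \<in> {0..t}" for s
          using that X_in_M[OF _ elim(4)] phi_in_M by auto
        show "((\<lambda>s. v j (X s \<omega>)) has_integral X u \<omega> - X 0 \<omega>) {0..u}" if "u \<in> {0..t}" for u
          using elim(3)[rule_format, of u] that I True by (subst has_integral_cong[of _ _ "\<lambda>s. v (I s \<omega>) (X s \<omega>)"]) auto
      qed
      then show ?thesis using True i I[of t] t noJ by simp
    next
      case False
      then have "\<omega> \<notin> NoJump t j" using Y0 by (auto simp: NoJump_def)
      then show ?thesis using False I[of t] t noJ by simp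
    qed
    then show ?thesis using R0 by simp
  next
    case False
    then obtain i k where ik: "i \<noteq> k" "\<omega> \<in> Jump t i k" using elim(1) by blast
    then have Y: "Y 0 \<omega> = i" "Y 1 \<omega> = k" and S0: "S 0 \<omega> \<le> ennreal t" by (auto simp: Jump_def Hold_def)
    have "\<omega> \<in> Jump t i' k' \<longleftrightarrow> i' = i \<and> k' = k" for i' k'
      using ik Y by (auto simp: Jump_def Hold_def)
    then have "(\<Sum>i'\<in>UNIV - {j}. indicator (Jump t i' j) \<omega> * f (X 0 \<omega>)) = (\<Sum>i'\<in>UNIV - {j}. if i' = i then (if k = j then f (X 0 \<omega>) else 0) else 0)"
      by (intro sum.cong) (auto simp: indicator_def)
    also have "\<dots> = (if k = j then f (X 0 \<omega>) else 0)" using ik by auto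
    finally have L: "?L = indicator {\<omega>. I t \<omega> = j} \<omega> * f (X t \<omega>) - (if k = j then f (X 0 \<omega>) else 0)"
      using False by simp
    have "(\<lambda>(i, k). \<epsilon> * indicator (Jump t i k) \<omega> + indicator (TwoJumps t i k) \<omega>) (i, k) \<le> ?R"
      using ik \<epsilon>(1) by (intro member_le_sum) auto
    then have R: "\<epsilon> + indicator (TwoJumps t i k) \<omega> \<le> ?R" using ik by simp
    show ?thesis
    proof (cases "\<omega> \<in> TwoJumps t i k")
      case True
      \<comment> \<open>After two short holding times \<open>I t\<close> is not controlled; both
        terms of \<open>?L\<close> lie between 0 and 1, which the indicator of
        \<open>TwoJumps\<close> pays for.\<close>
      have "\<bar>?L\<bar> \<le> 1" unfolding L using f01[of "X t \<omega>"] f01[of "X 0 \<omega>"] by (auto simp: indicator_def)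
      then show ?thesis using R True \<epsilon>(1) by simp
    next
      case False
      \<comment> \<open>The second holding time alone exceeds t, so at time t the chain is still in
        its second state, whenever it jumped.\<close>
      then have S1: "ennreal t < S 1 \<omega>" using ik by (auto simp: TwoJumps_def Hold_def)
      then have "ennreal t < S 0 \<omega> + S 1 \<omega>" by (rule order.strict_trans2) simp
      then have "I t \<omega> = k" using elim(2)[rule_format, of t 1] S0 t Y by simp
      moreover have "norm (X t \<omega> - X 0 \<omega>) \<le> B * t"
      proof -
        have "norm (X t \<omega> - X 0 \<omega>) \<le> B * measure lborel (cbox 0 t)"
          using elim(3)[rule_format, of t] t norm_v_le B_nonneg
          by (intro has_integral_bound[of _ "\<lambda>s. v (I s \<omega>) (X s \<omega>)"]) auto
        then show ?thesis using t by simp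
      qed
      then have "\<bar>f (X t \<omega>) - f (X 0 \<omega>)\<bar> \<le> \<epsilon>"
        using X_in_M elim(4) t by (intro \<epsilon>(2)) auto
      ultimately show ?thesis unfolding L using R False \<epsilon>(1) by (cases "k = j") auto
    qed
  qed
qed

end

section \<open>The stationarity identity tested on resolvents\<close>

lemma derivative_zero_at_right:
  fixes R :: "real \<Rightarrow> real"
  assumes R0: "R 0 = 0" and der: "(R has_real_derivative c) (at 0)" and K: "0 \<le> K"
    and small: "\<And>\<epsilon>. 0 < \<epsilon> \<Longrightarrow> \<exists>t1>0. \<forall>t. 0 < t \<longrightarrow> t < t1 \<longrightarrow> \<bar>R t\<bar> \<le> t * (\<epsilon> * K + t * K)"
  shows "c = 0"
proof (rule ccontr)
  assume "c \<noteq> 0"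
  \<comment> \<open>Makes the bound 2 * \<epsilon> * K on \<bar>c\<bar> at most \<bar>c\<bar> /
    2.\<close>
  define \<epsilon> where "\<epsilon> = \<bar>c\<bar> / (4 * (K + 1))"
  have \<epsilon>: "\<epsilon> > 0" using \<open>c \<noteq> 0\<close> K by (simp add: \<epsilon>_def)
  obtain t1 where t1: "t1 > 0" "\<And>t. 0 < t \<Longrightarrow> t < t1 \<Longrightarrow> \<bar>R t\<bar> \<le> t * (\<epsilon> * K + t * K)"
    using small[OF \<epsilon>] by blast
  have "((\<lambda>t. R t / t) \<longlongrightarrow> c) (at 0)"
    using der by (simp add: DERIV_def R0)
  then have "((\<lambda>t. R t / t) \<longlongrightarrow> c) (at_right 0)"
    by (rule filterlim_mono[OF _ order_refl at_le]) auto
  then have lim: "((\<lambda>t. \<bar>R t / t\<bar>) \<longlongrightarrow> \<bar>c\<bar>) (at_right 0)" by (rule tendsto_rabs)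
  have "\<forall>\<^sub>F t in at_right (0::real). t < min t1 \<epsilon>"
    by (rule order_tendstoD(2)[OF tendsto_ident_at]) (use t1 \<epsilon> in auto)
  then have "\<forall>\<^sub>F t in at_right 0. \<bar>R t / t\<bar> \<le> 2 * \<epsilon> * K"
    using eventually_at_right_less[of 0]
  proof eventually_elim
    case (elim t)
    then have "\<bar>R t\<bar> \<le> t * (\<epsilon> * K + t * K)" by (intro t1) auto
    also have "\<dots> \<le> t * (\<epsilon> * K + \<epsilon> * K)" using elim K by (intro mult_left_mono add_left_mono mult_right_mono) auto
    finally show ?case using elim by (simp add: field_simps)
  qed
  from tendsto_upperbound[OF lim this] have "\<bar>c\<bar> \<le> 2 * \<epsilon> * K" by simp
  also have "\<dots> \<le> 2 * \<epsilon> * (K + 1)" using \<epsilon> by simp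
  also have "\<dots> = \<bar>c\<bar> / 2"
  proof -
    have "K + 1 \<noteq> 0" using K by simp
    then show ?thesis unfolding \<epsilon>_def by (simp add: field_simps)
  qed
  finally show False using \<open>c \<noteq> 0\<close> by simp
qed

lemma one_minus_exp_bounds: "0 \<le> x \<Longrightarrow> 0 \<le> 1 - exp (- x) \<and> 1 - exp (- x) \<le> (x::real)"
  using exp_ge_add_one_self[of "- x"] by auto

context stationary_jumps begin

lemma expectation_stationary:
  assumes f[measurable]: "f \<in> borel_measurable borel" and t: "0 \<le> t"
  shows "expectation (\<lambda>\<omega>. indicator {\<omega>. I t \<omega> = j} \<omega> * f (X t \<omega>)) = expectation (\<lambda>\<omega>. indicator (Start j) \<omega> * (f (X 0 \<omega>) :: real))"
proof -
  let ?N = "restrict_space borel M \<Otimes>\<^sub>M count_space UNIV :: ('a \<times> 'n) measure"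
  let ?F = "\<lambda>p. indicator {j} (snd p) * f (fst p)"
  have f': "f \<in> borel_measurable (restrict_space borel M)" by (rule measurable_restrict_space1[OF f])
  have F: "?F \<in> borel_measurable ?N"
    by (intro borel_measurable_times measurable_compose[OF measurable_fst f']
        measurable_compose[OF measurable_snd borel_measurable_indicator]) simp
  have eq: "expectation (\<lambda>\<omega>. indicator {\<omega>. I s \<omega> = j} \<omega> * f (X s \<omega>)) = integral\<^sup>L (PDMP_law M \<Omega> X I s) ?F" if s: "0 \<le> s" for s
    unfolding PDMP_law_def using measurable_Pair[OF X_meas[OF s] I_meas[OF s]] F
    by (subst integral_distr) (auto simp: indicator_def)
  have "expectation (\<lambda>\<omega>. indicator {\<omega>. I t \<omega> = j} \<omega> * f (X t \<omega>)) = expectation (\<lambda>\<omega>. indicator {\<omega>. I 0 \<omega> = j} \<omega> * f (X 0 \<omega>))"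
    unfolding eq[OF t] eq[OF order_refl] stat[OF t] ..
  also have "\<dots> = expectation (\<lambda>\<omega>. indicator (Start j) \<omega> * f (X 0 \<omega>))"
  proof (rule integral_cong_AE)
    have "(\<lambda>\<omega>. indicator {j} (I 0 \<omega>) * f (X 0 \<omega>)) \<in> borel_measurable \<Omega>"
      using measurable_compose[OF measurable_I0, of "indicator {j} :: 'n \<Rightarrow> real"] by measurable
    then show "(\<lambda>\<omega>. indicator {\<omega>. I 0 \<omega> = j} \<omega> * f (X 0 \<omega>)) \<in> borel_measurable \<Omega>"
      by (simp add: indicator_def)
    show "AE \<omega> in \<Omega>. indicator {\<omega>. I 0 \<omega> = j} \<omega> * f (X 0 \<omega>) = indicator (Start j) \<omega> * f (X 0 \<omega>)"
      using AE_I0_eq_Y0 AE_space by eventually_elim (auto simp: Start_def indicator_def)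
  qed measurable
  finally show ?thesis .
qed

text \<open>The integral of the generator vanishes for the test function that equals the resolvent f
  on copy \<open>j\<close> and 0 elsewhere, with the derivative of f along \<open>v j\<close>
  written as l * (f - h). It results from comparing the expectation of this test function at times 0
  and t to first order.\<close>

lemma resolvent_identity:
  assumes l: "0 < l" and h: "continuous_on UNIV h" "\<And>x. 0 \<le> h x" "\<And>x. h x \<le> (1::real)"
    and lip: "\<And>x y. \<bar>h x - h y\<bar> \<le> C * norm (x - y)"
  shows "l * expectation (\<lambda>\<omega>. indicator (Start j) \<omega> * h (X 0 \<omega>)) =
    (l - q j) * expectation (\<lambda>\<omega>. indicator (Start j) \<omega> * resolvent l j h (X 0 \<omega>)) +
    (\<Sum>i\<in>UNIV - {j}. Q $ i $ j * expectation (\<lambda>\<omega>. indicator (Start i) \<omega> * resolvent l j h (X 0 \<omega>)))"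
proof -
  define f where "f = resolvent l j h"
  have f_cont: "continuous_on UNIV f" unfolding f_def by (rule continuous_resolvent[OF l h])
  have f01: "0 \<le> f x" "f x \<le> 1" for x unfolding f_def using resolvent_bounds[OF l h] by auto
  have [measurable]: "f \<in> borel_measurable borel" "h \<in> borel_measurable borel"
    using f_cont h(1) by (auto intro: borel_measurable_continuous_onI)
  define a where "a i = expectation (\<lambda>\<omega>. indicator (Start i) \<omega> * f (X 0 \<omega>))" for i
  define b where "b = expectation (\<lambda>\<omega>. indicator (Start j) \<omega> * h (X 0 \<omega>))"
  define F where "F t = expectation (\<lambda>\<omega>. indicator (Start j) \<omega> * f (\<phi> j t (X 0 \<omega>)))" for t
  define inflow where "inflow t = (\<Sum>i\<in>UNIV - {j}. (1 - exp (- (q i * t))) * (Q $ i $ j / q i) * a i)" for t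
  define relaxed where "relaxed t = a j - (1 - exp (- (l * t))) * b" for t
  \<comment> \<open>A jump from i to k by time t has probability at most
    \<open>t * Q $ i $ k\<close>, and a short second holding time brings a further factor t * q
    k.\<close>
  define K1 where "K1 = (\<Sum>(i, k)\<in>offdiag. Q $ i $ k * (1 + q k))"
  have C: "0 \<le> C" by (rule lipschitz_constant_nonneg[OF lip])
  \<comment> \<open>Adds the error constant of \<open>resolvent_expansion\<close>; exp l bounds exp
    (l * t) for t at most 1.\<close>
  define K where "K = K1 + exp l * (C * B * l)"
  have K1: "0 \<le> K1" unfolding K1_def
    by (intro sum_nonneg) (use Q_pos q_nonneg in \<open>auto simp: less_imp_le\<close>)
  have K: "0 \<le> K" "K1 \<le> K" using K1 C B_nonneg l by (auto simp: K_def)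
  \<comment> \<open>By stationarity the expectation at time t is \<open>a j\<close>; subtracted is
    its explicit approximation, in which exp (l * t) * relaxed t stands for \<open>F t\<close>. The
    remainder is o(t), and its derivative at 0 is \<open>?c\<close>.\<close>
  define R where "R t = a j - exp (- (q j * t)) * exp (l * t) * relaxed t - inflow t" for t
  let ?c = "(q j - l) * a j + l * b - (\<Sum>i\<in>UNIV - {j}. Q $ i $ j * a i)"
  have int_f: "integrable \<Omega> (\<lambda>\<omega>. indicator E \<omega> * g (X 0 \<omega>))"
    if [measurable]: "E \<in> sets \<Omega>" "g \<in> borel_measurable borel" and "\<And>x. 0 \<le> g x" "\<And>x. g x \<le> 1" for E and g :: "'a \<Rightarrow> real"
    using that by (intro integrable_bounded[of _ 1]) (auto simp: indicator_def)
  obtain t0 where "t0 > 0" and t0: "\<forall>t i x Z. 0 \<le> t \<longrightarrow> t \<le> t0 \<longrightarrow> (\<forall>s\<in>{0..t}. Z s \<in> M \<and> \<phi> i s x \<in> M) \<longrightarrow>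
      (\<forall>u\<in>{0..t}. ((\<lambda>s. v i (Z s)) has_integral (Z u - x)) {0..u}) \<longrightarrow> Z t = \<phi> i t x"
    using ex_small_time_flow_unique[OF compact_M] by blast
  have flow_term: "\<bar>exp (- (l * t)) * F t - relaxed t\<bar> \<le> C * B * l * t\<^sup>2" if t: "0 \<le> t" for t
  proof -
    let ?g = "\<lambda>\<omega>. exp (- (l * t)) * (indicator (Start j) \<omega> * f (\<phi> j t (X 0 \<omega>))) -
        (indicator (Start j) \<omega> * f (X 0 \<omega>) - (1 - exp (- (l * t))) * (indicator (Start j) \<omega> * h (X 0 \<omega>)))"
    have meas: "(\<lambda>x. f (\<phi> j t x)) \<in> borel_measurable borel" by measurable
    have int: "integrable \<Omega> (\<lambda>\<omega>. indicator (Start j) \<omega> * f (\<phi> j t (X 0 \<omega>)))"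
      "integrable \<Omega> (\<lambda>\<omega>. indicator (Start j) \<omega> * f (X 0 \<omega>))" "integrable \<Omega> (\<lambda>\<omega>. indicator (Start j) \<omega> * h (X 0 \<omega>))"
      using int_f[OF sets_events(1) meas] f01 h by (auto intro: int_f)
    have eq: "exp (- (l * t)) * F t - relaxed t = expectation ?g"
      unfolding F_def relaxed_def a_def b_def using int by simp
    have "\<bar>expectation ?g\<bar> \<le> expectation (\<lambda>\<omega>. C * B * l * t\<^sup>2)"
    proof (rule order_trans[OF integral_abs_bound integral_mono])
      fix \<omega>
      have eq': "?g \<omega> = indicator (Start j) \<omega> * (exp (- (l * t)) * f (\<phi> j t (X 0 \<omega>)) - (f (X 0 \<omega>) - (1 - exp (- (l * t))) * h (X 0 \<omega>)))"
        by (simp add: algebra_simps)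
      show "\<bar>?g \<omega>\<bar> \<le> C * B * l * t\<^sup>2"
        unfolding eq' using resolvent_expansion[OF l h lip t, of j "X 0 \<omega>"] C B_nonneg l unfolding f_def
        by (cases "\<omega> \<in> Start j") auto
    qed (use int in auto)
    then show ?thesis unfolding eq by (simp add: prob_space)
  qed
  have jump_term: "\<bar>a j - (exp (- (q j * t)) * F t + inflow t)\<bar> \<le> t * (\<epsilon> * K1 + t * K1)"
    if t: "0 \<le> t" "t \<le> t0" and \<epsilon>: "0 \<le> \<epsilon>" "\<And>x y. x \<in> M \<Longrightarrow> y \<in> M \<Longrightarrow> norm (x - y) \<le> B * t \<Longrightarrow> \<bar>f x - f y\<bar> \<le> \<epsilon>" for t \<epsilon>
  proof -
    let ?W = "\<lambda>\<omega>. indicator {\<omega>. I t \<omega> = j} \<omega> * f (X t \<omega>)"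
    let ?N = "\<lambda>\<omega>. indicator (NoJump t j) \<omega> * f (\<phi> j t (X 0 \<omega>))"
    let ?J = "\<lambda>i \<omega>. indicator (Jump t i j) \<omega> * f (X 0 \<omega>)"
    let ?E = "\<lambda>\<omega>. \<Sum>(i, k)\<in>offdiag. \<epsilon> * indicator (Jump t i k) \<omega> + indicator (TwoJumps t i k) \<omega>"
    have meas: "(\<lambda>x. f (\<phi> j t x)) \<in> borel_measurable borel" by measurable
    have W: "integrable \<Omega> ?W"
    proof (rule integrable_bounded[of _ 1])
      have "(\<lambda>\<omega>. indicator {j} (I t \<omega>) * f (X t \<omega>)) \<in> borel_measurable \<Omega>"
        using measurable_compose[OF I_meas[OF t(1)], of "indicator {j} :: 'n \<Rightarrow> real"] measurable_X[OF t(1)] by measurable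
      then show "?W \<in> borel_measurable \<Omega>" by (simp add: indicator_def)
    qed (use f01 in \<open>auto simp: indicator_def\<close>)
    have N: "integrable \<Omega> ?N" using int_f[OF sets_events(2) meas] f01 by auto
    have J: "integrable \<Omega> (?J i)" for i using f01 by (intro int_f) auto
    have E: "integrable \<Omega> (\<lambda>\<omega>. \<epsilon> * indicator (Jump t i k) \<omega> + indicator (TwoJumps t i k) \<omega>)" for i k
      by (intro Bochner_Integration.integrable_add integrable_mult_right integrable_real_indicator) (auto simp: emeasure_eq_measure)
    have EW: "expectation ?W = a j" unfolding a_def by (rule expectation_stationary[OF _ t(1)]) measurable
    have EN: "expectation ?N = exp (- (q j * t)) * F t"
      unfolding F_def using prob_NoJump[OF _ t(1)] f01
      by (intro expectation_event_scale[where g = "\<lambda>x. f (\<phi> j t x)"]) auto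
    have EJ: "expectation (?J i) = (1 - exp (- (q i * t))) * (Q $ i $ j / q i) * a i" if "i \<noteq> j" for i
      unfolding a_def using prob_Jump[OF _ t(1) that] f01 one_minus_exp_bounds[of "q i * t"] q_nonneg[of i] t Q_pos[OF that]
      by (intro expectation_event_scale[where g = f]) auto
    have eq: "a j - (exp (- (q j * t)) * F t + inflow t)
      = expectation (\<lambda>\<omega>. ?W \<omega> - (?N \<omega> + (\<Sum>i\<in>UNIV - {j}. ?J i \<omega>)))"
    proof -
      have S: "integrable \<Omega> (\<lambda>\<omega>. \<Sum>i\<in>UNIV - {j}. ?J i \<omega>)" by (intro Bochner_Integration.integrable_sum J)
      have "expectation (\<lambda>\<omega>. \<Sum>i\<in>UNIV - {j}. ?J i \<omega>) = (\<Sum>i\<in>UNIV - {j}. expectation (?J i))"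
        by (rule Bochner_Integration.integral_sum[OF J])
      also have "\<dots> = inflow t"
        unfolding inflow_def by (intro sum.cong refl EJ) auto
      finally show ?thesis
        by (simp only: Bochner_Integration.integral_diff[OF W Bochner_Integration.integrable_add[OF N S]]
            Bochner_Integration.integral_add[OF N S] EW EN)
    qed
    have "\<bar>expectation (\<lambda>\<omega>. ?W \<omega> - (?N \<omega> + (\<Sum>i\<in>UNIV - {j}. ?J i \<omega>)))\<bar>
        \<le> expectation (\<lambda>\<omega>. \<bar>?W \<omega> - (?N \<omega> + (\<Sum>i\<in>UNIV - {j}. ?J i \<omega>))\<bar>)"
      by (rule integral_abs_bound)
    also have "\<dots> \<le> expectation ?E"
    proof (rule integral_mono_AE)
      show "integrable \<Omega> (\<lambda>\<omega>. \<bar>?W \<omega> - (?N \<omega> + (\<Sum>i\<in>UNIV - {j}. ?J i \<omega>))\<bar>)"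
        by (intro integrable_abs Bochner_Integration.integrable_diff Bochner_Integration.integrable_add
            Bochner_Integration.integrable_sum W N J)
      show "integrable \<Omega> ?E"
        unfolding case_prod_beta by (intro Bochner_Integration.integrable_sum E)
      show "AE \<omega> in \<Omega>. \<bar>?W \<omega> - (?N \<omega> + (\<Sum>i\<in>UNIV - {j}. ?J i \<omega>))\<bar> \<le> ?E \<omega>"
        by (rule AE_short_time[OF t0 t f01 \<epsilon>])
    qed
    also have "\<dots> = (\<Sum>(i, k)\<in>offdiag. \<epsilon> * prob (Jump t i k) + prob (TwoJumps t i k))"
    proof -
      have "expectation (\<lambda>\<omega>. \<epsilon> * indicator (Jump t i k) \<omega> + indicator (TwoJumps t i k) \<omega>) = \<epsilon> * prob (Jump t i k) + prob (TwoJumps t i k)" for i k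
        by (subst Bochner_Integration.integral_add)
          (auto intro!: integrable_mult_right integrable_real_indicator simp: emeasure_eq_measure
            Int_absorb1[OF sets.sets_into_space[OF sets_events(4)]] Int_absorb1[OF sets.sets_into_space[OF sets_events(5)]]
            Int_absorb2[OF sets.sets_into_space[OF sets_events(4)]] Int_absorb2[OF sets.sets_into_space[OF sets_events(5)]])
      then show ?thesis
        unfolding case_prod_beta by (subst Bochner_Integration.integral_sum[OF E]) simp
    qed
    also have "\<dots> \<le> (\<Sum>(i, k)\<in>offdiag. t * (\<epsilon> * (Q $ i $ k * (1 + q k)) + t * (Q $ i $ k * (1 + q k))))"
    proof (rule sum_mono, clarify)
      fix i k :: 'n assume ik: "i \<noteq> k"
      let ?x = "1 - exp (- (q i * t))" and ?y = "1 - exp (- (q k * t))" and ?r = "Q $ i $ k / q i"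
      have x: "0 \<le> ?x" "?x \<le> q i * t" and y: "0 \<le> ?y" "?y \<le> q k * t"
        using one_minus_exp_bounds[of "q i * t"] one_minus_exp_bounds[of "q k * t"] q_nonneg t by auto
      have r: "0 \<le> ?r" using Q_pos[OF ik] q_nonneg by simp
      have xr0: "0 \<le> ?x * ?r" by (rule mult_nonneg_nonneg[OF x(1) r])
      have xr: "?x * ?r \<le> t * Q $ i $ k"
      proof -
        have "?x * ?r \<le> (q i * t) * ?r" using x r by (intro mult_right_mono) auto
        then show ?thesis using q_pos[OF ik] by simp
      qed
      have "prob (Jump t i k) = ?x * ?r * prob (Start i)"
        using prob_Jump[of UNIV t i k] t ik sets.sets_into_space[OF sets_events(4)] sets.sets_into_space[OF sets_events(1)]
        by (simp add: X0_in_UNIV Int_absorb1)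
      also have "\<dots> \<le> ?x * ?r * 1" by (rule mult_left_mono[OF prob_le_1 xr0])
      finally have PJ: "prob (Jump t i k) \<le> t * Q $ i $ k" using xr by simp
      have "prob (TwoJumps t i k) = (?x * ?r) * ?y * prob (Start i)"
        using prob_TwoJumps[OF t(1) ik] by (simp add: mult_ac)
      also have "\<dots> \<le> (?x * ?r) * ?y * 1" by (rule mult_left_mono[OF prob_le_1 mult_nonneg_nonneg[OF xr0 y(1)]])
      also have "\<dots> \<le> (t * Q $ i $ k) * (q k * t) * 1"
        using t Q_pos[OF ik] by (intro mult_right_mono mult_mono[OF xr y(2) _ y(1)]) auto
      finally have PT: "prob (TwoJumps t i k) \<le> t * (t * (Q $ i $ k * q k))" by (simp add: mult_ac)
      have "\<epsilon> * prob (Jump t i k) \<le> \<epsilon> * (t * (Q $ i $ k * (1 + q k)))"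
        using PJ \<epsilon>(1) t Q_pos[OF ik] q_nonneg[of k]
        by (intro mult_left_mono) (auto intro!: order_trans[OF PJ] mult_left_mono)
      moreover have "t * (t * (Q $ i $ k * q k)) \<le> t * (t * (Q $ i $ k * (1 + q k)))"
        using t Q_pos[OF ik] by (intro mult_left_mono) auto
      ultimately show "\<epsilon> * prob (Jump t i k) + prob (TwoJumps t i k) \<le> t * (\<epsilon> * (Q $ i $ k * (1 + q k)) + t * (Q $ i $ k * (1 + q k)))"
        using PT by (simp add: distrib_left mult.left_commute)
    qed
    also have "\<dots> = t * (\<epsilon> * K1 + t * K1)"
      unfolding K1_def by (simp add: sum_distrib_left sum.distrib distrib_left case_prod_beta)
    finally show ?thesis unfolding eq .
  qed
  have "\<exists>t1>0. \<forall>t. 0 < t \<longrightarrow> t < t1 \<longrightarrow> \<bar>R t\<bar> \<le> t * (\<epsilon> * K + t * K)" if "0 < \<epsilon>" for \<epsilon>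
  proof -
    \<comment> \<open>The resolvent is controlled through its modulus of continuity on the compact
      set \<open>M\<close>; a single jump therefore contributes an error of order \<epsilon> * t,
      with \<epsilon> arbitrary.\<close>
    have "uniformly_continuous_on M f"
      by (intro compact_uniformly_continuous compact_M continuous_on_subset[OF f_cont]) auto
    then obtain \<delta> where \<delta>: "\<delta> > 0" "\<And>x y. x \<in> M \<Longrightarrow> y \<in> M \<Longrightarrow> dist x y < \<delta> \<Longrightarrow> dist (f x) (f y) < \<epsilon>"
      unfolding uniformly_continuous_on_def using \<open>0 < \<epsilon>\<close> by metis
    \<comment> \<open>The three bounds serve exp (l * t) \<le> exp l, the uniqueness of short
      trajectories, and displacements B * t below \<delta>.\<close>
    define t1 where "t1 = min 1 (min t0 (\<delta> / (B + 1)))"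
    have "t1 > 0" using \<open>t0 > 0\<close> \<delta>(1) B_nonneg by (simp add: t1_def)
    have "\<bar>R t\<bar> \<le> t * (\<epsilon> * K + t * K)" if t: "0 < t" "t < t1" for t
    proof -
      have "B * t < \<delta>"
      proof -
        have "t < \<delta> / (B + 1)" using t by (simp add: t1_def)
        then have "t * (B + 1) < \<delta>" using B_nonneg by (simp add: pos_less_divide_eq)
        then show ?thesis using t by (simp add: algebra_simps)
      qed
      then have mod: "\<bar>f x - f y\<bar> \<le> \<epsilon>" if "x \<in> M" "y \<in> M" "norm (x - y) \<le> B * t" for x y
        using \<delta>(2)[of x y] that by (simp add: dist_norm dist_real_def)
      let ?e = "exp (- (q j * t)) * exp (l * t)"
      have "exp (l * t) * exp (- (l * t)) = 1" by (simp add: exp_minus_inverse)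
      then have "?e * (exp (- (l * t)) * F t) = exp (- (q j * t)) * F t"
        by (metis mult.assoc mult.right_neutral)
      then have eq: "R t = (a j - (exp (- (q j * t)) * F t + inflow t)) + ?e * (exp (- (l * t)) * F t - relaxed t)"
        by (simp add: R_def right_diff_distrib)
      have triangle: "\<bar>x + c * y\<bar> \<le> \<bar>x\<bar> + c * \<bar>y\<bar>" if "0 \<le> c" for x y c :: real
        using abs_triangle_ineq[of x "c * y"] that by (simp add: abs_mult)
      have "\<bar>R t\<bar> \<le> \<bar>a j - (exp (- (q j * t)) * F t + inflow t)\<bar> + ?e * \<bar>exp (- (l * t)) * F t - relaxed t\<bar>"
        unfolding eq by (rule triangle) simp
      also have "\<dots> \<le> t * (\<epsilon> * K1 + t * K1) + exp l * (C * B * l * t\<^sup>2)"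
      proof (rule add_mono)
        show "\<bar>a j - (exp (- (q j * t)) * F t + inflow t)\<bar> \<le> t * (\<epsilon> * K1 + t * K1)"
          using t mod \<open>0 < \<epsilon>\<close> by (intro jump_term) (auto simp: t1_def)
        have "?e \<le> 1 * exp l"
          using t q_nonneg[of j] l by (intro mult_mono) (auto simp: t1_def mult_left_le)
        then show "?e * \<bar>exp (- (l * t)) * F t - relaxed t\<bar> \<le> exp l * (C * B * l * t\<^sup>2)"
          using flow_term[of t] t by (intro mult_mono) auto
      qed
      also have "\<dots> = t * (\<epsilon> * K1 + t * K)"
        by (simp add: K_def power2_eq_square algebra_simps)
      also have "\<dots> \<le> t * (\<epsilon> * K + t * K)"
        using K t \<open>0 < \<epsilon>\<close> by (intro mult_left_mono add_right_mono) auto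
      finally show ?thesis .
    qed
    then show ?thesis using \<open>t1 > 0\<close> by blast
  qed
  moreover have "R 0 = 0" by (simp add: R_def relaxed_def inflow_def)
  moreover have "(R has_real_derivative ?c) (at 0)"
  proof -
    have sum_der: "((\<lambda>t. \<Sum>i\<in>UNIV - {j}. (1 - exp (- (q i * t))) * (Q $ i $ j / q i) * a i) has_real_derivative (\<Sum>i\<in>UNIV - {j}. Q $ i $ j * a i)) (at 0)"
    proof (rule DERIV_sum)
      fix i assume "i \<in> UNIV - {j}"
      then have "q i \<noteq> 0" using q_pos[of i j] by auto
      then show "((\<lambda>t. (1 - exp (- (q i * t))) * (Q $ i $ j / q i) * a i) has_real_derivative Q $ i $ j * a i) (at 0)"
        by (auto intro!: derivative_eq_intros)
    qed
    have "((\<lambda>t. a j - exp (- (q j * t)) * exp (l * t) * relaxed t) has_real_derivative (q j - l) * a j + l * b) (at 0)"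
      unfolding relaxed_def by (auto intro!: derivative_eq_intros simp: algebra_simps)
    from DERIV_diff[OF this sum_der] show ?thesis by (simp add: R_def[abs_def] relaxed_def inflow_def)
  qed
  ultimately have "?c = 0" using derivative_zero_at_right[OF _ _ K(1)] by blast
  then show ?thesis by (simp add: a_def b_def f_def algebra_simps)
qed

end

section \<open>Invariance of the stationary law and conclusion\<close>

lemma open_indicator_lipschitz_approx:
  fixes U :: "'a::euclidean_space set"
  assumes "open U"
  shows "\<exists>h :: nat \<Rightarrow> 'a \<Rightarrow> real. (\<forall>n x. 0 \<le> h n x \<and> h n x \<le> 1) \<and> (\<forall>n x y. \<bar>h n x - h n y\<bar> \<le> real n * norm (x - y)) \<and>
     (\<forall>x. incseq (\<lambda>n. h n x)) \<and> (\<forall>x. (SUP n. ennreal (h n x)) = indicator U x)"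
proof (cases "U = UNIV")
  \<comment> \<open>\<open>infdist\<close> to the empty set is 0, so the formula of the other case
    would give the zero function here.\<close>
  case True
  then show ?thesis by (intro exI[of _ "\<lambda>_ _. 1"]) auto
next
  case False
  define h where "h n x = min 1 (real n * infdist x (- U))" for n x
  have closed: "closed (- U)" "- U \<noteq> {}" using assms False by auto
  have "\<bar>h n x - h n y\<bar> \<le> real n * norm (x - y)" for n x y
  proof -
    have "\<bar>infdist x (- U) - infdist y (- U)\<bar> \<le> norm (x - y)"
      using infdist_triangle[of x "- U" y] infdist_triangle[of y "- U" x] by (simp add: dist_norm norm_minus_commute)
    then have "real n * \<bar>infdist x (- U) - infdist y (- U)\<bar> \<le> real n * norm (x - y)"
      by (intro mult_left_mono) auto
    moreover have "\<bar>real n * infdist x (- U) - real n * infdist y (- U)\<bar> = real n * \<bar>infdist x (- U) - infdist y (- U)\<bar>"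
      by (simp add: right_diff_distrib[symmetric] abs_mult)
    ultimately show ?thesis unfolding h_def by linarith
  qed
  moreover have "incseq (\<lambda>n. h n x)" for x
    unfolding incseq_def h_def by (auto intro!: min.coboundedI2 mult_right_mono infdist_nonneg)
  moreover have "(SUP n. ennreal (h n x)) = indicator U x" for x
  proof (cases "x \<in> U")
    case True
    then have "infdist x (- U) > 0"
      using closed in_closed_iff_infdist_zero[OF closed, of x] infdist_nonneg[of x "- U"] by (simp add: less_le)
    then obtain n where "1 < real n * infdist x (- U)" using reals_Archimedean3 by blast
    then have "h n x = 1" by (simp add: h_def)
    then have "1 \<le> (SUP n. ennreal (h n x))" by (intro SUP_upper2[of n]) auto
    moreover have "(SUP n. ennreal (h n x)) \<le> 1" by (intro SUP_least) (simp add: h_def)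
    ultimately show ?thesis using True by simp
  next
    case False
    then have "infdist x (- U) = 0" by (intro infdist_zero) simp
    then show ?thesis using False by (simp add: h_def)
  qed
  moreover have "0 \<le> h n x \<and> h n x \<le> 1" for n x by (simp add: h_def infdist_nonneg)
  ultimately show ?thesis by (intro exI[of _ h]) blast
qed

text \<open>Open sets form an intersection-stable generator, and the measure of an open set is an
  increasing limit of integrals of Lipschitz functions.\<close>

lemma borel_measure_eqI_lipschitz:
  fixes \<mu> \<nu> :: "'a::euclidean_space measure"
  assumes sets: "sets \<mu> = sets borel" "sets \<nu> = sets borel" and fin: "emeasure \<mu> UNIV \<noteq> \<infinity>"
    and eq: "\<And>h C. (\<And>x. 0 \<le> h x) \<Longrightarrow> (\<And>x. h x \<le> 1) \<Longrightarrow> (\<And>x y. \<bar>h x - h y\<bar> \<le> C * norm (x - y)) \<Longrightarrow>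
      (\<integral>\<^sup>+x. ennreal (h x) \<partial>\<mu>) = (\<integral>\<^sup>+x. ennreal (h x) \<partial>\<nu>)"
  shows "\<mu> = \<nu>"
proof (rule measure_eqI_generator_eq[where E = "{S. open S}" and \<Omega> = UNIV and A = "\<lambda>_. UNIV"])
  show "Int_stable {S :: 'a set. open S}" by (auto simp: Int_stable_def)
  show "sets \<mu> = sigma_sets UNIV {S. open S}" "sets \<nu> = sigma_sets UNIV {S. open S}"
    by (simp_all add: sets borel_def)
  fix U :: "'a set" assume "U \<in> {S. open S}"
  then have U: "open U" by simp
  obtain h :: "nat \<Rightarrow> 'a \<Rightarrow> real" where h: "\<And>n x. 0 \<le> h n x" "\<And>n x. h n x \<le> 1"
      "\<And>n x y. \<bar>h n x - h n y\<bar> \<le> real n * norm (x - y)" "\<And>x. incseq (\<lambda>n. h n x)"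
      "\<And>x. (SUP n. ennreal (h n x)) = indicator U x"
    using open_indicator_lipschitz_approx[OF U] by blast
  have "h n \<in> borel_measurable borel" for n
  proof (rule borel_measurable_continuous_onI)
    have "(real n)-lipschitz_on UNIV (h n)"
      using h(3) by (intro lipschitz_onI) (auto simp: dist_norm)
    then show "continuous_on UNIV (h n)" by (rule lipschitz_on_continuous_on)
  qed
  then have meas: "h n \<in> borel_measurable m" if "sets m = sets borel" for n m
    using measurable_cong_sets[OF that refl] by blast
  have em: "emeasure m U = (SUP n. \<integral>\<^sup>+x. ennreal (h n x) \<partial>m)" if m: "sets m = sets borel" for m
  proof -
    have "emeasure m U = (\<integral>\<^sup>+x. (SUP n. ennreal (h n x)) \<partial>m)"
      using U m by (simp add: h(5))
    also have "\<dots> = (SUP n. \<integral>\<^sup>+x. ennreal (h n x) \<partial>m)"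
      using h(4) meas[OF m]
      by (intro nn_integral_monotone_convergence_SUP) (auto simp: incseq_def le_fun_def intro!: ennreal_leI)
    finally show ?thesis .
  qed
  show "emeasure \<mu> U = emeasure \<nu> U"
    unfolding em[OF sets(1)] em[OF sets(2)] using eq[of "h n" "real n" for n] h by simp
qed (use fin in auto)

text \<open>In finite dimension, continuity of all directional derivatives is continuity in operator
  norm.\<close>

lemma smooth_imp_C1:
  fixes f :: "'a::euclidean_space \<Rightarrow> 'a"
  assumes "smooth f"
  shows "\<exists>f'. (\<forall>x. (f has_derivative blinfun_apply (f' x)) (at x)) \<and> continuous_on UNIV f'"
proof -
  define f' where "f' x = Blinfun (frechet_derivative f (at x))" for x
  have der: "(f has_derivative frechet_derivative f (at x)) (at x)" for x
    using smooth_imp_differentiable[OF assms] by (rule differentiable_has_frechet)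
  have f': "blinfun_apply (f' x) = frechet_derivative f (at x)" for x
    unfolding f'_def using der has_derivative_bounded_linear by (intro bounded_linear_Blinfun_apply) blast
  have "continuous_on UNIV f'"
  proof (rule continuous_on_blinfun_componentwise)
    show "continuous_on UNIV (\<lambda>x. blinfun_apply (f' x) h)" for h
      using assms unfolding f' smooth_def by (metis Ck.simps)
  qed
  then show ?thesis using der f' by (intro exI[of _ f']) simp
qed

section \<open>Invariance of the initial law under K\<close>

locale stationary_jumps_cart = stationary_jumps v v' \<phi> B \<Omega> M Q X I Y S
  for v :: "'n::finite \<Rightarrow> real^'d \<Rightarrow> real^'d" and v' \<phi> B and \<Omega> :: "'w measure" and M Q X I Y S
begin

text \<open>Uniformization: jumps of the chain are embedded in a Poisson clock of rate \<open>\<Lambda>\<close> whose ticks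
  may also leave the state unchanged; all entries of the transition matrix \<open>P\<close> are then positive.\<close>

definition \<Lambda> :: real where "\<Lambda> = 1 + (\<Sum>i\<in>UNIV. q i)"

definition P :: "'n \<Rightarrow> 'n \<Rightarrow> real" where
  "P i j = (if i = j then 1 - q i / \<Lambda> else Q $ i $ j / \<Lambda>)"

lemma Lambda_gt: "q i < \<Lambda>"
proof -
  have "q i \<le> (\<Sum>i\<in>UNIV. q i)" using q_nonneg by (intro member_le_sum) auto
  then show ?thesis by (simp add: \<Lambda>_def)
qed

lemma Lambda_positive: "0 < \<Lambda>"
  using Lambda_gt q_nonneg le_less_trans by blast

sublocale switching v v' \<phi> B \<Lambda> P
proof
  show "0 < \<Lambda>" by (rule Lambda_positive)
  show "0 < P i j" for i j
    using Lambda_gt[of i] Lambda_positive Q_pos[of i j] by (cases "i = j") (auto simp: P_def)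
  show "(\<Sum>j\<in>UNIV. P i j) = 1" for i
  proof -
    have "(\<Sum>j\<in>UNIV. P i j) = P i i + (\<Sum>j\<in>UNIV - {i}. P i j)" by (rule sum.remove) auto
    also have "(\<Sum>j\<in>UNIV - {i}. P i j) = (\<Sum>j\<in>UNIV - {i}. Q $ i $ j) / \<Lambda>"
      unfolding sum_divide_distrib by (intro sum.cong) (auto simp: P_def)
    finally show ?thesis by (simp add: P_def Q_sum)
  qed
qed

text \<open>The part of the stationary law on copy i, read off at time 0, with \<open>Y 0\<close> in
  place of the almost surely equal \<open>I 0\<close>.\<close>

definition law :: "'n \<Rightarrow> (real^'d) measure" where
  "law i = distr (density \<Omega> (indicator (Start i))) borel (X 0)"

lemma sets_law [simp]: "sets (law i) = sets borel" by (simp add: law_def)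

lemma nn_integral_law:
  "h \<in> borel_measurable borel \<Longrightarrow> (\<integral>\<^sup>+x. h x \<partial>law i) = (\<integral>\<^sup>+\<omega>. indicator (Start i) \<omega> * h (X 0 \<omega>) \<partial>\<Omega>)"
  unfolding law_def by (simp add: nn_integral_distr nn_integral_density)

lemma emeasure_law_UNIV: "emeasure (law i) UNIV \<noteq> \<infinity>"
proof -
  have "space (law i) = UNIV" by (simp add: law_def)
  then have "emeasure (law i) UNIV = (\<integral>\<^sup>+x. 1 \<partial>law i)" by simp
  also have "\<dots> = (\<integral>\<^sup>+\<omega>. indicator (Start i) \<omega> * 1 \<partial>\<Omega>)" by (rule nn_integral_law) simp
  also have "\<dots> = emeasure \<Omega> (Start i)" by simp
  finally show ?thesis by simp
qed

lemma nn_integral_law_real: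
  assumes "g \<in> borel_measurable borel" "\<And>x. 0 \<le> g x" "\<And>x. g x \<le> 1"
  shows "(\<integral>\<^sup>+x. ennreal (g x) \<partial>law i) = ennreal (expectation (\<lambda>\<omega>. indicator (Start i) \<omega> * g (X 0 \<omega>)))"
proof -
  note [measurable] = assms(1)
  have "(\<integral>\<^sup>+x. ennreal (g x) \<partial>law i) = (\<integral>\<^sup>+\<omega>. ennreal (indicator (Start i) \<omega> * g (X 0 \<omega>)) \<partial>\<Omega>)"
    by (subst nn_integral_law) (auto simp: indicator_def intro!: nn_integral_cong)
  also have "\<dots> = ennreal (expectation (\<lambda>\<omega>. indicator (Start i) \<omega> * g (X 0 \<omega>)))"
    using assms by (intro nn_integral_eq_integral integrable_bounded[of _ 1]) (auto simp: indicator_def)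
  finally show ?thesis .
qed

text \<open>The component j of the image of \<open>law\<close> under one step of \<open>K\<close>.
  It is built as a measure, with an independent exponential time as second coordinate, so that a
  comparison with \<open>law j\<close> on Lipschitz functions is enough.\<close>

definition law' :: "'n \<Rightarrow> (real^'d) measure" where
  "law' j = distr (density (\<Omega> \<Otimes>\<^sub>M lborel) (\<lambda>(\<omega>, t). ennreal (P (Y 0 \<omega>) j) * ennreal (exponential_density \<Lambda> t)))
     borel (\<lambda>(\<omega>, t). \<phi> j t (X 0 \<omega>))"

lemma nn_integral_law':
  assumes [measurable]: "h \<in> borel_measurable borel"
  shows "(\<integral>\<^sup>+x. h x \<partial>law' j) = (\<Sum>i\<in>UNIV. ennreal (P i j) * (\<integral>\<^sup>+x. T j h x \<partial>law i))"
proof -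
  have PY[measurable]: "(\<lambda>\<omega>. ennreal (P (Y 0 \<omega>) j)) \<in> borel_measurable \<Omega>"
    using measurable_compose[OF measurable_Y[of 0], of "\<lambda>i. ennreal (P i j)" borel] by simp
  have "(\<integral>\<^sup>+x. h x \<partial>law' j) = (\<integral>\<^sup>+(\<omega>, t). ennreal (P (Y 0 \<omega>) j) * ennreal (exponential_density \<Lambda> t) * h (\<phi> j t (X 0 \<omega>)) \<partial>(\<Omega> \<Otimes>\<^sub>M lborel))"
    unfolding law'_def by (simp add: nn_integral_distr nn_integral_density case_prod_beta')
  also have "\<dots> = (\<integral>\<^sup>+\<omega>. \<integral>\<^sup>+t. ennreal (P (Y 0 \<omega>) j) * ennreal (exponential_density \<Lambda> t) * h (\<phi> j t (X 0 \<omega>)) \<partial>lborel \<partial>\<Omega>)"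
    by (subst lborel.nn_integral_fst[symmetric]) (simp_all add: case_prod_beta')
  also have "\<dots> = (\<integral>\<^sup>+\<omega>. ennreal (P (Y 0 \<omega>) j) * T j h (X 0 \<omega>) \<partial>\<Omega>)"
    unfolding T_def by (simp add: nn_integral_cmult[symmetric] mult.assoc)
  also have "\<dots> = (\<integral>\<^sup>+\<omega>. (\<Sum>i\<in>UNIV. ennreal (P i j) * (indicator (Start i) \<omega> * T j h (X 0 \<omega>))) \<partial>\<Omega>)"
  proof (rule nn_integral_cong)
    fix \<omega> assume "\<omega> \<in> space \<Omega>"
    then have "(\<Sum>i\<in>UNIV. ennreal (P i j) * (indicator (Start i) \<omega> * T j h (X 0 \<omega>)))
      = (\<Sum>i\<in>UNIV. if i = Y 0 \<omega> then ennreal (P i j) * T j h (X 0 \<omega>) else 0)"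
      by (intro sum.cong) (auto simp: Start_def indicator_def)
    then show "ennreal (P (Y 0 \<omega>) j) * T j h (X 0 \<omega>) = (\<Sum>i\<in>UNIV. ennreal (P i j) * (indicator (Start i) \<omega> * T j h (X 0 \<omega>)))"
      by simp
  qed
  also have "\<dots> = (\<Sum>i\<in>UNIV. ennreal (P i j) * (\<integral>\<^sup>+\<omega>. indicator (Start i) \<omega> * T j h (X 0 \<omega>) \<partial>\<Omega>))"
  proof -
    have meas: "(\<lambda>\<omega>. indicator (Start i) \<omega> * T j h (X 0 \<omega>)) \<in> borel_measurable \<Omega>" for i
      by (intro borel_measurable_times_ennreal measurable_compose[OF measurable_X0 measurable_T]) auto
    then show ?thesis by (subst nn_integral_sum) (auto simp: nn_integral_cmult)
  qed
  also have "\<dots> = (\<Sum>i\<in>UNIV. ennreal (P i j) * (\<integral>\<^sup>+x. T j h x \<partial>law i))"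
    by (simp add: nn_integral_law measurable_T)
  finally show ?thesis .
qed

lemma law_eq_law': "law j = law' j"
proof (rule borel_measure_eqI_lipschitz)
  fix h :: "real^'d \<Rightarrow> real" and C
  assume h: "\<And>x. 0 \<le> h x" "\<And>x. h x \<le> 1" and lip: "\<And>x y. \<bar>h x - h y\<bar> \<le> C * norm (x - y)"
  have "continuous_on UNIV h"
  proof -
    have "\<bar>C\<bar>-lipschitz_on UNIV h"
      using order_trans[OF lip mult_right_mono[OF abs_ge_self norm_ge_zero]]
      by (intro lipschitz_onI) (auto simp: dist_norm)
    then show ?thesis by (rule lipschitz_on_continuous_on)
  qed
  note hc = this h
  have [measurable]: "h \<in> borel_measurable borel" using hc(1) by (rule borel_measurable_continuous_onI)
  let ?f = "resolvent \<Lambda> j h"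
  let ?a = "\<lambda>i. expectation (\<lambda>\<omega>. indicator (Start i) \<omega> * ?f (X 0 \<omega>))"
  have f[measurable]: "?f \<in> borel_measurable borel"
    by (rule borel_measurable_continuous_onI[OF continuous_resolvent[OF Lambda_positive hc]])
  have f01: "0 \<le> ?f x" "?f x \<le> 1" for x using resolvent_bounds[OF Lambda_positive hc] by auto
  have a0: "0 \<le> ?a i" for i using f01 by (intro integral_nonneg_AE) auto
  have T_h: "T j (\<lambda>x. ennreal (h x)) = (\<lambda>x. ennreal (?f x))"
    by (simp add: fun_eq_iff T_def nn_integral_resolvent[OF Lambda_positive hc])
  have "(\<integral>\<^sup>+x. ennreal (h x) \<partial>law' j) = (\<Sum>i\<in>UNIV. ennreal (P i j) * (\<integral>\<^sup>+x. ennreal (?f x) \<partial>law i))"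
    by (subst nn_integral_law') (simp_all add: T_h)
  also have "\<dots> = (\<Sum>i\<in>UNIV. ennreal (P i j * ?a i))"
    using f01 P_pos a0 by (simp add: nn_integral_law_real ennreal_mult less_imp_le)
  also have "\<dots> = ennreal (\<Sum>i\<in>UNIV. P i j * ?a i)"
    using P_pos a0 by (intro sum_ennreal) (simp add: less_imp_le)
  also have "(\<Sum>i\<in>UNIV. P i j * ?a i) = expectation (\<lambda>\<omega>. indicator (Start j) \<omega> * h (X 0 \<omega>))"
  proof -
    have "(\<Sum>i\<in>UNIV. P i j * ?a i) = P j j * ?a j + (\<Sum>i\<in>UNIV - {j}. P i j * ?a i)" by (rule sum.remove) auto
    also have "(\<Sum>i\<in>UNIV - {j}. P i j * ?a i) = (\<Sum>i\<in>UNIV - {j}. Q $ i $ j * ?a i) / \<Lambda>"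
      unfolding sum_divide_distrib by (intro sum.cong) (auto simp: P_def)
    \<comment> \<open>Multiplication by \<Lambda> turns \<open>P j j\<close> into \<Lambda> - q j
      and the other entries into jump rates, which gives the right-hand side of
      \<open>resolvent_identity\<close> for the parameter \<Lambda>.\<close>
    finally have "\<Lambda> * (\<Sum>i\<in>UNIV. P i j * ?a i) = (\<Lambda> - q j) * ?a j + (\<Sum>i\<in>UNIV - {j}. Q $ i $ j * ?a i)"
      using Lambda_positive by (simp add: P_def field_simps)
    also have "\<dots> = \<Lambda> * expectation (\<lambda>\<omega>. indicator (Start j) \<omega> * h (X 0 \<omega>))"
      by (rule resolvent_identity[OF Lambda_positive hc lip, symmetric])
    finally show ?thesis using Lambda_positive by simp
  qed
  finally show "(\<integral>\<^sup>+x. ennreal (h x) \<partial>law j) = (\<integral>\<^sup>+x. ennreal (h x) \<partial>law' j)"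
    using h by (simp add: nn_integral_law_real)
qed (use emeasure_law_UNIV in \<open>simp_all add: law'_def\<close>)

lemma law_invariant:
  assumes "\<And>i. h i \<in> borel_measurable borel"
  shows "(\<Sum>i\<in>UNIV. \<integral>\<^sup>+x. K h i x \<partial>law i) = (\<Sum>i\<in>UNIV. \<integral>\<^sup>+x. h i x \<partial>law i)"
proof -
  have meas: "T j (h j) \<in> borel_measurable (law i)" for i j
    using measurable_T[OF assms] by (simp add: measurable_cong_sets[OF sets_law refl])
  have "(\<Sum>i\<in>UNIV. \<integral>\<^sup>+x. K h i x \<partial>law i) = (\<Sum>i\<in>UNIV. \<Sum>j\<in>UNIV. ennreal (P i j) * (\<integral>\<^sup>+x. T j (h j) x \<partial>law i))"
    unfolding K_def using meas by (simp add: nn_integral_sum nn_integral_cmult)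
  also have "\<dots> = (\<Sum>j\<in>UNIV. \<Sum>i\<in>UNIV. ennreal (P i j) * (\<integral>\<^sup>+x. T j (h j) x \<partial>law i))"
    by (rule sum.swap)
  also have "\<dots> = (\<Sum>j\<in>UNIV. \<integral>\<^sup>+x. h j x \<partial>law' j)" using assms by (simp add: nn_integral_law')
  finally show ?thesis by (simp add: law_eq_law')
qed

lemma AE_law_in_M: "AE x in law i. x \<in> M"
proof -
  have M: "M \<in> sets borel" using compact_M by (simp add: compact_imp_closed)
  have "emeasure (law i) (- M) = (\<integral>\<^sup>+x. indicator (- M) x \<partial>law i)" using M by simp
  also have "\<dots> = (\<integral>\<^sup>+\<omega>. indicator (Start i) \<omega> * indicator (- M) (X 0 \<omega>) \<partial>\<Omega>)"
    using M by (intro nn_integral_law) auto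
  also have "\<dots> = (\<integral>\<^sup>+\<omega>. 0 \<partial>\<Omega>)" using X_in_M by (intro nn_integral_cong) simp
  finally have "emeasure (law i) (- M) = 0" by simp
  then show ?thesis using M by (intro AE_I[of _ _ "- M"]) auto
qed

section \<open>Return to the product of M and the index set\<close>

lemma emeasure_PDMP_law:
  assumes A: "A \<in> sets (restrict_space borel M \<Otimes>\<^sub>M count_space UNIV)"
  shows "emeasure (PDMP_law M \<Omega> X I 0) A = (\<Sum>i\<in>UNIV. emeasure (law i) ((\<lambda>x. (x, i)) -` A))"
    and "(\<lambda>x. (x, i)) -` A \<in> sets borel" and "(\<lambda>x. (x, i)) -` A \<subseteq> M"
proof -
  have M: "M \<in> sets borel" using compact_M by (simp add: compact_imp_closed)
  show sub: "(\<lambda>x. (x, i)) -` A \<subseteq> M" for i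
    using sets.sets_into_space[OF A] by (auto simp: space_pair_measure space_restrict_space)
  show Ai: "(\<lambda>x. (x, i)) -` A \<in> sets borel" for i
  proof -
    have "(\<lambda>x. (x, i)) -` A \<inter> space (restrict_space borel M) \<in> sets (restrict_space borel M)"
      by (rule measurable_sets[OF _ A]) measurable
    moreover have "(\<lambda>x. (x, i)) -` A \<inter> space (restrict_space borel M) = (\<lambda>x. (x, i)) -` A"
      using sub[of i] by (auto simp: space_restrict_space)
    ultimately show ?thesis using M by (simp add: sets_restrict_space_iff)
  qed
  have XI: "(\<lambda>\<omega>. (X 0 \<omega>, I 0 \<omega>)) \<in> \<Omega> \<rightarrow>\<^sub>M restrict_space borel M \<Otimes>\<^sub>M count_space UNIV"
    by (intro measurable_Pair X_meas I_meas) auto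
  have "emeasure (PDMP_law M \<Omega> X I 0) A = (\<integral>\<^sup>+\<omega>. indicator A (X 0 \<omega>, I 0 \<omega>) \<partial>\<Omega>)"
    unfolding PDMP_law_def using A XI
    by (subst nn_integral_indicator[symmetric]) (simp_all add: nn_integral_distr del: nn_integral_indicator)
  also have "\<dots> = (\<integral>\<^sup>+\<omega>. (\<Sum>i\<in>UNIV. indicator (Start i) \<omega> * indicator ((\<lambda>x. (x, i)) -` A) (X 0 \<omega>)) \<partial>\<Omega>)"
  proof (rule nn_integral_cong_AE)
    show "AE \<omega> in \<Omega>. indicator A (X 0 \<omega>, I 0 \<omega>) = (\<Sum>i\<in>UNIV. indicator (Start i) \<omega> * indicator ((\<lambda>x. (x, i)) -` A) (X 0 \<omega>) :: ennreal)"
      using AE_I0_eq_Y0 AE_space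
    proof eventually_elim
      case (elim \<omega>)
      then have "(\<Sum>i\<in>UNIV. indicator (Start i) \<omega> * indicator ((\<lambda>x. (x, i)) -` A) (X 0 \<omega>) :: ennreal)
        = (\<Sum>i\<in>UNIV. if i = I 0 \<omega> then indicator A (X 0 \<omega>, i) else 0)"
        by (intro sum.cong) (auto simp: Start_def indicator_def)
      then show ?case by simp
    qed
  qed
  also have "\<dots> = (\<Sum>i\<in>UNIV. \<integral>\<^sup>+\<omega>. indicator (Start i) \<omega> * indicator ((\<lambda>x. (x, i)) -` A) (X 0 \<omega>) \<partial>\<Omega>)"
    using Ai by (intro nn_integral_sum borel_measurable_times_ennreal
        measurable_compose[OF measurable_X0 borel_measurable_indicator]) auto
  also have "\<dots> = (\<Sum>i\<in>UNIV. emeasure (law i) ((\<lambda>x. (x, i)) -` A))"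
    using Ai by (simp add: nn_integral_law[symmetric])
  finally show "emeasure (PDMP_law M \<Omega> X I 0) A = (\<Sum>i\<in>UNIV. emeasure (law i) ((\<lambda>x. (x, i)) -` A))" .
qed

text \<open>Both measures are computed slice by slice; the slices of a measurable subset of the
  product lie in \<open>M\<close>, so restricting Lebesgue measure to \<open>M\<close> does not
  change the integrals.\<close>

lemma PDMP_law_eq_density:
  assumes g: "\<And>i. lsc (g i)" and law: "\<And>i. law i = density lborel (g i)"
  shows "PDMP_law M \<Omega> X I 0 = density (lebesgue_on_copies M) (\<lambda>(x, i). g i x)"
proof (rule measure_eqI)
  have sets_eq: "sets (lebesgue_on_copies M :: ((real^'d) \<times> 'n) measure) = sets (restrict_space borel M \<Otimes>\<^sub>M count_space UNIV)"
    unfolding lebesgue_on_copies_def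
    by (intro sets_pair_measure_cong sets_restrict_space_cong refl) simp
  show "sets (PDMP_law M \<Omega> X I 0) = sets (density (lebesgue_on_copies M) (\<lambda>(x, i). g i x))"
    by (simp add: PDMP_law_def sets_eq)
  have M: "M \<in> sets borel" using compact_M by (simp add: compact_imp_closed)
  note [measurable] = lsc_borel_measurable[OF g]
  fix A assume "A \<in> sets (PDMP_law M \<Omega> X I 0)"
  then have A: "A \<in> sets (restrict_space borel M \<Otimes>\<^sub>M count_space UNIV)" by (simp add: PDMP_law_def)
  let ?R = "restrict_space lborel M" and ?C = "count_space UNIV :: 'n measure"
  have gR: "g i \<in> borel_measurable ?R" for i
    using measurable_restrict_space1[of "g i" lborel borel M] by simp
  have f: "(\<lambda>(x, i). g i x) \<in> borel_measurable (?R \<Otimes>\<^sub>M ?C)"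
    unfolding case_prod_beta
    by (rule measurable_compose_countable[OF measurable_compose[OF measurable_fst gR] measurable_snd])
  have A': "A \<in> sets (?R \<Otimes>\<^sub>M ?C)" using A sets_eq unfolding lebesgue_on_copies_def by simp
  interpret C: sigma_finite_measure ?C by (rule sigma_finite_measure_count_space)
  have "emeasure (density (lebesgue_on_copies M) (\<lambda>(x, i). g i x)) A
    = (\<integral>\<^sup>+p. (\<lambda>(x, i). g i x) p * indicator A p \<partial>(?R \<Otimes>\<^sub>M ?C))"
    unfolding lebesgue_on_copies_def using A' f by (rule emeasure_density[rotated])
  also have "\<dots> = (\<integral>\<^sup>+x. \<integral>\<^sup>+i. (\<lambda>(x, i). g i x) (x, i) * indicator A (x, i) \<partial>?C \<partial>?R)"
    using A' f by (intro C.nn_integral_fst[symmetric] borel_measurable_times_ennreal) auto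
  also have "\<dots> = (\<integral>\<^sup>+x. (\<Sum>i\<in>UNIV. g i x * indicator ((\<lambda>x. (x, i)) -` A) x) * indicator M x \<partial>lborel)"
    using M by (subst nn_integral_restrict_space) (auto simp: nn_integral_count_space_finite indicator_def)
  also have "\<dots> = (\<integral>\<^sup>+x. (\<Sum>i\<in>UNIV. g i x * indicator ((\<lambda>x. (x, i)) -` A) x) \<partial>lborel)"
    using emeasure_PDMP_law(3)[OF A] by (intro nn_integral_cong) (auto simp: indicator_def intro!: sum.cong)
  also have "\<dots> = (\<Sum>i\<in>UNIV. \<integral>\<^sup>+x. g i x * indicator ((\<lambda>x. (x, i)) -` A) x \<partial>lborel)"
    using emeasure_PDMP_law(2)[OF A] by (intro nn_integral_sum borel_measurable_times_ennreal) auto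
  also have "\<dots> = (\<Sum>i\<in>UNIV. emeasure (law i) ((\<lambda>x. (x, i)) -` A))"
    using emeasure_PDMP_law(2)[OF A] by (simp add: law emeasure_density)
  also have "\<dots> = emeasure (PDMP_law M \<Omega> X I 0) A" by (rule emeasure_PDMP_law(1)[OF A, symmetric])
  finally show "emeasure (PDMP_law M \<Omega> X I 0) A = emeasure (density (lebesgue_on_copies M) (\<lambda>(x, i). g i x)) A" ..
qed

end

text \<open>Singletons are open in the discrete factor, so superlevel sets are unions of open
  slices.\<close>

lemma lower_semicontinuous_map_copies:
  fixes g :: "'n \<Rightarrow> 'a::topological_space \<Rightarrow> ennreal"
  assumes "\<And>i. lsc (g i)"
  shows "lower_semicontinuous_map (prod_topology (top_of_set M) (discrete_topology UNIV)) (\<lambda>(x, i). g i x)"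
  unfolding lower_semicontinuous_map_def
proof
  fix a
  let ?T = "prod_topology (top_of_set M) (discrete_topology (UNIV :: 'n set))"
  have "openin ?T ((M \<inter> {x. a < g i x}) \<times> {i})" for i
    using assms[of i] by (intro openin_prod_Times_iff[THEN iffD2]) (auto simp: lsc_def openin_open)
  then have "openin ?T (\<Union>i. (M \<inter> {x. a < g i x}) \<times> {i})" by (intro openin_Union) auto
  moreover have "(\<Union>i. (M \<inter> {x. a < g i x}) \<times> {i}) = {z \<in> topspace ?T. a < (\<lambda>(x, i). g i x) z}" by auto
  ultimately show "openin ?T {z \<in> topspace ?T. a < (\<lambda>(x, i). g i x) z}" by simp
qed

theorem theorem2p5:
  fixes v :: "'n::finite \<Rightarrow> real^'d \<Rightarrow> real^'d"
    and \<phi> :: "'n \<Rightarrow> real \<Rightarrow> real^'d \<Rightarrow> real^'d"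
    and M :: "(real^'d) set"
    and xstar :: "real^'d"
    and Q :: "real^'n^'n"
    and \<Omega> :: "'w measure"
    and X :: "real \<Rightarrow> 'w \<Rightarrow> real^'d"
    and I :: "real \<Rightarrow> 'w \<Rightarrow> 'n"
    and \<pi> :: "((real^'d) \<times> 'n) measure"
  assumes "\<And>i. smooth (v i)"
    and "\<And>i. bounded (range (v i))"
    and "\<And>i. is_flow (v i) (\<phi> i)"
    and "compact M"
    and "forward_invariant \<phi> M"
    and "xstar \<in> M"
    and "accessible \<phi> M xstar"
    and "weak_Hormander v xstar"
    and "Q \<in> positive_rate_matrices"
    and "stationary_distribution_via v M Q \<Omega> X I \<pi>"
  shows "\<exists>f. lower_semicontinuous_map (prod_topology (top_of_set M) (discrete_topology UNIV)) f
           \<and> \<pi> = density (lebesgue_on_copies M) f"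
proof -
  have "\<forall>i. \<exists>v'. (\<forall>x. (v i has_derivative blinfun_apply (v' x)) (at x)) \<and> continuous_on UNIV v'"
    using smooth_imp_C1[OF assms(1)] by blast
  from choice[OF this] obtain v' where v': "\<And>i x. (v i has_derivative blinfun_apply (v' i x)) (at x)"
    "\<And>i. continuous_on UNIV (v' i)" by blast
  have "\<forall>i. \<exists>b. \<forall>x. norm (v i x) \<le> b" using assms(2) by (auto simp: bounded_iff)
  from choice[OF this] obtain b where b: "\<And>i x. norm (v i x) \<le> b i" by blast
  \<comment> \<open>One speed bound for all fields: the individual bounds are nonnegative, so their
    sum dominates each of them.\<close>
  define B where "B = (\<Sum>i\<in>UNIV. b i)"
  have "0 \<le> b i" for i by (rule order_trans[OF norm_ge_zero b[of i 0]])
  then have "b i \<le> B" for i unfolding B_def by (intro member_le_sum) auto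
  then have B: "norm (v i x) \<le> B" for i x by (rule order_trans[OF b])
  have PDMP: "PDMP v M Q \<Omega> X I" and \<pi>: "\<And>t. 0 \<le> t \<Longrightarrow> PDMP_law M \<Omega> X I t = \<pi>"
    using assms(10) by (auto simp: stationary_distribution_via_def)
  interpret prob_space \<Omega> using PDMP by (simp add: PDMP_def)
  obtain Y S where "jump_hold_law \<Omega> Q (X 0) Y S" "AE \<omega> in \<Omega>. \<forall>k. \<forall>t\<ge>0.
      (\<Sum>m<k. S m \<omega>) \<le> ennreal t \<and> ennreal t < (\<Sum>m<Suc k. S m \<omega>) \<longrightarrow> I t \<omega> = Y k \<omega>"
    using PDMP unfolding PDMP_def markov_chain_rates_def by blast
  then interpret stationary_jumps_cart v v' \<phi> B \<Omega> M Q X I Y S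
    using v' B assms(3-5,9) PDMP \<pi>
    by unfold_locales (auto simp: PDMP_def markov_chain_rates_def)
  obtain g where g: "\<forall>i. lsc (g i)" "\<forall>i. law i = density lborel (g i)"
    using invariant_imp_lsc_density[OF assms(1,7,8) sets_law emeasure_law_UNIV AE_law_in_M law_invariant] by blast
  have "\<pi> = density (lebesgue_on_copies M) (\<lambda>(x, i). g i x)"
    using PDMP_law_eq_density[of g] g \<pi>[of 0] by simp
  moreover have "lower_semicontinuous_map (prod_topology (top_of_set M) (discrete_topology UNIV)) (\<lambda>(x, i). g i x)"
    using g(1) by (intro lower_semicontinuous_map_copies) simp
  ultimately show ?thesis by blast
qed

end
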